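(* Let $(\mathcal{N},G)$ be a complete Riemannian manifold with norm $\|v\|:=\sqrt{G(v,v)}$ on the tangent bundle $T\mathcal{N}$, let $D\subset\mathcal{N}$ be simply connected and open, and let $F:\mathcal{N}\to T\mathcal{N}$ be a twice differentiable vector field with covariant derivative $J$, $J(x)v:=\nabla_vF_x$. Let $J(x)$ be invertible for $x\in D$ and choose $M(x)=J(x)^{-1}$ (the exact Newton method on manifolds). Assume that for all points $x,y\in D$ with $y=\exp_x(\Delta x)$, $\Delta x:=-M(x)F(x)$, and all $t\in[0,1]$, the following conditions hold along the geodesic $\gamma:[0,1]\to\mathcal{N}$, $\gamma(t):=\exp_x(-tM(x)F(x))$, with parallel transport $\mathcal{P}_{\alpha,\beta}:T_{\gamma(\alpha)}\mathcal{N}\to T_{\gamma(\beta)}\mathcal{N}$: (i) there exists $\omega<\infty$ (independent of $x,y,t$) with $\|M(y)(\mathcal{P}_{t,1}J(\gamma(t))\mathcal{P}_{0,t}-\mathcal{P}_{0,1}J(x))\Delta x\|\le\omega t\|\Delta x\|^2$; (ii) there is a constant $\kappa<1$ such that the function $\tilde\kappa(x)$ defined by $\|M(y)\mathcal{P}_{0,1}(F(x)+J(x)\Delta x)\|=:\tilde\kappa(x)\|\Delta x\|$ satisfies $\tilde\kappa(x)\le\kappa$. Let $x_0\in D$ satisfy $\delta_0:=\kappa+\frac{\omega}{2}\|M(x_0)F(x_0)\|<1$, let $x_{k+1}:=\exp_{x_k}(-M(x_k)F(x_k))$ for $k=0,1,\dots$, and let $\hat{x}$ be the limit of $(x_k)$,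 i.e. $\lim_{k\to\infty}d_G(x_k,\hat{x})=0$. Then the iteration converges locally quadratically, i.e. there are $\tilde{k}\in\mathbb{N}$ and $C<\infty$ such that $$d_G(x_{k+1},\hat{x})\le C\,d_G(x_k,\hat{x})^2\qquad\text{for all }k\ge\tilde{k}.$$
   Context: $\exp$ is the Riemannian exponential map, $\nabla$ the Riemannian (Levi-Civita) connection, and $d_G$ the geodesic distance on $\mathcal{N}$. The existence of the limit $\hat{x}$ of the iteration under the stated assumptions is part of the setting (the paper's general convergence theorem for Newton-like iterations on manifolds asserts that $(x_k)$ is well defined, stays in $D_0:=\{x\in D\mid d_G(x,x_0)\le\|M(x_0)F(x_0)\|/(1-\delta_0)\}$, and converges to some $\hat{x}\in D_0$). *)

theory Defs
  imports "HOL-Analysis.Analysis"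
begin

section \<open>Smooth manifolds\<close>

text \<open>
  The manifold is the whole type \<open>'a\<close>, modelled on a Euclidean space \<open>'e\<close>. A chart is a pair of
  its open domain and its coordinate map (with irrelevant values outside the domain).
\<close>

type_synonym ('a, 'e) chart = "'a set \<times> ('a \<Rightarrow> 'e)"

abbreviation chart_dom :: "('a, 'e) chart \<Rightarrow> 'a set" where
  "chart_dom c \<equiv> fst c"

abbreviation chart_map :: "('a, 'e) chart \<Rightarrow> 'a \<Rightarrow> 'e" where
  "chart_map c \<equiv> snd c"

definition chart_inv :: "('a, 'e) chart \<Rightarrow> 'e \<Rightarrow> 'a" where
  "chart_inv c = inv_into (chart_dom c) (chart_map c)"

text \<open>\<open>Ck_on k S f\<close> is meant for open sets \<open>S\<close>; since \<open>'e\<close> is finite-dimensional, continuity of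
  all iterated directional derivatives is continuity of the iterated Frechet derivatives.\<close>

primrec Ck_on :: "nat \<Rightarrow> 'e::euclidean_space set \<Rightarrow> ('e \<Rightarrow> 'f::real_normed_vector) \<Rightarrow> bool" where
  "Ck_on 0 S f \<longleftrightarrow> continuous_on S f"
| "Ck_on (Suc k) S f \<longleftrightarrow>
     (\<forall>z\<in>S. f differentiable (at z)) \<and> (\<forall>v. Ck_on k S (\<lambda>z. frechet_derivative f (at z) v))"

definition smooth_on :: "'e::euclidean_space set \<Rightarrow> ('e \<Rightarrow> 'f::real_normed_vector) \<Rightarrow> bool" where
  "smooth_on S f \<longleftrightarrow> (\<forall>k. Ck_on k S f)"

definition smooth_atlas ::
  "('a::{t2_space, second_countable_topology}, 'e::euclidean_space) chart set \<Rightarrow> bool" where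
  "smooth_atlas A \<longleftrightarrow>
     (\<forall>c\<in>A. open (chart_dom c) \<and> open (chart_map c ` chart_dom c) \<and>
        homeomorphism (chart_dom c) (chart_map c ` chart_dom c) (chart_map c) (chart_inv c)) \<and>
     (\<Union>c\<in>A. chart_dom c) = UNIV \<and>
     (\<forall>c\<in>A. \<forall>d\<in>A.
        smooth_on (chart_map c ` (chart_dom c \<inter> chart_dom d)) (chart_map d \<circ> chart_inv c))"


section \<open>Tangent vectors and vector fields\<close>

text \<open>
  Every tangent space is identified with \<open>'e\<close>: the vector \<open>v :: 'e\<close>, regarded as a tangent vector
  at \<open>p\<close>, is the one whose components with respect to the chart \<open>tangent_chart A p\<close> are \<open>v\<close>.
  Hence a vector field is a function \<open>'a \<Rightarrow> 'e\<close>, but its regularity (and that of every other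
  tensor field) only makes sense for its components with respect to a fixed chart, because
  \<open>tangent_chart A p\<close> jumps as \<open>p\<close> varies. None of the notions below depends on the choice.
\<close>

definition tangent_chart :: "('a, 'e) chart set \<Rightarrow> 'a \<Rightarrow> ('a, 'e) chart" where
  "tangent_chart A p = (SOME c. c \<in> A \<and> p \<in> chart_dom c)"

text \<open>\<open>chart_coords A c p\<close> maps a tangent vector at \<open>p\<close> to its components with respect to the chart
  \<open>c\<close>, and \<open>chart_vector A c p\<close> is its inverse.\<close>

definition chart_coords ::
  "('a, 'e::euclidean_space) chart set \<Rightarrow> ('a, 'e) chart \<Rightarrow> 'a \<Rightarrow> 'e \<Rightarrow> 'e" where
  "chart_coords A c p =
     frechet_derivative (chart_map c \<circ> chart_inv (tangent_chart A p))
       (at (chart_map (tangent_chart A p) p))"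

definition chart_vector ::
  "('a, 'e::euclidean_space) chart set \<Rightarrow> ('a, 'e) chart \<Rightarrow> 'a \<Rightarrow> 'e \<Rightarrow> 'e" where
  "chart_vector A c p =
     frechet_derivative (chart_map (tangent_chart A p) \<circ> chart_inv c) (at (chart_map c p))"

definition field_in_chart ::
  "('a, 'e::euclidean_space) chart set \<Rightarrow> ('a, 'e) chart \<Rightarrow> ('a \<Rightarrow> 'e) \<Rightarrow> 'e \<Rightarrow> 'e" where
  "field_in_chart A c X z = chart_coords A c (chart_inv c z) (X (chart_inv c z))"

definition fun_differentiable_at ::
  "('a, 'e::euclidean_space) chart set \<Rightarrow> ('a \<Rightarrow> real) \<Rightarrow> 'a \<Rightarrow> bool" where
  "fun_differentiable_at A f p \<longleftrightarrow>
     (\<forall>c\<in>A. p \<in> chart_dom c \<longrightarrow> (f \<circ> chart_inv c) differentiable (at (chart_map c p)))"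

definition field_differentiable_at ::
  "('a, 'e::euclidean_space) chart set \<Rightarrow> ('a \<Rightarrow> 'e) \<Rightarrow> 'a \<Rightarrow> bool" where
  "field_differentiable_at A X p \<longleftrightarrow>
     (\<forall>c\<in>A. p \<in> chart_dom c \<longrightarrow> field_in_chart A c X differentiable (at (chart_map c p)))"

definition field_twice_differentiable ::
  "('a, 'e::euclidean_space) chart set \<Rightarrow> ('a \<Rightarrow> 'e) \<Rightarrow> bool" where
  "field_twice_differentiable A X \<longleftrightarrow>
     (\<forall>c\<in>A. \<forall>z\<in>chart_map c ` chart_dom c.
        field_in_chart A c X differentiable (at z) \<and>
        (\<forall>v. (\<lambda>w. frechet_derivative (field_in_chart A c X) (at w) v) differentiable (at z)))"

text \<open>The derivative \<open>df\<^sub>p(v)\<close> of a function in the direction of a tangent vector.\<close>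

definition fun_deriv ::
  "('a, 'e::euclidean_space) chart set \<Rightarrow> ('a \<Rightarrow> real) \<Rightarrow> 'a \<Rightarrow> 'e \<Rightarrow> real" where
  "fun_deriv A f p =
     (let c = tangent_chart A p in frechet_derivative (f \<circ> chart_inv c) (at (chart_map c p)))"

definition lie_bracket ::
  "('a, 'e::euclidean_space) chart set \<Rightarrow> ('a \<Rightarrow> 'e) \<Rightarrow> ('a \<Rightarrow> 'e) \<Rightarrow> 'a \<Rightarrow> 'e" where
  "lie_bracket A X Y p =
     (let c = tangent_chart A p in
        frechet_derivative (field_in_chart A c Y) (at (chart_map c p)) (X p)
        - frechet_derivative (field_in_chart A c X) (at (chart_map c p)) (Y p))"


section \<open>Riemannian manifolds and the Levi-Civita connection\<close>

type_synonym ('a, 'e) metric_field = "'a \<Rightarrow> 'e \<Rightarrow> 'e \<Rightarrow> real"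

definition riemannian_manifold ::
  "('a::{t2_space, second_countable_topology}, 'e::euclidean_space) chart set \<Rightarrow>
   ('a, 'e) metric_field \<Rightarrow> bool" where
  "riemannian_manifold A G \<longleftrightarrow>
     smooth_atlas A \<and>
     (\<forall>p. bilinear (G p) \<and> (\<forall>v w. G p v w = G p w v) \<and> (\<forall>v. v \<noteq> 0 \<longrightarrow> G p v v > 0)) \<and>
     (\<forall>c\<in>A. \<forall>v w. smooth_on (chart_map c ` chart_dom c)
        (\<lambda>z. let p = chart_inv c z in G p (chart_vector A c p v) (chart_vector A c p w)))"

definition riem_norm :: "('a, 'e) metric_field \<Rightarrow> 'a \<Rightarrow> 'e \<Rightarrow> real" where
  "riem_norm G p v = sqrt (G p v v)"

text \<open>
  \<open>\<nabla> p v X\<close> stands for \<open>(\<nabla>\<^sub>v X)(p)\<close>, with \<open>v\<close> a tangent vector at \<open>p\<close> and \<open>X\<close> a vector field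
  that need only be differentiable at \<open>p\<close> (the value is irrelevant otherwise). For such \<open>X\<close>
  the Levi-Civita connection below is uniquely determined by the metric.
\<close>

type_synonym ('a, 'e) connection = "'a \<Rightarrow> 'e \<Rightarrow> ('a \<Rightarrow> 'e) \<Rightarrow> 'e"

definition affine_connection ::
  "('a, 'e::euclidean_space) chart set \<Rightarrow> ('a, 'e) connection \<Rightarrow> bool" where
  "affine_connection A nabla \<longleftrightarrow>
     (\<forall>p X. field_differentiable_at A X p \<longrightarrow> linear (\<lambda>v. nabla p v X)) \<and>
     (\<forall>p v X Y. field_differentiable_at A X p \<longrightarrow> field_differentiable_at A Y p \<longrightarrow>
        nabla p v (\<lambda>q. X q + Y q) = nabla p v X + nabla p v Y) \<and>
     (\<forall>p v f X. fun_differentiable_at A f p \<longrightarrow> field_differentiable_at A X p \<longrightarrow>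
        nabla p v (\<lambda>q. f q *\<^sub>R X q) = fun_deriv A f p v *\<^sub>R X p + f p *\<^sub>R nabla p v X)"

definition levi_civita_connection ::
  "('a, 'e::euclidean_space) chart set \<Rightarrow> ('a, 'e) metric_field \<Rightarrow> ('a, 'e) connection \<Rightarrow> bool" where
  "levi_civita_connection A G nabla \<longleftrightarrow>
     affine_connection A nabla \<and>
     (\<forall>p v X Y. field_differentiable_at A X p \<longrightarrow> field_differentiable_at A Y p \<longrightarrow>
        fun_deriv A (\<lambda>q. G q (X q) (Y q)) p v = G p (nabla p v X) (Y p) + G p (X p) (nabla p v Y)) \<and>
     (\<forall>p X Y. field_differentiable_at A X p \<longrightarrow> field_differentiable_at A Y p \<longrightarrow>
        nabla p (X p) Y - nabla p (Y p) X = lie_bracket A X Y p)"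

text \<open>The components \<open>\<Gamma>(u, w)\<close> of \<open>\<nabla>\<^sub>u W\<close> at \<open>p\<close> in the chart \<open>c\<close>, where \<open>W\<close> is the vector field with
  constant components \<open>w\<close> in this chart. (Its values outside the chart domain do not matter, as
  the Leibniz rule makes \<open>\<nabla>\<close> local.)\<close>

definition christoffel ::
  "('a, 'e::euclidean_space) chart set \<Rightarrow> ('a, 'e) connection \<Rightarrow> ('a, 'e) chart \<Rightarrow>
   'a \<Rightarrow> 'e \<Rightarrow> 'e \<Rightarrow> 'e" where
  "christoffel A nabla c p u w =
     chart_coords A c p (nabla p (chart_vector A c p u) (\<lambda>q. chart_vector A c q w))"


section \<open>Curves, parallel transport, and the exponential map\<close>

definition coord_velocity ::
  "('a, 'e::euclidean_space) chart \<Rightarrow> real set \<Rightarrow> (real \<Rightarrow> 'a) \<Rightarrow> real \<Rightarrow> 'e" where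
  "coord_velocity c I \<gamma> t = vector_derivative (\<lambda>s. chart_map c (\<gamma> s)) (at t within I)"

definition velocity ::
  "('a, 'e::euclidean_space) chart set \<Rightarrow> real set \<Rightarrow> (real \<Rightarrow> 'a) \<Rightarrow> real \<Rightarrow> 'e" where
  "velocity A I \<gamma> t = coord_velocity (tangent_chart A (\<gamma> t)) I \<gamma> t"

definition C1_curve ::
  "('a::topological_space, 'e::euclidean_space) chart set \<Rightarrow> real set \<Rightarrow> (real \<Rightarrow> 'a) \<Rightarrow> bool" where
  "C1_curve A I \<gamma> \<longleftrightarrow>
     continuous_on I \<gamma> \<and>
     (\<forall>c\<in>A.
        (\<forall>t\<in>I. \<gamma> t \<in> chart_dom c \<longrightarrow> (\<lambda>s. chart_map c (\<gamma> s)) differentiable (at t within I)) \<and>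
        continuous_on {t \<in> I. \<gamma> t \<in> chart_dom c} (coord_velocity c I \<gamma>))"

text \<open>The vector field \<open>V\<close> along \<open>\<gamma>\<close> is parallel: in every chart, \<open>V' + \<Gamma>(\<gamma>', V) = 0\<close>.\<close>

definition parallel_along ::
  "('a, 'e::euclidean_space) chart set \<Rightarrow> ('a, 'e) connection \<Rightarrow> real set \<Rightarrow>
   (real \<Rightarrow> 'a) \<Rightarrow> (real \<Rightarrow> 'e) \<Rightarrow> bool" where
  "parallel_along A nabla I \<gamma> V \<longleftrightarrow>
     (\<forall>c\<in>A. \<forall>t\<in>I. \<gamma> t \<in> chart_dom c \<longrightarrow>
        ((\<lambda>s. chart_coords A c (\<gamma> s) (V s)) has_vector_derivative
           - christoffel A nabla c (\<gamma> t) (coord_velocity c I \<gamma> t) (chart_coords A c (\<gamma> t) (V t)))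
          (at t within I))"

text \<open>\<open>parallel_transport A \<nabla> \<gamma> \<alpha> \<beta>\<close> is the parallel transport along \<open>\<gamma> : [0,1] \<rightarrow> N\<close> from the tangent
  space at \<open>\<gamma> \<alpha>\<close> to the one at \<open>\<gamma> \<beta>\<close>.\<close>

definition parallel_transport ::
  "('a, 'e::euclidean_space) chart set \<Rightarrow> ('a, 'e) connection \<Rightarrow> (real \<Rightarrow> 'a) \<Rightarrow>
   real \<Rightarrow> real \<Rightarrow> 'e \<Rightarrow> 'e" where
  "parallel_transport A nabla \<gamma> \<alpha> \<beta> v =
     (THE w. \<exists>V. parallel_along A nabla {0..1} \<gamma> V \<and> V \<alpha> = v \<and> V \<beta> = w)"

definition geodesic ::
  "('a::topological_space, 'e::euclidean_space) chart set \<Rightarrow> ('a, 'e) connection \<Rightarrow> real set \<Rightarrow>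
   (real \<Rightarrow> 'a) \<Rightarrow> bool" where
  "geodesic A nabla I \<gamma> \<longleftrightarrow> C1_curve A I \<gamma> \<and> parallel_along A nabla I \<gamma> (velocity A I \<gamma>)"

text \<open>Completeness in the sense that \<open>exp\<close> is defined on the whole tangent bundle (for connected
  manifolds equivalent to completeness of the geodesic distance, by Hopf--Rinow).\<close>

definition geodesically_complete ::
  "('a::topological_space, 'e::euclidean_space) chart set \<Rightarrow> ('a, 'e) connection \<Rightarrow> bool" where
  "geodesically_complete A nabla \<longleftrightarrow>
     (\<forall>p v. \<exists>\<gamma>. geodesic A nabla UNIV \<gamma> \<and> \<gamma> 0 = p \<and> velocity A UNIV \<gamma> 0 = v)"

definition riem_exp ::
  "('a::topological_space, 'e::euclidean_space) chart set \<Rightarrow> ('a, 'e) connection \<Rightarrow> 'a \<Rightarrow> 'e \<Rightarrow> 'a"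
where
  "riem_exp A nabla p v =
     (THE q. \<exists>\<gamma>. geodesic A nabla {0..1} \<gamma> \<and> \<gamma> 0 = p \<and> velocity A {0..1} \<gamma> 0 = v \<and> \<gamma> 1 = q)"


section \<open>The geodesic distance\<close>

text \<open>\<open>P\<close> is the set of breakpoints of a partition of \<open>[0,1]\<close>; \<open>\<gamma>\<close> is continuously differentiable
  on each closed subinterval between consecutive ones (one-sidedly at its ends).\<close>

definition piecewise_C1_curve ::
  "('a::topological_space, 'e::euclidean_space) chart set \<Rightarrow> (real \<Rightarrow> 'a) \<Rightarrow> bool" where
  "piecewise_C1_curve A \<gamma> \<longleftrightarrow>
     (\<exists>P. finite P \<and> {0, 1} \<subseteq> P \<and> P \<subseteq> {0..1} \<and>
        (\<forall>a\<in>P. \<forall>b\<in>P. a < b \<and> {a<..<b} \<inter> P = {} \<longrightarrow> C1_curve A {a..b} \<gamma>))"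

text \<open>The velocity at the finitely many breakpoints is arbitrary, which does not affect the
  integral.\<close>

definition curve_length ::
  "('a, 'e::euclidean_space) chart set \<Rightarrow> ('a, 'e) metric_field \<Rightarrow> (real \<Rightarrow> 'a) \<Rightarrow> real" where
  "curve_length A G \<gamma> = integral {0..1} (\<lambda>t. riem_norm G (\<gamma> t) (velocity A {0..1} \<gamma> t))"

text \<open>The distance of points in different connected components is \<open>\<infinity>\<close>.\<close>

definition geodesic_dist ::
  "('a::topological_space, 'e::euclidean_space) chart set \<Rightarrow> ('a, 'e) metric_field \<Rightarrow>
   'a \<Rightarrow> 'a \<Rightarrow> ennreal" where
  "geodesic_dist A G p q =
     (INF \<gamma> \<in> {\<gamma>. piecewise_C1_curve A \<gamma> \<and> \<gamma> 0 = p \<and> \<gamma> 1 = q}. ennreal (curve_length A G \<gamma>))"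

end

theory Submission
  imports Defs
begin

text \<open>
  Let \<open>\<delta>\<^sub>k\<close> be the length of the Newton correction at \<open>x\<^sub>k\<close>. Since \<open>F(x) + J(x)\<Delta>x = 0\<close> and the velocity of
  a geodesic is parallel, condition (i) bounds the covariant derivative of \<open>F\<close> along the geodesic from
  \<open>x\<^sub>k\<close> to its end point, which gives \<open>\<delta>\<^bsub>k+1\<^esub> \<le> \<omega>/2 \<delta>\<^sub>k\<^sup>2\<close>. As \<open>\<omega>/2 \<delta>\<^sub>0 < 1\<close>, the lengths decay geometrically,
  so the distance of \<open>x\<^bsub>k+1\<^esub>\<close> to the limit is at most a multiple of \<open>\<delta>\<^bsub>k+1\<^esub>\<close>, hence of \<open>\<delta>\<^sub>k\<^sup>2\<close>. Conversely,
  short geodesics near the limit are almost straight in a chart, so that \<open>\<delta>\<^sub>k\<close> is at most a multiple of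
  the distance from \<open>x\<^sub>k\<close> to \<open>x\<^bsub>k+1\<^esub>\<close>; as the distance from \<open>x\<^bsub>k+1\<^esub>\<close> to the limit is of order \<open>\<delta>\<^sub>k\<^sup>2\<close>,
  it can be absorbed, and \<open>\<delta>\<^sub>k\<close> is at most a multiple of the distance from \<open>x\<^sub>k\<close> to the limit.

  The connection inherits its regularity from the metric: by the Koszul formula, which needs the vanishing Lie
  bracket of coordinate fields, the Christoffel symbols are locally Lipschitz, and this yields
  parallel transport, the uniqueness of geodesics, and the estimates in charts.
\<close>

section \<open>Real and Euclidean analysis\<close>

text \<open>Tangent vectors are stored as components in a chart chosen anew at each point, so a
  field along a curve need not be continuous as a function into \<open>'e\<close>. Derivatives are
  therefore taken either of components in a fixed chart or of inner products, which are real-valued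
  and independent of charts. Inner products carry the invariant arguments: vector identities are
  tested against all vectors, the parallel equation against frame fields, the Newton estimate
  against one parallel field. No regularity of \<open>nabla\<close> in the base point is assumed,
  only its axioms at single points, which is why its coefficients must be recovered from the smooth
  metric. Differential equations are treated on short intervals inside one chart, and bisection
  extends the result to [0,1]. The geodesic distance is compared with the coordinate distance only
  near the limit; the two comparison constants change the constant in the quadratic estimate, not
  its order. The start condition bounds the sum of \<open>\<kappa>\<close> and half of
  \<open>\<omega>\<close> times the first length, while the recursion needs the second summand below
  1. Exactness of the Newton step closes this gap: it makes \<open>\<kappa>'\<close> vanish wherever
  the correction is nonzero.\<close>

abbreviation fderiv ::
  "('e::real_normed_vector \<Rightarrow> 'f::real_normed_vector) \<Rightarrow> 'e \<Rightarrow> 'e \<Rightarrow> 'f" where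
  "fderiv f z \<equiv> frechet_derivative f (at z)"

lemma smooth_on_has_derivative:
  assumes "smooth_on S f" "z \<in> S"
  shows "(f has_derivative fderiv f z) (at z)"
  using assms unfolding smooth_on_def
  by (metis Ck_on.simps(2) frechet_derivative_works)

lemma smooth_on_fderiv:
  assumes "smooth_on S f"
  shows "smooth_on S (\<lambda>z. fderiv f z v)"
  using assms unfolding smooth_on_def by (metis Ck_on.simps(2))

lemma smooth_on_continuous_on:
  assumes "smooth_on S f"
  shows "continuous_on S f"
  using assms unfolding smooth_on_def by (metis Ck_on.simps(1))

lemma smooth_on_imp_C1:
  assumes "smooth_on S f"
  shows "continuous_on S (\<lambda>z. fderiv f z v)"
  using assms smooth_on_continuous_on smooth_on_fderiv by blast

section \<open>Symmetry of second derivatives\<close>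

lemma second_difference_mean_value:
  fixes f :: "'e::real_normed_vector \<Rightarrow> real"
  assumes h: "0 < h"
    and S: "\<And>a b. \<lbrakk>0 \<le> a; a \<le> h; 0 \<le> b; b \<le> h\<rbrakk> \<Longrightarrow> z + a *\<^sub>R u + b *\<^sub>R v \<in> S"
    and f': "\<And>y. y \<in> S \<Longrightarrow> (f has_derivative f' y) (at y)"
    and f'': "\<And>y. y \<in> S \<Longrightarrow> ((\<lambda>y. f' y u) has_derivative f'' y) (at y)"
  obtains a b where "0 \<le> a" "a \<le> h" "0 \<le> b" "b \<le> h"
    "f (z + h *\<^sub>R u + h *\<^sub>R v) - f (z + h *\<^sub>R u) - f (z + h *\<^sub>R v) + f z
       = h\<^sup>2 * f'' (z + a *\<^sub>R u + b *\<^sub>R v) v"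
proof -
  \<comment> \<open>The second difference is \<open>?g h - ?g 0\<close>. A first mean value theorem
    acts along \<open>u\<close>, a second one along \<open>v\<close> on the resulting difference of
    derivatives in direction \<open>u\<close>.\<close>
  let ?g = "\<lambda>s. f (z + s *\<^sub>R u + h *\<^sub>R v) - f (z + s *\<^sub>R u)"
  have der: "((\<lambda>s. f (z + s *\<^sub>R u + b *\<^sub>R v)) has_real_derivative f' (z + s *\<^sub>R u + b *\<^sub>R v) u) (at s)"
    if "0 \<le> s" "s \<le> h" "0 \<le> b" "b \<le> h" for s b
  proof -
    have "((\<lambda>s. z + s *\<^sub>R u + b *\<^sub>R v) has_derivative (\<lambda>r. r *\<^sub>R u)) (at s)"
      by (auto intro!: derivative_eq_intros)
    from has_derivative_compose[OF this f'[OF S[OF that]]]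
    have "((\<lambda>s. f (z + s *\<^sub>R u + b *\<^sub>R v)) has_derivative (\<lambda>r. f' (z + s *\<^sub>R u + b *\<^sub>R v) (r *\<^sub>R u))) (at s)" .
    then show ?thesis
      using linear_scale[OF has_derivative_linear[OF f'[OF S[OF that]]]]
      by (simp add: has_field_derivative_def mult_commute_abs)
  qed
  have "\<exists>a>0. a < h \<and> ?g h - ?g 0 = (h - 0) * (f' (z + a *\<^sub>R u + h *\<^sub>R v) u - f' (z + a *\<^sub>R u) u)"
  proof (rule MVT2[OF h])
    fix s assume "0 \<le> s" "s \<le> h"
    then show "(?g has_real_derivative f' (z + s *\<^sub>R u + h *\<^sub>R v) u - f' (z + s *\<^sub>R u) u) (at s)"
      using der[of s h] der[of s 0] h by (auto intro!: derivative_eq_intros)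
  qed
  then obtain a where a: "0 < a" "a < h"
    and ga: "?g h - ?g 0 = h * (f' (z + a *\<^sub>R u + h *\<^sub>R v) u - f' (z + a *\<^sub>R u) u)" by auto
  have "\<exists>b>0. b < h \<and> f' (z + a *\<^sub>R u + h *\<^sub>R v) u - f' (z + a *\<^sub>R u + 0 *\<^sub>R v) u
      = (h - 0) * f'' (z + a *\<^sub>R u + b *\<^sub>R v) v"
  proof (rule MVT2[OF h])
    fix s assume s: "0 \<le> s" "s \<le> h"
    then have mem: "z + a *\<^sub>R u + s *\<^sub>R v \<in> S" using S a by auto
    have "((\<lambda>s. z + a *\<^sub>R u + s *\<^sub>R v) has_derivative (\<lambda>r. r *\<^sub>R v)) (at s)"
      by (auto intro!: derivative_eq_intros)
    from has_derivative_compose[OF this f''[OF mem]]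
    show "((\<lambda>s. f' (z + a *\<^sub>R u + s *\<^sub>R v) u) has_real_derivative f'' (z + a *\<^sub>R u + s *\<^sub>R v) v) (at s)"
      using linear_scale[OF has_derivative_linear[OF f''[OF mem]]]
      by (simp add: has_field_derivative_def mult_commute_abs)
  qed
  then obtain b where b: "0 < b" "b < h"
    "f' (z + a *\<^sub>R u + h *\<^sub>R v) u - f' (z + a *\<^sub>R u) u = h * f'' (z + a *\<^sub>R u + b *\<^sub>R v) v" by auto
  show ?thesis
    by (rule that[of a b]) (use a b ga in \<open>auto simp: power2_eq_square\<close>)
qed

text \<open>Schwarz's argument: the second difference is symmetric in \<open>u\<close> and
  \<open>v\<close>, so the two orders of taking mean values produce values of the two mixed
  derivatives that agree, though at different points of a small parallelogram; continuity at
  \<open>z\<close> does the rest. Only derivatives of directional derivatives occur, since these are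
  what \<open>Ck_on\<close> provides.\<close>

lemma symmetric_second_derivative_real:
  fixes f :: "'e::real_normed_vector \<Rightarrow> real"
  assumes S: "open S" "z \<in> S"
    and f': "\<And>y. y \<in> S \<Longrightarrow> (f has_derivative f' y) (at y)"
    and fu: "\<And>y. y \<in> S \<Longrightarrow> ((\<lambda>y. f' y u) has_derivative fu y) (at y)"
    and fv: "\<And>y. y \<in> S \<Longrightarrow> ((\<lambda>y. f' y v) has_derivative fv y) (at y)"
    and cont: "isCont (\<lambda>y. fu y v) z" "isCont (\<lambda>y. fv y u) z"
  shows "fu z v = fv z u"
proof (rule ccontr)
  assume ne: "fu z v \<noteq> fv z u"
  define e where "e = \<bar>fu z v - fv z u\<bar> / 2"
  have e: "e > 0" using ne by (simp add: e_def)
  obtain d1 where d1: "d1 > 0" "\<And>y. dist y z < d1 \<Longrightarrow> dist (fu y v) (fu z v) < e"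
    using cont(1) e unfolding continuous_at_eps_delta by metis
  obtain d2 where d2: "d2 > 0" "\<And>y. dist y z < d2 \<Longrightarrow> dist (fv y u) (fv z u) < e"
    using cont(2) e unfolding continuous_at_eps_delta by metis
  obtain d3 where d3: "d3 > 0" "ball z d3 \<subseteq> S" using S openE by blast
  define d where "d = min d1 (min d2 d3)"
  \<comment> \<open>This keeps the whole parallelogram within distance \<open>d / 2\<close> of
    \<open>z\<close>; the summand 1 covers the case that \<open>u\<close> and \<open>v\<close> both
    vanish.\<close>
  define h where "h = d / (2 * (norm u + norm v + 1))"
  have d: "d > 0" using d1 d2 d3 by (simp add: d_def)
  have np: "0 < norm u + norm v + 1" by (smt (verit) norm_ge_zero)
  have h: "h > 0" using d np by (simp add: h_def)
  have near: "dist (z + a *\<^sub>R u + b *\<^sub>R v) z < d" if "0 \<le> a" "a \<le> h" "0 \<le> b" "b \<le> h" for a b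
  proof -
    have "norm (a *\<^sub>R u + b *\<^sub>R v) \<le> h * norm u + h * norm v"
      using that by (intro norm_triangle_le add_mono) (auto simp: mult_right_mono)
    also have "\<dots> \<le> h * (norm u + norm v + 1)" using h by (simp add: algebra_simps)
    also have "\<dots> = d / 2" using np less_imp_neq[OF np] by (simp add: h_def divide_simps del: distrib_left_numeral)
    also have "\<dots> < d" using d by simp
    finally show ?thesis by (simp add: dist_norm add.assoc)
  qed
  have near': "dist (z + a *\<^sub>R v + b *\<^sub>R u) z < d" if "0 \<le> a" "a \<le> h" "0 \<le> b" "b \<le> h" for a b
    using near[of b a] that by (simp add: algebra_simps)
  have inS: "y \<in> S" if "dist y z < d" for y
    using d3(2) that by (auto simp: d_def dist_commute)
  obtain a b where ab: "0 \<le> a" "a \<le> h" "0 \<le> b" "b \<le> h"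
    "f (z + h *\<^sub>R u + h *\<^sub>R v) - f (z + h *\<^sub>R u) - f (z + h *\<^sub>R v) + f z
       = h\<^sup>2 * fu (z + a *\<^sub>R u + b *\<^sub>R v) v"
    using second_difference_mean_value[OF h _ f' fu, where z = z and v = v] near inS by blast
  obtain a' b' where ab': "0 \<le> a'" "a' \<le> h" "0 \<le> b'" "b' \<le> h"
    "f (z + h *\<^sub>R v + h *\<^sub>R u) - f (z + h *\<^sub>R v) - f (z + h *\<^sub>R u) + f z
       = h\<^sup>2 * fv (z + a' *\<^sub>R v + b' *\<^sub>R u) u"
    using second_difference_mean_value[OF h _ f' fv, where z = z and v = u] near' inS by blast
  have "h\<^sup>2 * fu (z + a *\<^sub>R u + b *\<^sub>R v) v = h\<^sup>2 * fv (z + a' *\<^sub>R v + b' *\<^sub>R u) u"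
    using ab(5) ab'(5) by (simp add: algebra_simps)
  then have eq: "fu (z + a *\<^sub>R u + b *\<^sub>R v) v = fv (z + a' *\<^sub>R v + b' *\<^sub>R u) u"
    using h by simp
  have "dist (fu (z + a *\<^sub>R u + b *\<^sub>R v) v) (fu z v) < e"
    using near[OF ab(1-4)] d1(2) by (simp add: d_def)
  moreover have "dist (fv (z + a' *\<^sub>R v + b' *\<^sub>R u) u) (fv z u) < e"
    using near'[OF ab'(1-4)] d2(2) by (simp add: d_def)
  ultimately show False
    using eq unfolding dist_real_def e_def by (smt (verit) field_sum_of_halves)
qed

lemma symmetric_second_derivative:
  fixes f :: "'e::euclidean_space \<Rightarrow> 'f::euclidean_space"
  assumes S: "open S" "z \<in> S" and f: "smooth_on S f"
  shows "fderiv (\<lambda>y. fderiv f y u) z v = fderiv (\<lambda>y. fderiv f y v) z u"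
proof (rule euclidean_eqI)
  fix b :: 'f assume "b \<in> Basis"
  have c: "isCont (\<lambda>y. fderiv (\<lambda>y. fderiv f y u) y v \<bullet> b) z" for u v
    using smooth_on_imp_C1[OF smooth_on_fderiv[OF f]] S
    by (intro continuous_intros) (simp add: continuous_on_eq_continuous_at)
  show "fderiv (\<lambda>y. fderiv f y u) z v \<bullet> b = fderiv (\<lambda>y. fderiv f y v) z u \<bullet> b"
    by (rule symmetric_second_derivative_real[where f = "\<lambda>y. f y \<bullet> b" and f' = "\<lambda>y w. fderiv f y w \<bullet> b"
          and fu = "\<lambda>y w. fderiv (\<lambda>y. fderiv f y u) y w \<bullet> b"
          and fv = "\<lambda>y w. fderiv (\<lambda>y. fderiv f y v) y w \<bullet> b", OF S])
      (auto intro!: has_derivative_inner_left smooth_on_has_derivative[OF f]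
          smooth_on_has_derivative[OF smooth_on_fderiv[OF f]] c)
qed

lemma smooth_on_has_derivative_fderiv:
  fixes f :: "'e::euclidean_space \<Rightarrow> 'f::euclidean_space"
  assumes S: "open S" "z \<in> S" and f: "smooth_on S f"
  shows "((\<lambda>y. fderiv f y u) has_derivative (\<lambda>v. fderiv (\<lambda>y. fderiv f y v) z u)) (at z)"
proof -
  have "fderiv (\<lambda>y. fderiv f y u) z = (\<lambda>v. fderiv (\<lambda>y. fderiv f y v) z u)"
    using symmetric_second_derivative[OF assms] by blast
  then show ?thesis
    using smooth_on_has_derivative[OF smooth_on_fderiv[OF f] S(2)] by metis
qed

section \<open>Bilinear maps and their dependence on a parameter\<close>

lemma bilinear_expand:
  fixes b :: "'e::euclidean_space \<Rightarrow> 'f::euclidean_space \<Rightarrow> 'g::real_vector"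
  assumes "bilinear b"
  shows "b v w = (\<Sum>i\<in>Basis. \<Sum>j\<in>Basis. ((v \<bullet> i) * (w \<bullet> j)) *\<^sub>R b i j)"
proof -
  have "b v w = b (\<Sum>i\<in>Basis. (v \<bullet> i) *\<^sub>R i) (\<Sum>j\<in>Basis. (w \<bullet> j) *\<^sub>R j)"
    by (simp add: euclidean_representation)
  also have "\<dots> = (\<Sum>(i, j)\<in>Basis \<times> Basis. b ((v \<bullet> i) *\<^sub>R i) ((w \<bullet> j) *\<^sub>R j))"
    by (rule bilinear_sum[OF assms])
  also have "\<dots> = (\<Sum>i\<in>Basis. \<Sum>j\<in>Basis. ((v \<bullet> i) * (w \<bullet> j)) *\<^sub>R b i j)"
    unfolding sum.cartesian_product
    using assms by (intro sum.cong) (auto simp: bilinear_lmul bilinear_rmul)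
  finally show ?thesis .
qed

lemma bilinear_norm_le:
  fixes b :: "'e::euclidean_space \<Rightarrow> 'f::euclidean_space \<Rightarrow> 'g::real_normed_vector"
  assumes "bilinear b" and B: "\<And>i j. \<lbrakk>i \<in> Basis; j \<in> Basis\<rbrakk> \<Longrightarrow> norm (b i j) \<le> B"
  shows "norm (b v w) \<le> real (DIM('e) * DIM('f)) * B * norm v * norm w"
proof -
  have "norm (b v w) \<le> (\<Sum>i\<in>Basis. \<Sum>j\<in>Basis. norm (((v \<bullet> i) * (w \<bullet> j)) *\<^sub>R b i j))"
    unfolding bilinear_expand[OF assms(1), of v w] by (intro sum_norm_le order_trans[OF norm_sum] order_refl)
  also have "\<dots> \<le> (\<Sum>i\<in>(Basis::'e set). \<Sum>j\<in>(Basis::'f set). norm v * norm w * B)"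
    by (intro sum_mono) (auto simp: abs_mult intro!: mult_mono B Basis_le_norm)
  also have "\<dots> = real (DIM('e) * DIM('f)) * B * norm v * norm w"
    by (simp add: mult_ac)
  finally show ?thesis .
qed

lemma linear_norm_le:
  fixes f :: "'e::euclidean_space \<Rightarrow> 'g::real_normed_vector"
  assumes f: "linear f" and B: "\<And>k. k \<in> Basis \<Longrightarrow> norm (f k) \<le> B"
  shows "norm (f v) \<le> real DIM('e) * B * norm v"
proof -
  have "f v = f (\<Sum>i\<in>Basis. (v \<bullet> i) *\<^sub>R i)" by (simp add: euclidean_representation)
  also have "\<dots> = (\<Sum>i\<in>Basis. (v \<bullet> i) *\<^sub>R f i)"
    by (simp add: linear_sum[OF f] linear_scale[OF f])
  also have "norm \<dots> \<le> (\<Sum>i\<in>(Basis::'e set). norm v * B)"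
    by (intro sum_norm_le) (auto intro!: mult_mono B Basis_le_norm)
  finally show ?thesis by (simp add: mult_ac)
qed

lemma continuous_on_bilinear_family:
  fixes b :: "'x::topological_space \<Rightarrow> 'e::euclidean_space \<Rightarrow> 'f::euclidean_space \<Rightarrow> 'g::real_normed_vector"
  assumes bil: "\<And>x. x \<in> S \<Longrightarrow> bilinear (b x)"
    and b: "\<And>i j. continuous_on S (\<lambda>x. b x i j)"
    and z: "continuous_on T z" "z ` T \<subseteq> S" and v: "continuous_on T v" and w: "continuous_on T w"
  shows "continuous_on T (\<lambda>s. b (z s) (v s) (w s))"
proof -
  have "continuous_on T (\<lambda>s. \<Sum>i\<in>Basis. \<Sum>j\<in>Basis. ((v s \<bullet> i) * (w s \<bullet> j)) *\<^sub>R b (z s) i j)"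
    by (intro continuous_intros v w continuous_on_compose2[OF b z])
  then show ?thesis
    using z(2) by (subst continuous_on_cong[OF refl bilinear_expand[OF bil]]) auto
qed

text \<open>A product rule for three factors in which the family is differentiable only for each
  fixed pair of vectors, as is the case for metric components in a frame. Expansion in a basis
  reduces it to finitely many products of scalar functions.\<close>

lemma has_derivative_bilinear_family:
  fixes b :: "'x::real_normed_vector \<Rightarrow> 'e::euclidean_space \<Rightarrow> 'f::euclidean_space \<Rightarrow> 'g::real_normed_vector"
  assumes S: "open S" "z t \<in> S" and t: "t \<in> I"
    and bil: "\<And>x. x \<in> S \<Longrightarrow> bilinear (b x)"
    and b: "\<And>v w. ((\<lambda>x. b x v w) has_derivative (\<lambda>u. b' u v w)) (at (z t))"
    and z: "(z has_derivative z') (at t within I)"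
    and v: "(v has_derivative v') (at t within I)" and w: "(w has_derivative w') (at t within I)"
  shows "((\<lambda>s. b (z s) (v s) (w s)) has_derivative
      (\<lambda>h. b' (z' h) (v t) (w t) + b (z t) (v' h) (w t) + b (z t) (v t) (w' h))) (at t within I)"
proof -
  \<comment> \<open>Bilinearity of \<open>b'\<close> in its last two arguments is not assumed; it is
    inherited from \<open>b\<close> by uniqueness of the derivative.\<close>
  have b'_expand: "b' u v w = (\<Sum>i\<in>Basis. \<Sum>j\<in>Basis. ((v \<bullet> i) * (w \<bullet> j)) *\<^sub>R b' u i j)" for u v w
  proof -
    have "((\<lambda>x. \<Sum>i\<in>Basis. \<Sum>j\<in>Basis. ((v \<bullet> i) * (w \<bullet> j)) *\<^sub>R b x i j) has_derivative
        (\<lambda>u. \<Sum>i\<in>Basis. \<Sum>j\<in>Basis. ((v \<bullet> i) * (w \<bullet> j)) *\<^sub>R b' u i j)) (at (z t))"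
      by (intro has_derivative_sum has_derivative_scaleR_right b)
    then have "((\<lambda>x. b x v w) has_derivative
        (\<lambda>u. \<Sum>i\<in>Basis. \<Sum>j\<in>Basis. ((v \<bullet> i) * (w \<bullet> j)) *\<^sub>R b' u i j)) (at (z t))"
      by (rule has_derivative_transform_within_open[OF _ S]) (simp add: bilinear_expand[OF bil, symmetric])
    from has_derivative_unique[OF b this] show ?thesis by metis
  qed
  have zb: "((\<lambda>s. b (z s) i j) has_derivative (\<lambda>h. b' (z' h) i j)) (at t within I)" for i j
    by (rule has_derivative_compose[OF z b])
  have ev: "\<forall>\<^sub>F s in at t within I. z s \<in> S"
    using has_derivative_continuous[OF z] S
    by (metis continuous_within topological_tendstoD)
  have "((\<lambda>s. \<Sum>i\<in>Basis. \<Sum>j\<in>Basis. ((v s \<bullet> i) * (w s \<bullet> j)) *\<^sub>R b (z s) i j) has_derivative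
      (\<lambda>h. \<Sum>i\<in>Basis. \<Sum>j\<in>Basis. ((v t \<bullet> i) * (w t \<bullet> j)) *\<^sub>R b' (z' h) i j +
          ((v t \<bullet> i) * (w' h \<bullet> j) + (v' h \<bullet> i) * (w t \<bullet> j)) *\<^sub>R b (z t) i j)) (at t within I)"
    by (intro has_derivative_sum has_derivative_scaleR has_derivative_mult zb has_derivative_inner_left v w)
  also have "(\<lambda>h. \<Sum>i\<in>Basis. \<Sum>j\<in>Basis. ((v t \<bullet> i) * (w t \<bullet> j)) *\<^sub>R b' (z' h) i j +
          ((v t \<bullet> i) * (w' h \<bullet> j) + (v' h \<bullet> i) * (w t \<bullet> j)) *\<^sub>R b (z t) i j)
      = (\<lambda>h. b' (z' h) (v t) (w t) + b (z t) (v' h) (w t) + b (z t) (v t) (w' h))"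
    unfolding b'_expand[of _ "v t"] bilinear_expand[OF bil[OF S(2)], of "v' _"]
      bilinear_expand[OF bil[OF S(2)], of "v t"]
    by (simp add: sum.distrib[symmetric] scaleR_add_left add_ac)
  finally show ?thesis
    by (rule has_derivative_transform_eventually[OF _ _ _ t])
      (use ev S(2) in \<open>auto elim!: eventually_mono simp: bilinear_expand[OF bil, symmetric]\<close>)
qed

section \<open>Bounds and Lipschitz constants on compact sets\<close>

lemma smooth_on_bounded:
  fixes f :: "'e::euclidean_space \<Rightarrow> 'f::real_normed_vector"
  assumes "smooth_on S f" "compact K" "K \<subseteq> S"
  obtains B where "B > 0" "\<And>z. z \<in> K \<Longrightarrow> norm (f z) \<le> B"
  using compact_imp_bounded[OF compact_continuous_image[OF
        continuous_on_subset[OF smooth_on_continuous_on[OF assms(1)] assms(3)] assms(2)]]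
  unfolding bounded_pos by auto

lemma smooth_on_lipschitz:
  fixes f :: "'e::euclidean_space \<Rightarrow> 'f::real_normed_vector"
  assumes f: "smooth_on S f" and K: "compact K" "convex K" "K \<subseteq> S"
  obtains L where "L > 0" "\<And>y z. \<lbrakk>y \<in> K; z \<in> K\<rbrakk> \<Longrightarrow> norm (f y - f z) \<le> L * norm (y - z)"
proof -
  have "\<exists>B>0. \<forall>z\<in>K. norm (fderiv f z k) \<le> B" for k
    using smooth_on_bounded[OF smooth_on_fderiv[OF f] K(1,3)] by metis
  then obtain B where B: "\<And>k z. z \<in> K \<Longrightarrow> norm (fderiv f z k) \<le> B k" "\<And>k. B k > 0" by metis
  define L where "L = real DIM('e) * (\<Sum>k\<in>(Basis::'e set). B k)"
  have Bk: "norm (fderiv f z k) \<le> (\<Sum>k\<in>(Basis::'e set). B k)" if "k \<in> Basis" "z \<in> K" for k z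
    using B(1)[OF that(2), of k] member_le_sum[OF that(1), of B] B(2) by (force intro: less_imp_le)
  have "L > 0" unfolding L_def by (intro mult_pos_pos sum_pos) (auto simp: B(2))
  moreover have "norm (f y - f z) \<le> L * norm (y - z)" if "y \<in> K" "z \<in> K" for y z
  proof (rule differentiable_bound[OF K(2) _ _ that])
    fix x assume x: "x \<in> K"
    have d: "(f has_derivative fderiv f x) (at x)" using smooth_on_has_derivative[OF f] K(3) x by blast
    then show "(f has_derivative fderiv f x) (at x within K)" by (rule has_derivative_at_withinI)
    show "onorm (fderiv f x) \<le> L"
      unfolding L_def by (intro onorm_le linear_norm_le has_derivative_linear[OF d] Bk x)
  qed
  ultimately show ?thesis by (rule that)
qed

text \<open>Serves to replace the constants of finitely many component functions by a single one.
  The weight \<open>g\<close> is 1 for bounds and a distance for Lipschitz estimates; adding 1 to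
  the sum keeps the constant positive even for empty \<open>I\<close>.\<close>

lemma finite_uniform_bound:
  fixes f :: "'i \<Rightarrow> 'x \<Rightarrow> real"
  assumes "finite I" and g: "\<And>x. x \<in> X \<Longrightarrow> 0 \<le> g x"
    and f: "\<And>i. i \<in> I \<Longrightarrow> \<exists>B>0. \<forall>x\<in>X. f i x \<le> B * g x"
  obtains B where "B > 0" "\<And>i x. \<lbrakk>i \<in> I; x \<in> X\<rbrakk> \<Longrightarrow> f i x \<le> B * g x"
proof -
  obtain B where B: "\<And>i. i \<in> I \<Longrightarrow> B i > 0" "\<And>i x. \<lbrakk>i \<in> I; x \<in> X\<rbrakk> \<Longrightarrow> f i x \<le> B i * g x"
    using f by metis
  have "f i x \<le> (1 + sum B I) * g x" if "i \<in> I" "x \<in> X" for i x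
  proof -
    have "B i \<le> 1 + sum B I"
      using member_le_sum[OF that(1), of B] B(1) assms(1) by (force intro: less_imp_le)
    then show ?thesis using B(2)[OF that] g[OF that(2)] by (meson mult_right_mono order_trans)
  qed
  moreover have "1 + sum B I > 0" using B(1) by (smt (verit) sum_nonneg)
  ultimately show ?thesis using that by blast
qed

text \<open>The expression has the shape of the right-hand side of the Koszul formula.\<close>

lemma abs_half_add3_le:
  fixes a b c x y z :: real
  assumes "\<bar>a\<bar> \<le> x" "\<bar>b\<bar> \<le> y" "\<bar>c\<bar> \<le> z"
  shows "\<bar>(a + b - c) / 2\<bar> \<le> x + y + z"
proof -
  have "\<bar>a + b - c\<bar> \<le> 2 * (x + y + z)"
    using assms by (auto simp: abs_if split: if_splits)
  then show ?thesis by simp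
qed

section \<open>Linear differential equations on short intervals\<close>

lemma norm_diff_le_vector_derivative:
  fixes f :: "real \<Rightarrow> 'f::real_normed_vector"
  assumes f: "\<And>t. t \<in> {a..b} \<Longrightarrow> (f has_vector_derivative f' t) (at t within {a..b})"
    and B: "\<And>t. t \<in> {a..b} \<Longrightarrow> norm (f' t) \<le> B" and st: "s \<in> {a..b}" "t \<in> {a..b}"
  shows "norm (f s - f t) \<le> B * norm (s - t)"
proof (rule differentiable_bound[OF convex_real_interval(5) _ _ st])
  fix t assume t: "t \<in> {a..b}"
  show "(f has_derivative (\<lambda>h. h *\<^sub>R f' t)) (at t within {a..b})"
    using f[OF t] by (simp add: has_vector_derivative_def)
  show "onorm (\<lambda>h. h *\<^sub>R f' t) \<le> B"
    by (rule onorm_le) (use mult_right_mono[OF B[OF t] abs_ge_zero] in \<open>simp add: mult.commute\<close>)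
qed

text \<open>Picard's integral operator on bounded continuous functions contracts distances by the
  factor \<open>K * (b - a)\<close>. The initial time may lie anywhere in the interval: the
  integrals start at \<open>a\<close>, and their value at \<open>t1\<close> is subtracted.\<close>

lemma linear_ode_exists_short:
  fixes B :: "real \<Rightarrow> 'e::euclidean_space \<Rightarrow> 'e"
  assumes ab: "a \<le> b" and t1: "t1 \<in> {a..b}"
    and cont: "\<And>y. continuous_on {a..b} y \<Longrightarrow> continuous_on {a..b} (\<lambda>s. B s (y s))"
    and lin: "\<And>s. s \<in> {a..b} \<Longrightarrow> linear (B s)"
    and K: "\<And>s v. s \<in> {a..b} \<Longrightarrow> norm (B s v) \<le> K * norm v" and small: "K * (b - a) < 1"
  obtains y where "y t1 = v" "\<And>t. t \<in> {a..b} \<Longrightarrow> (y has_vector_derivative B t (y t)) (at t within {a..b})"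
proof -
  \<comment> \<open>Clamping to \<open>{a..b}\<close>: elements of the complete space used here are
    functions on the whole real line, so values outside the interval are filled in
    constantly.\<close>
  define p where "p t = max a (min b t)" for t :: real
  have p_mem: "p t \<in> {a..b}" for t using ab by (auto simp: p_def)
  have p_id: "p t = t" if "t \<in> {a..b}" for t using that by (auto simp: p_def)
  have p_cont: "continuous_on T p" for T unfolding p_def by (intro continuous_intros)
  have ycont: "continuous_on {a..b} (\<lambda>s. B s (apply_bcontfun y s))" for y :: "real \<Rightarrow>\<^sub>C 'e"
    by (intro cont continuous_on_subset[OF continuous_on_apply_bcontfun]) auto
  define I where "I y t = integral {a..t} (\<lambda>s. B s (apply_bcontfun y s))" for y :: "real \<Rightarrow>\<^sub>C 'e" and t
  have I': "(I y has_vector_derivative B t (apply_bcontfun y t)) (at t within {a..b})"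
    if "t \<in> {a..b}" for y t
    unfolding I_def by (rule integral_has_vector_derivative[OF ycont that])
  have I_cont: "continuous_on {a..b} (I y)" for y
    using I' has_vector_derivative_continuous continuous_on_eq_continuous_within by blast
  define T where "T y = Bcontfun (\<lambda>t. v + I y (p t) - I y t1)" for y
  have "(\<lambda>t. v + I y (p t) - I y t1) \<in> bcontfun" for y
  proof -
    obtain C where C: "\<And>t. t \<in> {a..b} \<Longrightarrow> norm (I y t) \<le> C"
      using compact_imp_bounded[OF compact_continuous_image[OF I_cont compact_Icc]]
      unfolding bounded_iff by blast
    have "norm (v + I y (p t) - I y t1) \<le> norm v + C + C" for t
      by (intro order_trans[OF norm_triangle_ineq4] order_trans[OF norm_triangle_ineq] add_mono C p_mem t1 order_refl)
    moreover have "continuous_on UNIV (\<lambda>t. v + I y (p t) - I y t1)"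
      by (intro continuous_intros continuous_on_compose2[OF I_cont p_cont]) (use p_mem in auto)
    ultimately show ?thesis by (intro bcontfun_normI)
  qed
  then have T_apply: "apply_bcontfun (T y) t = v + I y (p t) - I y t1" for y t
    unfolding T_def by (simp add: Bcontfun_inverse)
  have K0: "0 \<le> K"
  proof -
    obtain b0 :: 'e where "b0 \<in> Basis" using nonempty_Basis by blast
    then have "norm b0 = 1" by (rule norm_Basis)
    then show ?thesis using order_trans[OF norm_ge_zero K[OF t1, of b0]] by simp
  qed
  have contr: "dist (T y) (T y') \<le> K * (b - a) * dist y y'" for y y'
  proof (rule dist_bound)
    fix t
    have "norm ((I y (p t) - I y' (p t)) - (I y t1 - I y' t1)) \<le> (K * dist y y') * norm (p t - t1)"
    proof (rule norm_diff_le_vector_derivative[OF has_vector_derivative_diff[OF I' I'] _ p_mem t1])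
      fix s assume s: "s \<in> {a..b}"
      have "norm (B s (apply_bcontfun y s) - B s (apply_bcontfun y' s)) \<le> K * norm (apply_bcontfun y s - apply_bcontfun y' s)"
        using K[OF s] by (simp add: linear_diff[OF lin[OF s], symmetric])
      also have "\<dots> \<le> K * dist y y'"
        using dist_bounded[of y s y'] K0 by (intro mult_left_mono) (auto simp: dist_norm)
      finally show "norm (B s (apply_bcontfun y s) - B s (apply_bcontfun y' s)) \<le> K * dist y y'" .
    qed
    also have "\<dots> \<le> (K * dist y y') * (b - a)"
      using p_mem[of t] t1 K0 by (intro mult_left_mono) (auto simp: abs_le_iff)
    finally show "dist (apply_bcontfun (T y) t) (apply_bcontfun (T y') t) \<le> K * (b - a) * dist y y'"
      unfolding T_apply dist_norm[of "v + _ - _"] by (simp add: algebra_simps)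
  qed
  have "\<exists>!y. T y = y"
    by (rule banach_fix_type[OF _ small]) (use contr K0 ab in auto)
  then obtain y where y: "T y = y" by blast
  have yt: "apply_bcontfun y t = v + I y t - I y t1" if "t \<in> {a..b}" for t
    using T_apply[of y t] y p_id[OF that] by simp
  show ?thesis
  proof (rule that)
    show "apply_bcontfun y t1 = v" using yt[OF t1] by simp
    fix t assume t: "t \<in> {a..b}"
    have "((\<lambda>t. v + I y t - I y t1) has_vector_derivative B t (apply_bcontfun y t)) (at t within {a..b})"
      using I'[OF t] by (auto intro!: derivative_eq_intros)
    then show "(apply_bcontfun y has_vector_derivative B t (apply_bcontfun y t)) (at t within {a..b})"
      by (rule has_vector_derivative_transform[OF t yt, rotated -1]) (use t in auto)
  qed
qed

text \<open>A substitute for Gronwall's inequality: where \<open>norm (w t)\<close> is maximal, the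
  mean value inequality bounds this maximum by \<open>M * (b - a)\<close> times itself.\<close>

lemma linear_growth_vanishing_short:
  fixes w :: "real \<Rightarrow> 'f::real_normed_vector"
  assumes w: "\<And>t. t \<in> {a..b} \<Longrightarrow> (w has_vector_derivative w' t) (at t within {a..b})"
    and M: "\<And>t. t \<in> {a..b} \<Longrightarrow> norm (w' t) \<le> M * norm (w t)"
    and a: "w a = 0" and small: "M * (b - a) < 1" and M0: "0 \<le> M" and t: "t \<in> {a..b}"
  shows "w t = 0"
proof -
  have ab: "a \<in> {a..b}" "{a..b} \<noteq> {}" using t by auto
  have "continuous_on {a..b} w"
    using w has_vector_derivative_continuous continuous_on_eq_continuous_within by blast
  then have "continuous_on {a..b} (\<lambda>t. norm (w t))" by (rule continuous_on_norm)
  from continuous_attains_sup[OF compact_Icc ab(2) this]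
  obtain s where s: "s \<in> {a..b}" "\<And>t. t \<in> {a..b} \<Longrightarrow> norm (w t) \<le> norm (w s)" by blast
  have "norm (w s - w a) \<le> (M * norm (w s)) * norm (s - a)"
    by (rule norm_diff_le_vector_derivative[OF w order_trans[OF M mult_left_mono[OF s(2) M0]] s(1) ab(1)])
  also have "\<dots> \<le> (M * norm (w s)) * (b - a)"
    using s(1) M0 by (intro mult_left_mono) auto
  finally have "norm (w s) \<le> (M * (b - a)) * norm (w s)" using a by (simp add: mult_ac)
  then have "norm (w s) \<le> 0"
    using small by (metis less_le_not_le mult_le_cancel_right1 norm_ge_zero order_le_less)
  then show ?thesis using s(2)[OF t] by simp
qed

lemma at_within_eventually_mem: "\<forall>\<^sub>F s in at (t::real) within I. s \<in> I"
  unfolding eventually_at by (intro exI[of _ 1]) auto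

section \<open>Partitions of an interval\<close>

lemma partition_induct:
  fixes P :: "real set"
  assumes P: "finite P" "lo \<in> P" "\<And>p. p \<in> P \<Longrightarrow> lo \<le> p"
    and base: "Q lo"
    and step: "\<And>a b. \<lbrakk>a \<in> P; b \<in> P; a < b; {a<..<b} \<inter> P = {}; Q a\<rbrakk> \<Longrightarrow> Q b"
    and b: "b \<in> P"
  shows "Q b"
  using b
proof (induction "card {p \<in> P. p < b}" arbitrary: b rule: less_induct)
  case less
  show ?case
  proof (cases "b = lo")
    case True
    then show ?thesis using base by simp
  next
    case False
    let ?S = "{p \<in> P. p < b}"
    have ne: "?S \<noteq> {}" "finite ?S" using P False less.prems by force+
    \<comment> \<open>The left neighbour of \<open>b\<close> among the breakpoints; fewer
      breakpoints lie below it, so the induction hypothesis applies to it.\<close>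
    define a where "a = Max ?S"
    have a: "a \<in> ?S" using Max_in[OF ne(2,1)] by (simp add: a_def)
    have gap: "{a<..<b} \<inter> P = {}"
      using Max_ge[OF ne(2)] unfolding a_def by fastforce
    have "card {p \<in> P. p < a} < card ?S"
      using a ne(2) by (intro psubset_card_mono) auto
    then show ?thesis using less.hyps[of a] a gap step less.prems by auto
  qed
qed

lemma partition_gap:
  fixes P :: "real set"
  assumes P: "finite P" "lo \<in> P" "hi \<in> P" and t: "lo < t" "t < hi" "t \<notin> P"
  obtains a b where "a \<in> P" "b \<in> P" "a < t" "t < b" "{a<..<b} \<inter> P = {}"
proof -
  let ?S = "{p \<in> P. p < t}" and ?T = "{p \<in> P. t < p}"
  have S: "finite ?S" "?S \<noteq> {}" and T: "finite ?T" "?T \<noteq> {}" using assms by auto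
  show ?thesis
  proof (rule that[of "Max ?S" "Min ?T"])
    show "{Max ?S<..<Min ?T} \<inter> P = {}"
    proof (rule ccontr)
      assume "{Max ?S<..<Min ?T} \<inter> P \<noteq> {}"
      then obtain p where p: "Max ?S < p" "p < Min ?T" "p \<in> P" by auto
      then have "p \<noteq> t" using t by blast
      then have "p \<in> ?S \<or> p \<in> ?T" using p by auto
      then show False using p Max_ge[OF S(1), of p] Min_le[OF T(1), of p] by auto
    qed
  qed (use Max_in[OF S] Min_in[OF T] in auto)
qed

section \<open>Recursive estimates for sequences\<close>

lemma quadratic_decay:
  fixes \<delta> :: "nat \<Rightarrow> real"
  assumes \<delta>: "\<And>k. 0 \<le> \<delta> k" "\<And>k. \<delta> (Suc k) \<le> a * (\<delta> k)\<^sup>2" and a: "0 \<le> a" "a * \<delta> 0 < 1"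
  shows "\<delta> (Suc k) \<le> (a * \<delta> 0) * \<delta> k" "\<delta> \<longlonglongrightarrow> 0"
proof -
  have q: "0 \<le> a * \<delta> 0" using \<delta>(1) a(1) by simp
  \<comment> \<open>The sequence \<open>a * \<delta> k\<close> is at most squared in each step, and
    squaring does not increase a number in [0,1).\<close>
  have le: "a * \<delta> k \<le> a * \<delta> 0" for k
  proof (induction k)
    case (Suc k)
    have "a * \<delta> (Suc k) \<le> a * (a * (\<delta> k)\<^sup>2)" using \<delta>(2) a(1) by (intro mult_left_mono)
    also have "\<dots> = (a * \<delta> k) * (a * \<delta> k)" by (simp add: power2_eq_square)
    also have "\<dots> \<le> 1 * (a * \<delta> k)" using Suc a \<delta>(1) by (intro mult_right_mono) auto
    finally show ?case using Suc by simp
  qed simp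
  have step: "\<delta> (Suc k) \<le> (a * \<delta> 0) * \<delta> k" for k
    using \<delta>(2)[of k] mult_right_mono[OF le[of k] \<delta>(1)[of k]] by (simp add: power2_eq_square mult.assoc)
  then show "\<delta> (Suc k) \<le> (a * \<delta> 0) * \<delta> k" .
  have geo: "\<delta> k \<le> (a * \<delta> 0) ^ k * \<delta> 0" for k
  proof (induction k)
    case (Suc k)
    then show ?case using step[of k] mult_left_mono[OF Suc q] by (simp add: mult.assoc)
  qed simp
  have "(\<lambda>k. (a * \<delta> 0) ^ k * \<delta> 0) \<longlonglongrightarrow> 0 * \<delta> 0"
    using q a(2) by (intro tendsto_mult tendsto_const LIMSEQ_power_zero) simp
  then show "\<delta> \<longlonglongrightarrow> 0"
    by (intro tendsto_sandwich[OF _ _ tendsto_const, of 0 \<delta> sequentially "\<lambda>k. (a * \<delta> 0) ^ k * \<delta> 0"])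
      (use \<delta>(1) geo in auto)
qed

text \<open>The factor \<open>b / (1 - q)\<close> is the geometric series of the step bounds.
  Splitting off the first step reproduces it, since
  \<open>b / (1 - q) * q + b = b / (1 - q)\<close>; for this the induction is over the number of
  steps with the starting index arbitrary.\<close>

lemma tail_distance_le:
  fixes z :: "nat \<Rightarrow> 'e::real_normed_vector"
  assumes z: "z \<longlonglongrightarrow> z0" and step: "\<And>k. k \<ge> N \<Longrightarrow> norm (z (Suc k) - z k) \<le> b * \<delta> k"
    and \<delta>: "\<And>k. \<delta> (Suc k) \<le> q * \<delta> k" and q: "0 \<le> q" "q < 1" and b: "0 \<le> b" and k: "k \<ge> N"
  shows "norm (z0 - z k) \<le> b / (1 - q) * \<delta> k"
proof -
  have "norm (z (k + i) - z k) \<le> b / (1 - q) * \<delta> k" if "k \<ge> N" for i k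
    using that
  proof (induction i arbitrary: k)
    case 0
    have "0 \<le> b * \<delta> k" using step[OF 0] norm_ge_zero order_trans by blast
    then have "0 \<le> b * \<delta> k / (1 - q)" using q by simp
    then show ?case by simp
  next
    case (Suc i)
    have "norm (z (Suc k + i) - z k) \<le> norm (z (Suc k + i) - z (Suc k)) + norm (z (Suc k) - z k)"
      using norm_triangle_ineq[of "z (Suc k + i) - z (Suc k)" "z (Suc k) - z k"] by simp
    also have "\<dots> \<le> b / (1 - q) * \<delta> (Suc k) + b * \<delta> k"
      using Suc.IH[of "Suc k"] step[of k] Suc.prems by simp
    also have "\<dots> \<le> b / (1 - q) * (q * \<delta> k) + b * \<delta> k"
      using \<delta>[of k] b q by (intro add_right_mono mult_left_mono) auto
    also have "\<dots> = b / (1 - q) * \<delta> k" using q by (simp add: field_simps)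
    finally show ?case by simp
  qed
  then have bound: "norm (z n - z k) \<le> b / (1 - q) * \<delta> k" if "n \<ge> k" for n
    using k that by (metis le_add_diff_inverse)
  have "(\<lambda>n. norm (z n - z k)) \<longlonglongrightarrow> norm (z0 - z k)"
    by (intro tendsto_norm tendsto_diff z tendsto_const)
  then show ?thesis
    by (rule tendsto_upperbound) (use bound in \<open>auto simp: eventually_sequentially\<close>)
qed

section \<open>Calculus in charts\<close>

abbreviation chart_image :: "('a, 'e) chart \<Rightarrow> 'e set" where
  "chart_image c \<equiv> chart_map c ` chart_dom c"

abbreviation transition :: "('a, 'e) chart \<Rightarrow> ('a, 'e) chart \<Rightarrow> 'e \<Rightarrow> 'e" where
  "transition c d \<equiv> chart_map d \<circ> chart_inv c"

locale smooth_manifold =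
  fixes A :: "('a::{t2_space, second_countable_topology}, 'e::euclidean_space) chart set"
  assumes atlas: "smooth_atlas A"
begin

section \<open>Charts and transition maps\<close>

lemma
  assumes "c \<in> A"
  shows open_chart_dom: "open (chart_dom c)"
    and open_chart_image: "open (chart_image c)"
    and homeomorphism_chart:
      "homeomorphism (chart_dom c) (chart_image c) (chart_map c) (chart_inv c)"
  using atlas assms unfolding smooth_atlas_def by auto

lemma chart_inv_chart_map [simp]: "\<lbrakk>c \<in> A; p \<in> chart_dom c\<rbrakk> \<Longrightarrow> chart_inv c (chart_map c p) = p"
  using homeomorphism_chart by (meson homeomorphism_apply1)

lemma chart_map_chart_inv [simp]: "\<lbrakk>c \<in> A; z \<in> chart_image c\<rbrakk> \<Longrightarrow> chart_map c (chart_inv c z) = z"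
  using homeomorphism_chart by (meson homeomorphism_apply2)

lemma chart_inv_in_dom [simp]: "\<lbrakk>c \<in> A; z \<in> chart_image c\<rbrakk> \<Longrightarrow> chart_inv c z \<in> chart_dom c"
  using chart_inv_chart_map by fastforce

lemma open_chart_map_image:
  assumes "c \<in> A" "open S" "S \<subseteq> chart_dom c"
  shows "open (chart_map c ` S)"
proof -
  have "chart_map c ` S = chart_inv c -` S \<inter> chart_image c"
  proof (intro set_eqI iffI)
    fix z assume "z \<in> chart_map c ` S"
    then show "z \<in> chart_inv c -` S \<inter> chart_image c" using assms(1,3) by auto
  next
    fix z assume z: "z \<in> chart_inv c -` S \<inter> chart_image c"
    then have "z = chart_map c (chart_inv c z)" using assms(1) by simp
    then show "z \<in> chart_map c ` S" using z by blast
  qed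
  then show ?thesis
    using homeomorphism_cont2[OF homeomorphism_chart[OF assms(1)]] open_chart_image[OF assms(1)] assms(2)
    by (simp add: continuous_on_open_vimage)
qed

lemma chart_cover: "\<exists>c\<in>A. p \<in> chart_dom c"
  using atlas unfolding smooth_atlas_def by blast

lemma tangent_chart: "tangent_chart A p \<in> A" "p \<in> chart_dom (tangent_chart A p)"
  using chart_cover[of p] unfolding tangent_chart_def by (metis (mono_tags, lifting) someI_ex)+

lemma smooth_on_transition:
  "\<lbrakk>c \<in> A; d \<in> A\<rbrakk> \<Longrightarrow> smooth_on (chart_map c ` (chart_dom c \<inter> chart_dom d)) (transition c d)"
  using atlas unfolding smooth_atlas_def by blast

lemma open_transition_dom:
  "\<lbrakk>c \<in> A; d \<in> A\<rbrakk> \<Longrightarrow> open (chart_map c ` (chart_dom c \<inter> chart_dom d))"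
  by (intro open_chart_map_image) (auto simp: open_chart_dom)

lemma has_derivative_transition:
  assumes "c \<in> A" "d \<in> A" "p \<in> chart_dom c" "p \<in> chart_dom d"
  shows "(transition c d has_derivative fderiv (transition c d) (chart_map c p)) (at (chart_map c p))"
  by (rule smooth_on_has_derivative[OF smooth_on_transition]) (use assms in auto)

text \<open>The cocycle identity, by the chain rule. All rules for changing components follow from
  it, because \<open>chart_coords\<close> and \<open>chart_vector\<close> are themselves
  differentials of transition maps from and to the tangent chart.\<close>

lemma fderiv_transition_compose:
  assumes c: "c \<in> A" "d \<in> A" "e \<in> A" and p: "p \<in> chart_dom c" "p \<in> chart_dom d" "p \<in> chart_dom e"
  shows "fderiv (transition d e) (chart_map d p) (fderiv (transition c d) (chart_map c p) w)
       = fderiv (transition c e) (chart_map c p) w"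
proof -
  have eq: "transition c d (chart_map c p) = chart_map d p" using c p by simp
  have "(transition d e has_derivative fderiv (transition d e) (chart_map d p))
      (at (transition c d (chart_map c p)))"
    unfolding eq by (rule has_derivative_transition[OF c(2,3) p(2,3)])
  from has_derivative_compose[OF has_derivative_transition[OF c(1,2) p(1,2)] this]
  have "((\<lambda>z. transition d e (transition c d z)) has_derivative
      (\<lambda>w. fderiv (transition d e) (chart_map d p) (fderiv (transition c d) (chart_map c p) w))) (at (chart_map c p))" .
  then have "(transition c e has_derivative
      (\<lambda>w. fderiv (transition d e) (chart_map d p) (fderiv (transition c d) (chart_map c p) w))) (at (chart_map c p))"
    by (rule has_derivative_transform_within_open[OF _ open_transition_dom[OF c(1,2)]]) (use c p in auto)
  from frechet_derivative_at[OF this] show ?thesis by metis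
qed

lemma fderiv_transition_self:
  assumes "c \<in> A" "p \<in> chart_dom c"
  shows "fderiv (transition c c) (chart_map c p) w = w"
proof -
  have "(transition c c has_derivative (\<lambda>w. w)) (at (chart_map c p))"
    by (rule has_derivative_transform_within_open[OF has_derivative_ident open_chart_image[OF assms(1)]])
      (use assms in auto)
  from frechet_derivative_at[OF this] show ?thesis by metis
qed

section \<open>Components of tangent vectors and frame fields\<close>

lemma chart_coords_chart_vector:
  assumes "c \<in> A" "d \<in> A" "p \<in> chart_dom c" "p \<in> chart_dom d"
  shows "chart_coords A d p (chart_vector A c p w) = fderiv (transition c d) (chart_map c p) w"
  unfolding chart_coords_def chart_vector_def
  by (rule fderiv_transition_compose[OF assms(1) tangent_chart(1) assms(2,3) tangent_chart(2) assms(4)])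

lemma chart_coords_vector [simp]:
  "\<lbrakk>c \<in> A; p \<in> chart_dom c\<rbrakk> \<Longrightarrow> chart_coords A c p (chart_vector A c p w) = w"
  by (simp add: chart_coords_chart_vector fderiv_transition_self)

lemma chart_vector_coords [simp]:
  assumes "c \<in> A" "p \<in> chart_dom c"
  shows "chart_vector A c p (chart_coords A c p v) = v"
  unfolding chart_coords_def chart_vector_def
  by (rule trans[OF fderiv_transition_compose[OF tangent_chart(1) assms(1) tangent_chart(1)
          tangent_chart(2) assms(2) tangent_chart(2)] fderiv_transition_self[OF tangent_chart]])

lemma chart_coords_change:
  assumes "c \<in> A" "d \<in> A" "p \<in> chart_dom c" "p \<in> chart_dom d"
  shows "chart_coords A d p v = fderiv (transition c d) (chart_map c p) (chart_coords A c p v)"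
  using chart_coords_chart_vector[OF assms, of "chart_coords A c p v"]
  by (simp only: chart_vector_coords[OF assms(1,3)])

lemma linear_chart_coords: "\<lbrakk>c \<in> A; p \<in> chart_dom c\<rbrakk> \<Longrightarrow> linear (chart_coords A c p)"
  unfolding chart_coords_def
  by (rule has_derivative_linear[OF has_derivative_transition[OF tangent_chart(1) _ tangent_chart(2)]])

lemma linear_chart_vector: "\<lbrakk>c \<in> A; p \<in> chart_dom c\<rbrakk> \<Longrightarrow> linear (chart_vector A c p)"
  unfolding chart_vector_def
  by (rule has_derivative_linear[OF has_derivative_transition[OF _ tangent_chart(1) _ tangent_chart(2)]])

lemma has_derivative_fderiv_transition:
  assumes "c \<in> A" "d \<in> A" "p \<in> chart_dom c" "p \<in> chart_dom d"
  shows "((\<lambda>z. fderiv (transition c d) z w) has_derivative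
            (\<lambda>v. fderiv (\<lambda>z. fderiv (transition c d) z v) (chart_map c p) w)) (at (chart_map c p))"
  by (rule smooth_on_has_derivative_fderiv[OF open_transition_dom _ smooth_on_transition]) (use assms in auto)

text \<open>In the chart \<open>d\<close> the field has the components obtained by applying the
  differential of the transition map from \<open>c\<close> to \<open>w\<close>, read at the
  \<open>c\<close>-coordinates of the point; the chain rule brings in the inverse transition.
  Differentiability of a field is demanded in every chart, hence the second chart
  \<open>d\<close>.\<close>

lemma has_derivative_frame_field:
  assumes "c \<in> A" "d \<in> A" "p \<in> chart_dom c" "p \<in> chart_dom d"
  shows "(field_in_chart A d (\<lambda>q. chart_vector A c q w) has_derivative
      (\<lambda>u. fderiv (\<lambda>z. fderiv (transition c d) z (fderiv (transition d c) (chart_map d p) u)) (chart_map c p) w))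
      (at (chart_map d p))"
proof -
  have eq: "transition d c (chart_map d p) = chart_map c p" using assms by simp
  have "((\<lambda>z. fderiv (transition c d) z w) has_derivative
      (\<lambda>v. fderiv (\<lambda>z. fderiv (transition c d) z v) (chart_map c p) w)) (at (transition d c (chart_map d p)))"
    unfolding eq by (rule has_derivative_fderiv_transition[OF assms])
  from has_derivative_compose[OF has_derivative_transition[OF assms(2,1,4,3)] this]
  have "((\<lambda>z. fderiv (transition c d) (transition d c z) w) has_derivative
      (\<lambda>u. fderiv (\<lambda>z. fderiv (transition c d) z (fderiv (transition d c) (chart_map d p) u)) (chart_map c p) w))
      (at (chart_map d p))" .
  then show ?thesis
    by (rule has_derivative_transform_within_open[OF _ open_transition_dom[OF assms(2,1)]])
      (use assms in \<open>auto simp: field_in_chart_def chart_coords_chart_vector\<close>)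
qed

lemma field_differentiable_frame_field:
  assumes "c \<in> A" "p \<in> chart_dom c"
  shows "field_differentiable_at A (\<lambda>q. chart_vector A c q w) p"
  unfolding field_differentiable_at_def
  using has_derivative_frame_field assms differentiableI by blast

text \<open>Computed in the tangent chart, the bracket is a difference of the two mixed second
  derivatives of one transition map. Its vanishing is what makes the Christoffel symbols
  symmetric.\<close>

lemma lie_bracket_frame_fields:
  assumes "c \<in> A" "p \<in> chart_dom c"
  shows "lie_bracket A (\<lambda>q. chart_vector A c q u) (\<lambda>q. chart_vector A c q w) p = 0"
proof -
  let ?t = "tangent_chart A p"
  have der: "fderiv (field_in_chart A ?t (\<lambda>q. chart_vector A c q w)) (chart_map ?t p) (chart_vector A c p u)
      = fderiv (\<lambda>z. fderiv (transition c ?t) z u) (chart_map c p) w" for u w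
  proof -
    have eq: "fderiv (transition ?t c) (chart_map ?t p) (chart_vector A c p u) = u"
      using chart_coords_vector[OF assms] unfolding chart_coords_def .
    then show ?thesis
      using frechet_derivative_at[OF has_derivative_frame_field[OF assms(1) tangent_chart(1) assms(2) tangent_chart(2)],
          THEN fun_cong, of "chart_vector A c p u" w]
      by (simp only: eq)
  qed
  have "fderiv (\<lambda>z. fderiv (transition c ?t) z u) (chart_map c p) w
      = fderiv (\<lambda>z. fderiv (transition c ?t) z w) (chart_map c p) u"
    by (rule symmetric_second_derivative[OF open_transition_dom[OF assms(1) tangent_chart(1)] _
          smooth_on_transition[OF assms(1) tangent_chart(1)]]) (use assms tangent_chart in auto)
  then show ?thesis unfolding lie_bracket_def Let_def der by simp
qed

lemma fun_deriv_chart: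
  assumes "c \<in> A" "p \<in> chart_dom c" and f: "((f \<circ> chart_inv c) has_derivative f') (at (chart_map c p))"
  shows "fun_deriv A f p v = f' (chart_coords A c p v)"
proof -
  let ?t = "tangent_chart A p"
  have eq: "transition ?t c (chart_map ?t p) = chart_map c p" using assms(1,2) tangent_chart by simp
  have "((f \<circ> chart_inv c) has_derivative f') (at (transition ?t c (chart_map ?t p)))"
    unfolding eq by (rule f)
  from has_derivative_compose[OF has_derivative_transition[OF tangent_chart(1) assms(1) tangent_chart(2) assms(2)] this]
  have "((\<lambda>z. (f \<circ> chart_inv c) (transition ?t c z)) has_derivative
      (\<lambda>u. f' (fderiv (transition ?t c) (chart_map ?t p) u))) (at (chart_map ?t p))" .
  then have "(f \<circ> chart_inv ?t has_derivative
      (\<lambda>u. f' (fderiv (transition ?t c) (chart_map ?t p) u))) (at (chart_map ?t p))"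
    by (rule has_derivative_transform_within_open[OF _ open_transition_dom[OF tangent_chart(1) assms(1)]])
      (use assms tangent_chart in auto)
  from frechet_derivative_at[OF this] show ?thesis
    unfolding fun_deriv_def chart_coords_def Let_def by metis
qed

section \<open>Curves and their velocities in charts\<close>

lemma C1_curve_has_coord_velocity:
  assumes "C1_curve A I \<gamma>" "t \<in> I" "c \<in> A" "\<gamma> t \<in> chart_dom c"
  shows "((\<lambda>s. chart_map c (\<gamma> s)) has_vector_derivative coord_velocity c I \<gamma> t) (at t within I)"
  using assms unfolding C1_curve_def coord_velocity_def by (simp add: vector_derivative_works)

lemma C1_curve_continuous_within:
  "\<lbrakk>C1_curve A I \<gamma>; t \<in> I\<rbrakk> \<Longrightarrow> continuous (at t within I) \<gamma>"
  unfolding C1_curve_def by (simp add: continuous_on_eq_continuous_within)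

lemma eventually_in_chart_dom:
  fixes \<gamma> :: "real \<Rightarrow> 'a"
  assumes "continuous (at t within J) \<gamma>" "c \<in> A" "\<gamma> t \<in> chart_dom c"
  shows "\<forall>\<^sub>F s in at t within J. \<gamma> s \<in> chart_dom c"
  using assms open_chart_dom[OF assms(2)] unfolding continuous_within by (metis topological_tendstoD)

lemma has_vector_derivative_chart_change:
  fixes \<gamma> :: "real \<Rightarrow> 'a"
  assumes \<gamma>: "continuous (at t within J) \<gamma>" and t: "t \<in> J" and c: "c \<in> A" "d \<in> A"
    and p: "\<gamma> t \<in> chart_dom c" "\<gamma> t \<in> chart_dom d"
    and u: "((\<lambda>s. chart_map c (\<gamma> s)) has_vector_derivative u) (at t within J)"
  shows "((\<lambda>s. chart_map d (\<gamma> s)) has_vector_derivative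
      fderiv (transition c d) (chart_map c (\<gamma> t)) u) (at t within J)"
proof -
  note D = has_derivative_transition[OF c p]
  have "((\<lambda>s. transition c d (chart_map c (\<gamma> s))) has_derivative
      (\<lambda>h. fderiv (transition c d) (chart_map c (\<gamma> t)) (h *\<^sub>R u))) (at t within J)"
    by (rule has_derivative_compose[OF u[unfolded has_vector_derivative_def] D])
  then have "((\<lambda>s. chart_map d (\<gamma> s)) has_derivative
      (\<lambda>h. fderiv (transition c d) (chart_map c (\<gamma> t)) (h *\<^sub>R u))) (at t within J)"
    by (rule has_derivative_transform_eventually[OF _ _ _ t])
      (use eventually_in_chart_dom[OF \<gamma> c(1) p(1)] c p in \<open>auto elim!: eventually_mono\<close>)
  then show ?thesis
    unfolding has_vector_derivative_def by (simp add: linear_scale[OF has_derivative_linear[OF D]])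
qed

text \<open>The chain rule passes from the tangent chart, in which \<open>velocity\<close> is
  defined and which jumps along the curve, to a fixed chart. The filter has to be proper because
  only then does \<open>vector_derivative\<close> have a determined value.\<close>

lemma chart_coords_velocity:
  assumes "C1_curve A I \<gamma>" "t \<in> I" "at t within I \<noteq> bot" "c \<in> A" "\<gamma> t \<in> chart_dom c"
  shows "chart_coords A c (\<gamma> t) (velocity A I \<gamma> t) = coord_velocity c I \<gamma> t"
proof -
  have "((\<lambda>s. chart_map c (\<gamma> s)) has_vector_derivative
      fderiv (transition (tangent_chart A (\<gamma> t)) c) (chart_map (tangent_chart A (\<gamma> t)) (\<gamma> t)) (velocity A I \<gamma> t))
      (at t within I)"
    unfolding velocity_def
    by (rule has_vector_derivative_chart_change[OF C1_curve_continuous_within[OF assms(1,2)] assms(2)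
          tangent_chart(1) assms(4) tangent_chart(2) assms(5)
          C1_curve_has_coord_velocity[OF assms(1,2) tangent_chart]])
  from vector_derivative_within[OF assms(3) this] show ?thesis
    unfolding chart_coords_def coord_velocity_def by simp
qed

lemma chart_vector_coord_velocity:
  assumes "C1_curve A I \<gamma>" "t \<in> I" "at t within I \<noteq> bot" "c \<in> A" "\<gamma> t \<in> chart_dom c"
  shows "chart_vector A c (\<gamma> t) (coord_velocity c I \<gamma> t) = velocity A I \<gamma> t"
  using chart_coords_velocity[OF assms, symmetric] assms(4,5) by simp

lemma open_chart_ball:
  assumes "c \<in> A"
  shows "open {q \<in> chart_dom c. chart_map c q \<in> ball z r}"
proof -
  have "{q \<in> chart_dom c. chart_map c q \<in> ball z r} = chart_map c -` ball z r \<inter> chart_dom c" by auto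
  then show ?thesis
    using homeomorphism_cont1[OF homeomorphism_chart[OF assms]] open_chart_dom[OF assms]
    by (simp add: continuous_on_open_vimage)
qed

text \<open>The set is the image of a compact ball under the inverse chart, hence compact and, in a
  Hausdorff space, closed in the whole manifold. Closedness relative to the chart domain would not
  prevent a curve from leaving the domain in the limit.\<close>

lemma closed_chart_cball:
  assumes c: "c \<in> A" and r: "cball z r \<subseteq> chart_image c"
  shows "closed {q \<in> chart_dom c. chart_map c q \<in> cball z r}"
proof -
  have "{q \<in> chart_dom c. chart_map c q \<in> cball z r} = chart_inv c ` cball z r"
  proof (intro set_eqI iffI)
    fix q assume "q \<in> {q \<in> chart_dom c. chart_map c q \<in> cball z r}"
    then show "q \<in> chart_inv c ` cball z r" using c by (intro image_eqI[of _ _ "chart_map c q"]) auto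
  next
    fix q assume "q \<in> chart_inv c ` cball z r"
    then obtain y where y: "y \<in> cball z r" "q = chart_inv c y" by blast
    then have "y \<in> chart_image c" using r by blast
    then show "q \<in> {q \<in> chart_dom c. chart_map c q \<in> cball z r}" using y c by simp
  qed
  moreover have "compact (chart_inv c ` cball z r)"
    by (intro compact_continuous_image continuous_on_subset[OF homeomorphism_cont2[OF homeomorphism_chart[OF c]] r]
        compact_cball)
  ultimately show ?thesis by (simp add: compact_imp_closed)
qed

lemma continuous_on_chart_curve:
  fixes \<gamma> :: "real \<Rightarrow> 'a"
  assumes "continuous_on T \<gamma>" "c \<in> A" "\<gamma> ` T \<subseteq> chart_dom c"
  shows "continuous_on T (\<lambda>s. chart_map c (\<gamma> s))"
  by (rule continuous_on_compose2[OF homeomorphism_cont1[OF homeomorphism_chart[OF assms(2)]] assms(1,3)])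

end

section \<open>Metric and Christoffel symbols in a chart\<close>

locale levi_civita_manifold = smooth_manifold A
  for A :: "('a::{t2_space, second_countable_topology}, 'e::euclidean_space) chart set" +
  fixes G :: "('a, 'e) metric_field" and nabla :: "('a, 'e) connection"
  assumes riemannian: "riemannian_manifold A G"
    and levi_civita: "levi_civita_connection A G nabla"
begin

definition chart_metric :: "('a, 'e) chart \<Rightarrow> 'e \<Rightarrow> 'e \<Rightarrow> 'e \<Rightarrow> real" where
  "chart_metric c z v w =
     G (chart_inv c z) (chart_vector A c (chart_inv c z) v) (chart_vector A c (chart_inv c z) w)"

definition metric_deriv :: "('a, 'e) chart \<Rightarrow> 'e \<Rightarrow> 'e \<Rightarrow> 'e \<Rightarrow> 'e \<Rightarrow> real" where
  "metric_deriv c z u v w = fderiv (\<lambda>z. chart_metric c z v w) z u"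

definition Gam :: "('a, 'e) chart \<Rightarrow> 'e \<Rightarrow> 'e \<Rightarrow> 'e \<Rightarrow> 'e" where
  "Gam c z u w = christoffel A nabla c (chart_inv c z) u w"

lemma bilinear_G: "bilinear (G p)" and G_commute: "G p v w = G p w v"
  and G_pos: "v \<noteq> 0 \<Longrightarrow> G p v v > 0"
  using riemannian unfolding riemannian_manifold_def by blast+

lemma G_nonneg: "G p v v \<ge> 0"
  using G_pos[of v p] bilinear_lzero[OF bilinear_G] by (cases "v = 0") auto

lemma riem_norm_nonneg [simp]: "riem_norm G p v \<ge> 0"
  by (simp add: riem_norm_def G_nonneg)

lemma riem_norm_power2: "(riem_norm G p v)\<^sup>2 = G p v v"
  by (simp add: riem_norm_def G_nonneg)

lemma riem_norm_eq_0 [simp]: "riem_norm G p v = 0 \<longleftrightarrow> v = 0"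
  using G_pos[of v p] bilinear_lzero[OF bilinear_G] by (cases "v = 0") (auto simp: riem_norm_def)

lemma G_linear: "linear (\<lambda>v. G p v w)" "linear (G p v)"
  using bilinear_G unfolding bilinear_def by blast+

lemma G_Cauchy_Schwarz: "G p v w \<le> riem_norm G p v * riem_norm G p w"
proof (cases "w = 0")
  case True
  then show ?thesis using bilinear_rzero[OF bilinear_G] by simp
next
  case False
  define a where "a = G p w w"
  define b where "b = G p v w"
  have a: "a > 0" using G_pos[OF False] by (simp add: a_def)
  have "0 \<le> G p (a *\<^sub>R v - b *\<^sub>R w) (a *\<^sub>R v - b *\<^sub>R w)" by (rule G_nonneg)
  also have "\<dots> = a * (a * G p v v - b\<^sup>2)"
    using G_commute[of p w v]
    by (simp add: bilinear_lsub[OF bilinear_G] bilinear_rsub[OF bilinear_G] bilinear_lmul[OF bilinear_G]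
        bilinear_rmul[OF bilinear_G] a_def[symmetric] b_def[symmetric] algebra_simps power2_eq_square)
  finally have "b\<^sup>2 \<le> G p v v * a" using a by (simp add: zero_le_mult_iff mult.commute)
  then have "\<bar>b\<bar> \<le> sqrt (G p v v * a)" by (rule real_le_rsqrt[of "\<bar>b\<bar>", simplified])
  then show ?thesis unfolding riem_norm_def b_def a_def by (simp add: real_sqrt_mult)
qed

lemma G_eq_chart_metric:
  "\<lbrakk>c \<in> A; p \<in> chart_dom c\<rbrakk> \<Longrightarrow>
     G p v w = chart_metric c (chart_map c p) (chart_coords A c p v) (chart_coords A c p w)"
  by (simp add: chart_metric_def)

lemma bilinear_chart_metric:
  assumes "c \<in> A" "z \<in> chart_image c"
  shows "bilinear (chart_metric c z)"
  unfolding bilinear_def chart_metric_def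
  using linear_compose[OF linear_chart_vector[OF assms(1) chart_inv_in_dom[OF assms]] G_linear(1)]
    linear_compose[OF linear_chart_vector[OF assms(1) chart_inv_in_dom[OF assms]] G_linear(2)]
  by (simp add: o_def)

lemma chart_metric_commute: "chart_metric c z v w = chart_metric c z w v"
  by (simp add: chart_metric_def G_commute)

lemma chart_metric_pos:
  assumes "c \<in> A" "z \<in> chart_image c" "v \<noteq> 0"
  shows "chart_metric c z v v > 0"
proof -
  have "chart_vector A c (chart_inv c z) v \<noteq> 0"
  proof
    assume "chart_vector A c (chart_inv c z) v = 0"
    then have "chart_coords A c (chart_inv c z) (chart_vector A c (chart_inv c z) v) = 0"
      using linear_0[OF linear_chart_coords[OF assms(1) chart_inv_in_dom[OF assms(1,2)]]] by simp
    then show False using assms by simp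
  qed
  then show ?thesis unfolding chart_metric_def by (rule G_pos)
qed

text \<open>The means by which identities between vectors are derived from identities between inner
  products, in particular those for \<open>Gam\<close> from the Koszul formula.\<close>

lemma chart_metric_nondegenerate:
  assumes "c \<in> A" "z \<in> chart_image c" "\<And>y. chart_metric c z v y = chart_metric c z w y"
  shows "v = w"
proof (rule ccontr)
  assume "v \<noteq> w"
  then have "chart_metric c z (v - w) (v - w) > 0" using assms chart_metric_pos by simp
  then show False
    using bilinear_lsub[OF bilinear_chart_metric[OF assms(1,2)]] assms(3) by simp
qed

lemma smooth_on_chart_metric: "c \<in> A \<Longrightarrow> smooth_on (chart_image c) (\<lambda>z. chart_metric c z v w)"
  using riemannian unfolding riemannian_manifold_def chart_metric_def Let_def by blast

lemma has_derivative_chart_metric: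
  assumes "c \<in> A" "z \<in> chart_image c"
  shows "((\<lambda>z. chart_metric c z v w) has_derivative (\<lambda>u. metric_deriv c z u v w)) (at z)"
  unfolding metric_deriv_def
  by (rule smooth_on_has_derivative[OF smooth_on_chart_metric[OF assms(1)] assms(2)])

lemma G_frame_fields_chart: "(\<lambda>q. G q (chart_vector A c q v) (chart_vector A c q w)) \<circ> chart_inv c
    = (\<lambda>z. chart_metric c z v w)"
  by (auto simp: chart_metric_def)

section \<open>Christoffel symbols and the Koszul formula\<close>

lemma chart_metric_compatible:
  assumes c: "c \<in> A" and z: "z \<in> chart_image c"
  shows "metric_deriv c z u v w = chart_metric c z (Gam c z u v) w + chart_metric c z v (Gam c z u w)"
proof -
  let ?p = "chart_inv c z" and ?X = "\<lambda>w q. chart_vector A c q w"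
  have p: "?p \<in> chart_dom c" using c z by simp
  have "fun_deriv A (\<lambda>q. G q (?X v q) (?X w q)) ?p (?X u ?p)
      = G ?p (nabla ?p (?X u ?p) (?X v)) (?X w ?p) + G ?p (?X v ?p) (nabla ?p (?X u ?p) (?X w))"
    using levi_civita field_differentiable_frame_field[OF c p] unfolding levi_civita_connection_def by blast
  moreover have "fun_deriv A (\<lambda>q. G q (?X v q) (?X w q)) ?p (?X u ?p) = metric_deriv c z u v w"
    using fun_deriv_chart[OF c p, of "\<lambda>q. G q (?X v q) (?X w q)", unfolded G_frame_fields_chart,
        of _ "?X u ?p"] has_derivative_chart_metric[OF c z, of v w] c z p by simp
  ultimately show ?thesis
    unfolding chart_metric_def Gam_def christoffel_def using c p by simp
qed

lemma Gam_commute: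
  assumes c: "c \<in> A" and z: "z \<in> chart_image c"
  shows "Gam c z u w = Gam c z w u"
proof -
  let ?p = "chart_inv c z" and ?X = "\<lambda>w q. chart_vector A c q w"
  have p: "?p \<in> chart_dom c" using c z by simp
  have "nabla ?p (?X u ?p) (?X w) - nabla ?p (?X w ?p) (?X u) = lie_bracket A (?X u) (?X w) ?p"
    using levi_civita field_differentiable_frame_field[OF c p] unfolding levi_civita_connection_def by blast
  then show ?thesis
    unfolding Gam_def christoffel_def lie_bracket_frame_fields[OF c p] by simp
qed

text \<open>In this combination of three instances of metric compatibility, the symmetry of
  \<open>Gam\<close> cancels everything but twice the left-hand side. The right-hand side involves
  only the metric, which is smooth by assumption.\<close>

lemma koszul_formula:
  assumes "c \<in> A" "z \<in> chart_image c"
  shows "chart_metric c z (Gam c z u w) y =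
    (metric_deriv c z u w y + metric_deriv c z w u y - metric_deriv c z y u w) / 2"
  using chart_metric_compatible[OF assms] Gam_commute[OF assms] chart_metric_commute by simp

lemma bilinear_metric_deriv:
  assumes c: "c \<in> A" and z: "z \<in> chart_image c"
  shows "bilinear (metric_deriv c z u)"
proof -
  have add: "metric_deriv c z u (v + v') w = metric_deriv c z u v w + metric_deriv c z u v' w"
    for v v' w
  proof -
    have "((\<lambda>z. chart_metric c z v w + chart_metric c z v' w) has_derivative
        (\<lambda>u. metric_deriv c z u v w + metric_deriv c z u v' w)) (at z)"
      by (intro has_derivative_add has_derivative_chart_metric c z)
    then have "((\<lambda>z. chart_metric c z (v + v') w) has_derivative
        (\<lambda>u. metric_deriv c z u v w + metric_deriv c z u v' w)) (at z)"
      by (rule has_derivative_transform_within_open[OF _ open_chart_image[OF c] z])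
        (simp add: bilinear_ladd[OF bilinear_chart_metric[OF c]])
    from has_derivative_unique[OF has_derivative_chart_metric[OF c z] this] show ?thesis by metis
  qed
  have scale: "metric_deriv c z u (r *\<^sub>R v) w = r *\<^sub>R metric_deriv c z u v w" for r v w
  proof -
    have "((\<lambda>z. r *\<^sub>R chart_metric c z v w) has_derivative
        (\<lambda>u. r *\<^sub>R metric_deriv c z u v w)) (at z)"
      by (intro has_derivative_scaleR_right has_derivative_chart_metric c z)
    then have "((\<lambda>z. chart_metric c z (r *\<^sub>R v) w) has_derivative
        (\<lambda>u. r *\<^sub>R metric_deriv c z u v w)) (at z)"
      by (rule has_derivative_transform_within_open[OF _ open_chart_image[OF c] z])
        (simp add: bilinear_lmul[OF bilinear_chart_metric[OF c]])
    from has_derivative_unique[OF has_derivative_chart_metric[OF c z] this] show ?thesis by metis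
  qed
  have "metric_deriv c z u v w = metric_deriv c z u w v" for v w
    unfolding metric_deriv_def by (subst chart_metric_commute) simp
  then show ?thesis unfolding bilinear_def linear_iff using add scale by metis
qed

lemma linear_metric_deriv:
  assumes "c \<in> A" "z \<in> chart_image c"
  shows "linear (\<lambda>u. metric_deriv c z u v w)"
  by (rule has_derivative_linear[OF has_derivative_chart_metric[OF assms]])

text \<open>Paired with an arbitrary vector, \<open>Gam\<close> becomes the Koszul expression, which
  is linear in the first slot; symmetry transfers linearity to the second.\<close>

lemma bilinear_Gam:
  assumes c: "c \<in> A" and z: "z \<in> chart_image c"
  shows "bilinear (Gam c z)"
proof -
  note lin = linear_metric_deriv[OF c z] and bil = bilinear_metric_deriv[OF c z]
    and bg = bilinear_chart_metric[OF c z]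
  have add: "Gam c z (u + u') w = Gam c z u w + Gam c z u' w" for u u' w
    by (rule chart_metric_nondegenerate[OF c z])
      (simp add: bilinear_ladd[OF bg] koszul_formula[OF c z] linear_add[OF lin] bilinear_ladd[OF bil]
        bilinear_radd[OF bil] field_simps)
  have scale: "Gam c z (r *\<^sub>R u) w = r *\<^sub>R Gam c z u w" for r u w
    by (rule chart_metric_nondegenerate[OF c z])
      (simp add: bilinear_lmul[OF bg] koszul_formula[OF c z] linear_scale[OF lin] bilinear_lmul[OF bil]
        bilinear_rmul[OF bil] field_simps)
  show ?thesis unfolding bilinear_def linear_iff using add scale Gam_commute[OF c z] by metis
qed

section \<open>Uniform estimates on compact coordinate sets\<close>

lemma chart_metric_lower_bound:
  assumes c: "c \<in> A" and K: "compact K" "K \<subseteq> chart_image c"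
  obtains m where "m > 0" "\<And>z v. z \<in> K \<Longrightarrow> m * (norm v)\<^sup>2 \<le> chart_metric c z v v"
proof (cases "K = {}")
  case True
  then show ?thesis using that[of 1] by simp
next
  case False
  \<comment> \<open>The constant is the minimum over \<open>K\<close> times the unit sphere,
    positive by definiteness; homogeneity extends the bound to all vectors.\<close>
  let ?f = "\<lambda>s. chart_metric c (fst s) (snd s) (snd s)" and ?S = "K \<times> sphere (0::'e) 1"
  obtain b :: 'e where "b \<in> Basis" using nonempty_Basis by blast
  then have ne: "?S \<noteq> {}" using False by (auto simp: norm_Basis)
  have "continuous_on ?S ?f"
    by (rule continuous_on_bilinear_family[OF bilinear_chart_metric[OF c]
          smooth_on_continuous_on[OF smooth_on_chart_metric[OF c]]])
      (use K(2) in \<open>auto intro!: continuous_intros\<close>)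
  from continuous_attains_inf[OF compact_Times[OF K(1) compact_sphere] ne this]
  obtain s where s: "s \<in> ?S" "\<And>s'. s' \<in> ?S \<Longrightarrow> ?f s \<le> ?f s'" by blast
  have "?f s > 0" using s(1) K(2) by (intro chart_metric_pos c) auto
  moreover have "?f s * (norm v)\<^sup>2 \<le> chart_metric c z v v" if z: "z \<in> K" for z v
  proof (cases "v = 0")
    case True
    then show ?thesis using bilinear_lzero[OF bilinear_chart_metric[OF c]] z K(2) by auto
  next
    case False
    have bg: "bilinear (chart_metric c z)" using z K(2) c bilinear_chart_metric by blast
    define u where "u = v /\<^sub>R norm v"
    have v: "v = norm v *\<^sub>R u" using False by (simp add: u_def)
    have "chart_metric c z (norm v *\<^sub>R u) (norm v *\<^sub>R u) = (norm v)\<^sup>2 * chart_metric c z u u"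
      by (simp add: bilinear_lmul[OF bg] bilinear_rmul[OF bg] power2_eq_square)
    then have "chart_metric c z v v = (norm v)\<^sup>2 * chart_metric c z u u"
      by (simp only: v[symmetric])
    moreover have "?f s \<le> chart_metric c z u u"
      using s(2)[of "(z, u)"] z False by (simp add: u_def)
    ultimately show ?thesis by (simp add: mult.commute mult_left_mono)
  qed
  ultimately show ?thesis by (rule that)
qed

lemma chart_metric_upper_bound:
  assumes c: "c \<in> A" and K: "compact K" "K \<subseteq> chart_image c"
  obtains C where "C > 0" "\<And>z v w. z \<in> K \<Longrightarrow> \<bar>chart_metric c z v w\<bar> \<le> C * norm v * norm w"
proof -
  obtain B where B: "B > 0" "\<And>i z. \<lbrakk>i \<in> Basis \<times> Basis; z \<in> K\<rbrakk> \<Longrightarrow>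
      \<bar>chart_metric c z (fst i) (snd i)\<bar> \<le> B * 1"
  proof (rule finite_uniform_bound[where f = "\<lambda>i z. \<bar>chart_metric c z (fst i) (snd i)\<bar>"
        and I = "(Basis::'e set) \<times> Basis" and g = "\<lambda>_. 1" and X = K])
    show "\<exists>B>0. \<forall>z\<in>K. \<bar>chart_metric c z (fst i) (snd i)\<bar> \<le> B * 1" for i
      using smooth_on_bounded[OF smooth_on_chart_metric[OF c] K, of "fst i" "snd i"]
      by (metis mult.right_neutral real_norm_def)
  qed auto
  have "real (DIM('e) * DIM('e)) * B > 0" using B(1) by simp
  moreover have "\<bar>chart_metric c z v w\<bar> \<le> real (DIM('e) * DIM('e)) * B * norm v * norm w" if "z \<in> K" for z v w
    using bilinear_norm_le[OF bilinear_chart_metric[OF c], of z B v w] B(2)[OF _ that] that K(2) by auto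
  ultimately show ?thesis by (rule that)
qed

lemma chart_metric_lipschitz:
  assumes c: "c \<in> A" and K: "compact K" "convex K" "K \<subseteq> chart_image c"
  obtains L where "L > 0"
    "\<And>y z v w. \<lbrakk>y \<in> K; z \<in> K\<rbrakk> \<Longrightarrow>
       \<bar>chart_metric c y v w - chart_metric c z v w\<bar> \<le> L * norm (y - z) * norm v * norm w"
proof -
  obtain L where L: "L > 0" "\<And>i x. \<lbrakk>i \<in> Basis \<times> Basis; x \<in> K \<times> K\<rbrakk> \<Longrightarrow>
      \<bar>chart_metric c (fst x) (fst i) (snd i) - chart_metric c (snd x) (fst i) (snd i)\<bar>
        \<le> L * norm (fst x - snd x)"
  proof (rule finite_uniform_bound[where I = "(Basis::'e set) \<times> Basis" and g = "\<lambda>x. norm (fst x - snd x)"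
        and X = "K \<times> K" and f = "\<lambda>i x. \<bar>chart_metric c (fst x) (fst i) (snd i)
           - chart_metric c (snd x) (fst i) (snd i)\<bar>"])
    fix i :: "'e \<times> 'e"
    show "\<exists>B>0. \<forall>x\<in>K \<times> K. \<bar>chart_metric c (fst x) (fst i) (snd i)
           - chart_metric c (snd x) (fst i) (snd i)\<bar> \<le> B * norm (fst x - snd x)"
      using smooth_on_lipschitz[OF smooth_on_chart_metric[OF c] K, of "fst i" "snd i"]
      by (metis mem_Times_iff real_norm_def)
  qed auto
  have "real (DIM('e) * DIM('e)) * L > 0" using L(1) by simp
  moreover have "\<bar>chart_metric c y v w - chart_metric c z v w\<bar>
      \<le> real (DIM('e) * DIM('e)) * L * norm (y - z) * norm v * norm w" if "y \<in> K" "z \<in> K" for y z v w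
  proof -
    have "bilinear (\<lambda>v w. chart_metric c y v w - chart_metric c z v w)"
      using bilinear_chart_metric[OF c] that K(3) unfolding bilinear_def
      by (auto intro!: linear_compose_sub)
    from bilinear_norm_le[OF this, of "L * norm (y - z)" v w] L(2)[of _ "(y, z)"] that
    show ?thesis by (auto simp: mult.assoc)
  qed
  ultimately show ?thesis by (rule that)
qed

text \<open>The right-hand side of the Koszul formula for basis vectors \<open>i\<close>, \<open>j\<close> is linear in \<open>y\<close>, with
  coefficients that are smooth in the base point.\<close>

lemma Gam_bounded_lipschitz:
  assumes c: "c \<in> A" and K: "compact K" "convex K" "K \<subseteq> chart_image c"
  obtains B L where "B > 0" "L > 0"
    "\<And>z u w. z \<in> K \<Longrightarrow> norm (Gam c z u w) \<le> B * norm u * norm w"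
    "\<And>y z u w. \<lbrakk>y \<in> K; z \<in> K\<rbrakk> \<Longrightarrow> norm (Gam c y u w - Gam c z u w) \<le> L * norm (y - z) * norm u * norm w"
proof -
  define R where "R z u w y =
    (metric_deriv c z u w y + metric_deriv c z w u y - metric_deriv c z y u w) / 2" for z u w y
  let ?R = "\<lambda>z i. R z (fst i) (fst (snd i)) (snd (snd i))"
  obtain m where m: "m > 0" "\<And>z v. z \<in> K \<Longrightarrow> m * (norm v)\<^sup>2 \<le> chart_metric c z v v"
    using chart_metric_lower_bound[OF c K(1,3)] by blast
  obtain l where l: "l > 0" "\<And>y z v w. \<lbrakk>y \<in> K; z \<in> K\<rbrakk> \<Longrightarrow>
       \<bar>chart_metric c y v w - chart_metric c z v w\<bar> \<le> l * norm (y - z) * norm v * norm w"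
    using chart_metric_lipschitz[OF c K] by blast
  have lin: "linear (R z u w)" if "z \<in> K" for z u w
  proof -
    have z: "z \<in> chart_image c" using that K(3) by blast
    show ?thesis
      unfolding R_def
      using bilinear_metric_deriv[OF c z] linear_metric_deriv[OF c z]
      by (auto simp: linear_iff bilinear_def field_simps)
  qed
  have dbound: "\<exists>B>0. \<forall>z\<in>K. \<bar>metric_deriv c z u v w\<bar> \<le> B" for u v w
    using smooth_on_bounded[OF smooth_on_fderiv[OF smooth_on_chart_metric[OF c]] K(1,3), of v w u]
    unfolding metric_deriv_def by (metis real_norm_def)
  have dlip: "\<exists>L>0. \<forall>y\<in>K. \<forall>z\<in>K. \<bar>metric_deriv c y u v w - metric_deriv c z u v w\<bar> \<le> L * norm (y - z)" for u v w
    using smooth_on_lipschitz[OF smooth_on_fderiv[OF smooth_on_chart_metric[OF c]] K, of v w u]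
    unfolding metric_deriv_def by (metis real_norm_def)
  let ?I = "(Basis::'e set) \<times> (Basis::'e set) \<times> (Basis::'e set)"
  obtain b where b: "b > 0" "\<And>i z. \<lbrakk>i \<in> ?I; z \<in> K\<rbrakk> \<Longrightarrow> \<bar>?R z i\<bar> \<le> b * 1"
  proof (rule finite_uniform_bound[where I = ?I and g = "\<lambda>_. 1" and X = K and
        f = "\<lambda>i z. \<bar>?R z i\<bar>"])
    fix i :: "'e \<times> 'e \<times> 'e"
    obtain u v w where i: "i = (u, v, w)" by (metis prod.exhaust)
    obtain b1 where b1: "b1 > 0" "\<And>z. z \<in> K \<Longrightarrow> \<bar>metric_deriv c z u v w\<bar> \<le> b1"
      using dbound[of u v w] by blast
    obtain b2 where b2: "b2 > 0" "\<And>z. z \<in> K \<Longrightarrow> \<bar>metric_deriv c z v u w\<bar> \<le> b2"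
      using dbound[of v u w] by blast
    obtain b3 where b3: "b3 > 0" "\<And>z. z \<in> K \<Longrightarrow> \<bar>metric_deriv c z w u v\<bar> \<le> b3"
      using dbound[of w u v] by blast
    have "\<bar>R z u v w\<bar> \<le> (b1 + b2 + b3) * 1" if "z \<in> K" for z
      using abs_half_add3_le[OF b1(2)[OF that] b2(2)[OF that] b3(2)[OF that]] unfolding R_def by simp
    moreover have "b1 + b2 + b3 > 0" using b1(1) b2(1) b3(1) by simp
    ultimately show "\<exists>B>0. \<forall>z\<in>K. \<bar>?R z i\<bar> \<le> B * 1"
      unfolding i by auto
  qed auto
  obtain L where L: "L > 0" "\<And>i x. \<lbrakk>i \<in> ?I; x \<in> K \<times> K\<rbrakk> \<Longrightarrow>
      \<bar>?R (fst x) i - ?R (snd x) i\<bar>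
        \<le> L * norm (fst x - snd x)"
  proof (rule finite_uniform_bound[where I = ?I and g = "\<lambda>x. norm (fst x - snd x)" and X = "K \<times> K" and
        f = "\<lambda>i x. \<bar>?R (fst x) i - ?R (snd x) i\<bar>"])
    fix i :: "'e \<times> 'e \<times> 'e"
    obtain u v w where i: "i = (u, v, w)" by (metis prod.exhaust)
    obtain b1 where b1: "b1 > 0" "\<And>y z. \<lbrakk>y \<in> K; z \<in> K\<rbrakk> \<Longrightarrow>
        \<bar>metric_deriv c y u v w - metric_deriv c z u v w\<bar> \<le> b1 * norm (y - z)"
      using dlip[of u v w] by blast
    obtain b2 where b2: "b2 > 0" "\<And>y z. \<lbrakk>y \<in> K; z \<in> K\<rbrakk> \<Longrightarrow>
        \<bar>metric_deriv c y v u w - metric_deriv c z v u w\<bar> \<le> b2 * norm (y - z)"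
      using dlip[of v u w] by blast
    obtain b3 where b3: "b3 > 0" "\<And>y z. \<lbrakk>y \<in> K; z \<in> K\<rbrakk> \<Longrightarrow>
        \<bar>metric_deriv c y w u v - metric_deriv c z w u v\<bar> \<le> b3 * norm (y - z)"
      using dlip[of w u v] by blast
    have "\<bar>R y u v w - R z u v w\<bar> \<le> (b1 + b2 + b3) * norm (y - z)" if "y \<in> K" "z \<in> K" for y z
    proof -
      have "R y u v w - R z u v w = ((metric_deriv c y u v w - metric_deriv c z u v w)
        + (metric_deriv c y v u w - metric_deriv c z v u w)
        - (metric_deriv c y w u v - metric_deriv c z w u v)) / 2"
        unfolding R_def by (simp add: field_simps)
      also have "\<bar>\<dots>\<bar> \<le> b1 * norm (y - z) + b2 * norm (y - z) + b3 * norm (y - z)"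
        by (rule abs_half_add3_le[OF b1(2)[OF that] b2(2)[OF that] b3(2)[OF that]])
      finally show ?thesis by (simp add: algebra_simps)
    qed
    moreover have "b1 + b2 + b3 > 0" using b1(1) b2(1) b3(1) by simp
    ultimately show "\<exists>B>0. \<forall>x\<in>K \<times> K. \<bar>?R (fst x) i
        - ?R (snd x) i\<bar> \<le> B * norm (fst x - snd x)"
      unfolding i by auto
  qed auto
  let ?n = "real DIM('e)" and ?N = "real (DIM('e) * DIM('e))"
  have koszul: "chart_metric c z (Gam c z u w) y = R z u w y" if "z \<in> K" for z u w y
    unfolding R_def using koszul_formula[OF c] that K(3) by blast
  \<comment> \<open>The Koszul formula is tested with the vector \<open>Gam c z i j\<close> itself:
    the lower bound of the metric gives its squared norm on the left, the right-hand side is linear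
    in it, and one factor of the norm cancels.\<close>
  have bound: "norm (Gam c z i j) \<le> ?n * b / m" if "i \<in> Basis" "j \<in> Basis" "z \<in> K" for z i j
  proof -
    let ?v = "Gam c z i j"
    have "m * (norm ?v)\<^sup>2 \<le> R z i j ?v" using m(2)[OF that(3), of ?v] koszul[OF that(3)] by simp
    also have "\<dots> \<le> ?n * b * norm ?v"
      using linear_norm_le[OF lin[OF that(3)], where B = b and v = ?v] b(2)[of "(i, j, _)" z] that by fastforce
    finally have "(m * norm ?v) * norm ?v \<le> (?n * b) * norm ?v" by (simp add: power2_eq_square)
    then have "norm ?v = 0 \<or> m * norm ?v \<le> ?n * b"
      using mult_right_le_imp_le by (metis norm_ge_zero order_le_less)
    then show ?thesis using m(1) b(1) by (auto simp: field_simps)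
  qed
  let ?B = "?n * b / m"
  define M where "M = (?n * L + l * ?B) / m"
  have M: "M > 0" unfolding M_def
    using m(1) l(1) b(1) L(1) by (intro divide_pos_pos add_pos_pos mult_pos_pos) auto
  \<comment> \<open>Tested with the difference \<open>?v\<close> of the symbols. The Koszul formula
    at \<open>z\<close> uses the metric at \<open>z\<close>, so measuring everything with the metric
    at \<open>y\<close> costs an extra term: the Lipschitz constant \<open>l\<close> of the metric
    times the bound \<open>?B\<close> of the symbols. This is the second summand in
    \<open>M\<close>.\<close>
  have lip: "norm (Gam c y i j - Gam c z i j) \<le> M * norm (y - z)"
    if "i \<in> Basis" "j \<in> Basis" "y \<in> K" "z \<in> K" for y z i j
  proof -
    let ?v = "Gam c y i j - Gam c z i j"
    have "linear (\<lambda>v. R y i j v - R z i j v)" by (intro linear_compose_sub lin that)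
    from linear_norm_le[OF this, of "L * norm (y - z)" ?v]
    have r: "\<bar>R y i j ?v - R z i j ?v\<bar> \<le> ?n * (L * norm (y - z)) * norm ?v"
      using L(2)[of "(i, j, _)" "(y, z)"] that by fastforce
    have "\<bar>chart_metric c y (Gam c z i j) ?v - chart_metric c z (Gam c z i j) ?v\<bar>
        \<le> l * norm (y - z) * norm (Gam c z i j) * norm ?v"
      by (rule l(2)[OF that(3,4)])
    also have "\<dots> \<le> l * norm (y - z) * ?B * norm ?v"
      using bound[OF that(1,2,4)] l(1)
      by (intro mult_right_mono[where c = "norm ?v"] mult_left_mono) auto
    finally have s: "\<bar>chart_metric c y (Gam c z i j) ?v - chart_metric c z (Gam c z i j) ?v\<bar>
        \<le> l * norm (y - z) * ?B * norm ?v" .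
    have "m * (norm ?v)\<^sup>2 \<le> chart_metric c y ?v ?v" by (rule m(2)[OF that(3)])
    also have "\<dots> = chart_metric c y (Gam c y i j) ?v - chart_metric c y (Gam c z i j) ?v"
      using bilinear_lsub[OF bilinear_chart_metric[OF c]] that(3) K(3) by blast
    also have "\<dots> = (R y i j ?v - R z i j ?v)
        - (chart_metric c y (Gam c z i j) ?v - chart_metric c z (Gam c z i j) ?v)"
      by (simp add: koszul that)
    also have "\<dots> \<le> ?n * (L * norm (y - z)) * norm ?v + l * norm (y - z) * ?B * norm ?v"
      using r s by linarith
    also have "\<dots> = (m * M * norm (y - z)) * norm ?v"
      using m(1) unfolding M_def by (simp add: field_simps)
    finally have "(m * norm ?v) * norm ?v \<le> (m * M * norm (y - z)) * norm ?v"
      by (simp add: power2_eq_square)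
    then have "norm ?v = 0 \<or> m * norm ?v \<le> m * M * norm (y - z)"
      using mult_right_le_imp_le by (metis norm_ge_zero order_le_less)
    then show ?thesis using m(1) M by (auto simp: mult.assoc)
  qed
  show ?thesis
  proof (rule that)
    show "?N * ?B > 0" using b(1) m(1) by simp
    show "?N * M > 0" using M by simp
    show "norm (Gam c z u w) \<le> ?N * ?B * norm u * norm w" if "z \<in> K" for z u w
      using bilinear_norm_le[OF bilinear_Gam[OF c], of z ?B u w] bound that K(3) by blast
    show "norm (Gam c y u w - Gam c z u w) \<le> ?N * M * norm (y - z) * norm u * norm w"
      if "y \<in> K" "z \<in> K" for y z u w
    proof -
      have "bilinear (\<lambda>u w. Gam c y u w - Gam c z u w)"
        using bilinear_Gam[OF c] that K(3) unfolding bilinear_def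
        by (auto intro!: linear_compose_sub)
      from bilinear_norm_le[OF this, of "M * norm (y - z)" u w] lip that
      show ?thesis by (auto simp: mult.assoc)
    qed
  qed
qed

lemma continuous_on_Gam_fixed:
  assumes c: "c \<in> A"
  shows "continuous_on (chart_image c) (\<lambda>z. Gam c z u w)"
proof -
  have "isCont (\<lambda>z. Gam c z u w) z" if z: "z \<in> chart_image c" for z
  proof -
    obtain r where r: "r > 0" "cball z r \<subseteq> chart_image c"
      using open_contains_cball open_chart_image[OF c] z by blast
    obtain L where L: "L > 0" "\<And>y z' u w. \<lbrakk>y \<in> cball z r; z' \<in> cball z r\<rbrakk> \<Longrightarrow>
        norm (Gam c y u w - Gam c z' u w) \<le> L * norm (y - z') * norm u * norm w"
      using Gam_bounded_lipschitz[OF c compact_cball convex_cball r(2)] by metis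
    have "((\<lambda>y. L * norm (y - z) * norm u * norm w) \<longlongrightarrow> L * norm (z - z) * norm u * norm w) (at z)"
      by (intro tendsto_intros)
    then have t: "((\<lambda>y. L * norm (y - z) * norm u * norm w) \<longlongrightarrow> 0) (at z)" by simp
    have "\<forall>\<^sub>F y in at z. norm (Gam c y u w - Gam c z u w) \<le> L * norm (y - z) * norm u * norm w"
      using r(1) L(2)[of _ z u w] unfolding eventually_at
      by (intro exI[of _ r]) (auto simp: dist_commute)
    from Lim_null_comparison[OF this t] show ?thesis
      unfolding isCont_def by (subst LIM_zero_iff[symmetric])
  qed
  then show ?thesis by (simp add: continuous_at_imp_continuous_on)
qed

lemma continuous_on_Gam:
  assumes c: "c \<in> A" and "continuous_on T z" "z ` T \<subseteq> chart_image c" "continuous_on T u" "continuous_on T w"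
  shows "continuous_on T (\<lambda>s. Gam c (z s) (u s) (w s))"
  by (rule continuous_on_bilinear_family[OF bilinear_Gam[OF c] continuous_on_Gam_fixed[OF c]])
    (use assms in auto)

lemma continuous_on_chart_metric:
  assumes c: "c \<in> A" and "continuous_on T z" "z ` T \<subseteq> chart_image c" "continuous_on T u" "continuous_on T w"
  shows "continuous_on T (\<lambda>s. chart_metric c (z s) (u s) (w s))"
  by (rule continuous_on_bilinear_family[OF bilinear_chart_metric[OF c]
        smooth_on_continuous_on[OF smooth_on_chart_metric[OF c]]])
    (use assms in auto)

section \<open>Fields along curves\<close>

lemma christoffel_eq_Gam:
  "\<lbrakk>c \<in> A; p \<in> chart_dom c\<rbrakk> \<Longrightarrow> christoffel A nabla c p u w = Gam c (chart_map c p) u w"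
  by (simp add: Gam_def)

lemma has_vector_derivative_G_curve:
  fixes \<gamma> :: "real \<Rightarrow> 'a"
  assumes \<gamma>: "continuous (at t within J) \<gamma>" and t: "t \<in> J" and c: "c \<in> A" and p: "\<gamma> t \<in> chart_dom c"
    and u: "((\<lambda>s. chart_map c (\<gamma> s)) has_vector_derivative u) (at t within J)"
    and V: "((\<lambda>s. chart_coords A c (\<gamma> s) (V s)) has_vector_derivative v') (at t within J)"
    and W: "((\<lambda>s. chart_coords A c (\<gamma> s) (W s)) has_vector_derivative w') (at t within J)"
  shows "((\<lambda>s. G (\<gamma> s) (V s) (W s)) has_vector_derivative
     metric_deriv c (chart_map c (\<gamma> t)) u (chart_coords A c (\<gamma> t) (V t)) (chart_coords A c (\<gamma> t) (W t))
     + chart_metric c (chart_map c (\<gamma> t)) v' (chart_coords A c (\<gamma> t) (W t))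
     + chart_metric c (chart_map c (\<gamma> t)) (chart_coords A c (\<gamma> t) (V t)) w') (at t within J)"
proof -
  let ?z = "chart_map c (\<gamma> t)" and ?v = "chart_coords A c (\<gamma> t) (V t)" and ?w = "chart_coords A c (\<gamma> t) (W t)"
  have z: "?z \<in> chart_image c" using p by blast
  have "((\<lambda>s. chart_metric c (chart_map c (\<gamma> s)) (chart_coords A c (\<gamma> s) (V s)) (chart_coords A c (\<gamma> s) (W s)))
    has_derivative (\<lambda>h.
     metric_deriv c ?z (h *\<^sub>R u) ?v ?w
     + chart_metric c ?z (h *\<^sub>R v') ?w
     + chart_metric c ?z ?v (h *\<^sub>R w'))) (at t within J)"
    by (rule has_derivative_bilinear_family[OF open_chart_image[OF c] z t bilinear_chart_metric[OF c]
          has_derivative_chart_metric[OF c z] u[unfolded has_vector_derivative_def]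
          V[unfolded has_vector_derivative_def] W[unfolded has_vector_derivative_def]])
  then have "((\<lambda>s. G (\<gamma> s) (V s) (W s)) has_derivative (\<lambda>h.
     metric_deriv c ?z (h *\<^sub>R u) ?v ?w
     + chart_metric c ?z (h *\<^sub>R v') ?w
     + chart_metric c ?z ?v (h *\<^sub>R w'))) (at t within J)"
    by (rule has_derivative_transform_eventually[OF _ _ _ t])
      (use eventually_in_chart_dom[OF \<gamma> c p] c p in \<open>auto elim!: eventually_mono simp: G_eq_chart_metric\<close>)
  then show ?thesis
    unfolding has_vector_derivative_def
    by (simp add: linear_scale[OF linear_metric_deriv[OF c z]] bilinear_lmul[OF bilinear_chart_metric[OF c z]]
        bilinear_rmul[OF bilinear_chart_metric[OF c z]] algebra_simps)
qed

text \<open>Metric compatibility, available only for fields on the manifold, is applied to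
  \<open>X\<close> and a frame field that coincides with \<open>V\<close> at time \<open>t\<close>.
  The Christoffel term which the frame field contributes is exactly the derivative of the components
  of \<open>V\<close>. In this way \<open>nabla\<close> of \<open>X\<close> enters without any
  coordinate formula for it.\<close>

lemma has_vector_derivative_G_field_parallel:
  fixes \<gamma> :: "real \<Rightarrow> 'a"
  assumes \<gamma>: "continuous (at t within J) \<gamma>" and t: "t \<in> J" and c: "c \<in> A" and p: "\<gamma> t \<in> chart_dom c"
    and u: "((\<lambda>s. chart_map c (\<gamma> s)) has_vector_derivative u) (at t within J)"
    and X: "field_differentiable_at A X (\<gamma> t)"
    and V: "((\<lambda>s. chart_coords A c (\<gamma> s) (V s)) has_vector_derivative
        - Gam c (chart_map c (\<gamma> t)) u (chart_coords A c (\<gamma> t) (V t))) (at t within J)"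
  shows "((\<lambda>s. G (\<gamma> s) (X (\<gamma> s)) (V s)) has_vector_derivative
     G (\<gamma> t) (nabla (\<gamma> t) (chart_vector A c (\<gamma> t) u) X) (V t)) (at t within J)"
proof -
  let ?z = "chart_map c (\<gamma> t)" and ?X = "field_in_chart A c X" and ?v = "chart_coords A c (\<gamma> t) (V t)"
  \<comment> \<open>The frame field with the components that \<open>V\<close> has at time
    \<open>t\<close>; it replaces \<open>V\<close>, which is defined only along the curve.\<close>
  let ?Y = "\<lambda>q. chart_vector A c q ?v"
  have z: "?z \<in> chart_image c" and inv: "chart_inv c ?z = \<gamma> t" using p c by auto
  note bg = bilinear_chart_metric[OF c z]
  define X' where "X' = fderiv ?X ?z"
  have X': "(?X has_derivative X') (at ?z)"
    using X c p unfolding field_differentiable_at_def X'_def by (metis frechet_derivative_works)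
  have Xz: "?X ?z = chart_coords A c (\<gamma> t) (X (\<gamma> t))" by (simp add: field_in_chart_def inv)
  have "((\<lambda>z. chart_metric c z (?X z) ?v) has_derivative
      (\<lambda>h. metric_deriv c ?z h (?X ?z) ?v + chart_metric c ?z (X' h) ?v + chart_metric c ?z (?X ?z) 0)) (at ?z)"
    by (rule has_derivative_bilinear_family[where z = "\<lambda>z. z" and z' = "\<lambda>h. h" and I = UNIV and w' = "\<lambda>_. 0",
          OF open_chart_image[OF c] z UNIV_I bilinear_chart_metric[OF c] has_derivative_chart_metric[OF c z]
          has_derivative_ident X' has_derivative_const])
  then have "((\<lambda>q. G q (X q) (?Y q)) \<circ> chart_inv c has_derivative
      (\<lambda>h. metric_deriv c ?z h (?X ?z) ?v + chart_metric c ?z (X' h) ?v + chart_metric c ?z (?X ?z) 0)) (at ?z)"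
    by (rule has_derivative_transform_within_open[OF _ open_chart_image[OF c] z])
      (simp add: chart_metric_def field_in_chart_def c)
  from fun_deriv_chart[OF c p this, of "chart_vector A c (\<gamma> t) u"]
  have "fun_deriv A (\<lambda>q. G q (X q) (?Y q)) (\<gamma> t) (chart_vector A c (\<gamma> t) u)
     = metric_deriv c ?z u (?X ?z) ?v + chart_metric c ?z (X' u) ?v"
    using c p by (simp add: bilinear_rzero[OF bg])
  moreover have "fun_deriv A (\<lambda>q. G q (X q) (?Y q)) (\<gamma> t) (chart_vector A c (\<gamma> t) u)
     = G (\<gamma> t) (nabla (\<gamma> t) (chart_vector A c (\<gamma> t) u) X) (?Y (\<gamma> t))
     + G (\<gamma> t) (X (\<gamma> t)) (nabla (\<gamma> t) (chart_vector A c (\<gamma> t) u) ?Y)"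
    using levi_civita X field_differentiable_frame_field[OF c p] unfolding levi_civita_connection_def by blast
  moreover have "G (\<gamma> t) (X (\<gamma> t)) (nabla (\<gamma> t) (chart_vector A c (\<gamma> t) u) ?Y)
     = chart_metric c ?z (?X ?z) (Gam c ?z u ?v)"
    unfolding G_eq_chart_metric[OF c p] Xz Gam_def christoffel_def inv by simp
  ultimately have nab: "G (\<gamma> t) (nabla (\<gamma> t) (chart_vector A c (\<gamma> t) u) X) (V t)
     = metric_deriv c ?z u (?X ?z) ?v + chart_metric c ?z (X' u) ?v + chart_metric c ?z (?X ?z) (- Gam c ?z u ?v)"
    using c p by (simp add: bilinear_rneg[OF bg])
  have "((\<lambda>s. ?X (chart_map c (\<gamma> s))) has_vector_derivative X' u) (at t within J)"
    using has_derivative_compose[OF u[unfolded has_vector_derivative_def] X']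
    unfolding has_vector_derivative_def by (simp add: linear_scale[OF has_derivative_linear[OF X']])
  then have "((\<lambda>s. chart_coords A c (\<gamma> s) (X (\<gamma> s))) has_vector_derivative X' u) (at t within J)"
    unfolding has_vector_derivative_def
    by (rule has_derivative_transform_eventually[OF _ _ _ t])
      (use eventually_in_chart_dom[OF \<gamma> c p] c p in \<open>auto elim!: eventually_mono simp: field_in_chart_def\<close>)
  from has_vector_derivative_G_curve[OF \<gamma> t c p u this V] show ?thesis
    unfolding nab Xz by simp
qed

lemma has_vector_derivative_G_parallel:
  fixes \<gamma> :: "real \<Rightarrow> 'a"
  assumes \<gamma>: "continuous (at t within J) \<gamma>" and t: "t \<in> J" and c: "c \<in> A" and p: "\<gamma> t \<in> chart_dom c"
    and u: "((\<lambda>s. chart_map c (\<gamma> s)) has_vector_derivative u) (at t within J)"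
    and V: "((\<lambda>s. chart_coords A c (\<gamma> s) (V s)) has_vector_derivative
        - Gam c (chart_map c (\<gamma> t)) u (chart_coords A c (\<gamma> t) (V t))) (at t within J)"
    and W: "((\<lambda>s. chart_coords A c (\<gamma> s) (W s)) has_vector_derivative
        - Gam c (chart_map c (\<gamma> t)) u (chart_coords A c (\<gamma> t) (W t))) (at t within J)"
  shows "((\<lambda>s. G (\<gamma> s) (V s) (W s)) has_vector_derivative 0) (at t within J)"
proof -
  have z: "chart_map c (\<gamma> t) \<in> chart_image c" using p by blast
  show ?thesis
    using has_vector_derivative_G_curve[OF \<gamma> t c p u V W]
    by (simp add: chart_metric_compatible[OF c z] bilinear_lneg[OF bilinear_chart_metric[OF c z]]
        bilinear_rneg[OF bilinear_chart_metric[OF c z]])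
qed

text \<open>Whether a field along a curve solves the equation of parallel transport at \<open>t\<close> can be read off
  from the derivatives of its inner products with the frame fields of any chart, hence the equation
  need only be checked in one chart.\<close>

lemma parallel_chart_change:
  fixes \<gamma> :: "real \<Rightarrow> 'a"
  assumes \<gamma>: "continuous (at t within J) \<gamma>" and t: "t \<in> J" and c: "c \<in> A" "d \<in> A"
    and p: "\<gamma> t \<in> chart_dom c" "\<gamma> t \<in> chart_dom d"
    and u: "((\<lambda>s. chart_map c (\<gamma> s)) has_vector_derivative u) (at t within J)"
    and u': "((\<lambda>s. chart_map d (\<gamma> s)) has_vector_derivative u') (at t within J)"
    and V: "((\<lambda>s. chart_coords A c (\<gamma> s) (V s)) has_vector_derivative
        - Gam c (chart_map c (\<gamma> t)) u (chart_coords A c (\<gamma> t) (V t))) (at t within J)"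
  shows "((\<lambda>s. chart_coords A d (\<gamma> s) (V s)) has_vector_derivative
        - Gam d (chart_map d (\<gamma> t)) u' (chart_coords A d (\<gamma> t) (V t))) (at t within J)"
proof (cases "at t within J = bot")
  \<comment> \<open>\<open>J\<close> may be a single point; then every bounded linear map is a
    derivative.\<close>
  case True
  then show ?thesis
    unfolding has_vector_derivative_def has_derivative_def by (auto intro: bounded_linear_minus bounded_linear_scaleR_left)
next
  case False
  let ?z = "chart_map d (\<gamma> t)" and ?v = "chart_coords A d (\<gamma> t) (V t)" and ?T = "\<lambda>z. fderiv (transition c d) z"
  have z: "?z \<in> chart_image d" and inv: "chart_inv d ?z = \<gamma> t" using p c by auto
  have zc: "chart_map c (\<gamma> t) \<in> chart_map c ` (chart_dom c \<inter> chart_dom d)" using p by blast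
  have "u' = ?T (chart_map c (\<gamma> t)) u"
    by (rule vector_derivative_unique_within[OF False u' has_vector_derivative_chart_change[OF \<gamma> t c p u]])
  then have u'_eq: "chart_vector A d (\<gamma> t) u' = chart_vector A c (\<gamma> t) u"
    using chart_coords_chart_vector[OF c p, of u] chart_vector_coords[OF c(2) p(2)] by metis
  obtain v' where v': "((\<lambda>s. chart_coords A d (\<gamma> s) (V s)) has_vector_derivative v') (at t within J)"
  proof -
    \<comment> \<open>The dummy scalar factor turns the linear maps \<open>?T z\<close> into
      bilinear ones, so that the product rule for bilinear families applies. Only the existence of a
      derivative is kept; its value is found below by testing with frame fields.\<close>
    let ?b = "\<lambda>z (x::real) v. x *\<^sub>R ?T z v"
    have bil: "bilinear (?b z)" if z: "z \<in> chart_map c ` (chart_dom c \<inter> chart_dom d)" for z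
    proof -
      obtain q where q: "q \<in> chart_dom c" "q \<in> chart_dom d" "z = chart_map c q" using z by blast
      have "linear (?T z)" unfolding q(3) by (rule has_derivative_linear[OF has_derivative_transition[OF c q(1,2)]])
      then show ?thesis unfolding bilinear_def by (auto simp: linear_iff scaleR_add_left scaleR_add_right)
    qed
    have D: "((\<lambda>z. ?b z x v) has_derivative
        (\<lambda>h. x *\<^sub>R fderiv (\<lambda>z. ?T z h) (chart_map c (\<gamma> t)) v)) (at (chart_map c (\<gamma> t)))" for x v
      by (intro has_derivative_scaleR_right has_derivative_fderiv_transition c p)
    have "((\<lambda>s. ?b (chart_map c (\<gamma> s)) 1 (chart_coords A c (\<gamma> s) (V s))) differentiable (at t within J))"
      using has_derivative_bilinear_family[OF open_transition_dom[OF c] zc t bil D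
          u[unfolded has_vector_derivative_def] has_derivative_const V[unfolded has_vector_derivative_def]]
      unfolding differentiable_def by blast
    then obtain f' where "((\<lambda>s. ?b (chart_map c (\<gamma> s)) 1 (chart_coords A c (\<gamma> s) (V s))) has_derivative f') (at t within J)"
      unfolding differentiable_def by blast
    moreover have "\<forall>\<^sub>F s in at t within J. ?b (chart_map c (\<gamma> s)) 1 (chart_coords A c (\<gamma> s) (V s)) = chart_coords A d (\<gamma> s) (V s)"
      using eventually_conj[OF eventually_in_chart_dom[OF \<gamma> c(1) p(1)] eventually_in_chart_dom[OF \<gamma> c(2) p(2)]]
      by (rule eventually_mono) (use chart_coords_change[OF c] in simp)
    ultimately have "((\<lambda>s. chart_coords A d (\<gamma> s) (V s)) has_derivative f') (at t within J)"
      by (rule has_derivative_transform_eventually[OF _ _ _ t]) (use chart_coords_change[OF c p] in simp)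
    then have "(\<lambda>s. chart_coords A d (\<gamma> s) (V s)) differentiable (at t within J)"
      unfolding differentiable_def by blast
    then show ?thesis using that vector_derivative_works by blast
  qed
  have "v' = - Gam d ?z u' ?v"
  proof (rule chart_metric_nondegenerate[OF c(2) z])
    fix w
    let ?X = "\<lambda>q. chart_vector A d q w"
    have "((\<lambda>s. G (\<gamma> s) (?X (\<gamma> s)) (V s)) has_vector_derivative
       G (\<gamma> t) (nabla (\<gamma> t) (chart_vector A d (\<gamma> t) u') ?X) (V t)) (at t within J)"
      unfolding u'_eq
      by (rule has_vector_derivative_G_field_parallel[OF \<gamma> t c(1) p(1) u
            field_differentiable_frame_field[OF c(2) p(2)] V])
    moreover have "G (\<gamma> t) (nabla (\<gamma> t) (chart_vector A d (\<gamma> t) u') ?X) (V t) = chart_metric d ?z (Gam d ?z u' w) ?v"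
      unfolding G_eq_chart_metric[OF c(2) p(2)] Gam_def christoffel_def inv by simp
    moreover have "((\<lambda>s. chart_coords A d (\<gamma> s) (?X (\<gamma> s))) has_vector_derivative 0) (at t within J)"
    proof -
      have "((\<lambda>s. w) has_derivative (\<lambda>h. 0)) (at t within J)" by simp
      then have "((\<lambda>s. chart_coords A d (\<gamma> s) (?X (\<gamma> s))) has_derivative (\<lambda>h. 0)) (at t within J)"
        by (rule has_derivative_transform_eventually[OF _ _ _ t])
          (use eventually_in_chart_dom[OF \<gamma> c(2) p(2)] c p in \<open>auto elim!: eventually_mono\<close>)
      then show ?thesis by (simp add: has_vector_derivative_def)
    qed
    from has_vector_derivative_G_curve[OF \<gamma> t c(2) p(2) u' this v']
    have "((\<lambda>s. G (\<gamma> s) (?X (\<gamma> s)) (V s)) has_vector_derivative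
       metric_deriv d ?z u' w ?v + chart_metric d ?z w v') (at t within J)"
      using c p by (simp add: bilinear_lzero[OF bilinear_chart_metric[OF c(2) z]])
    ultimately have "chart_metric d ?z (Gam d ?z u' w) ?v = metric_deriv d ?z u' w ?v + chart_metric d ?z w v'"
      using vector_derivative_unique_within[OF False] by metis
    then show "chart_metric d ?z v' w = chart_metric d ?z (- Gam d ?z u' ?v) w"
      by (simp add: chart_metric_compatible[OF c(2) z] bilinear_lneg[OF bilinear_chart_metric[OF c(2) z]]
          chart_metric_commute[of d ?z w])
  qed
  then show ?thesis using v' by simp
qed

section \<open>Parallel transport\<close>

text \<open>The equation of parallel transport on \<open>J \<subseteq> I\<close>, with one-sided derivatives at the boundary
  points of \<open>J\<close>; the velocity of the curve is the one with respect to \<open>I\<close>.\<close>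

definition parallel_on :: "real set \<Rightarrow> (real \<Rightarrow> 'a) \<Rightarrow> real set \<Rightarrow> (real \<Rightarrow> 'e) \<Rightarrow> bool" where
  "parallel_on I \<gamma> J V \<longleftrightarrow> (\<forall>c\<in>A. \<forall>t\<in>J. \<gamma> t \<in> chart_dom c \<longrightarrow>
     ((\<lambda>s. chart_coords A c (\<gamma> s) (V s)) has_vector_derivative
       - Gam c (chart_map c (\<gamma> t)) (coord_velocity c I \<gamma> t) (chart_coords A c (\<gamma> t) (V t))) (at t within J))"

lemma parallel_along_iff: "parallel_along A nabla I \<gamma> V \<longleftrightarrow> parallel_on I \<gamma> I V"
  unfolding parallel_along_def parallel_on_def by (auto simp: christoffel_eq_Gam)

lemma parallel_onD:
  assumes "parallel_on I \<gamma> J V" "c \<in> A" "t \<in> J" "\<gamma> t \<in> chart_dom c"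
  shows "((\<lambda>s. chart_coords A c (\<gamma> s) (V s)) has_vector_derivative
       - Gam c (chart_map c (\<gamma> t)) (coord_velocity c I \<gamma> t) (chart_coords A c (\<gamma> t) (V t))) (at t within J)"
  using assms unfolding parallel_on_def by blast

text \<open>At the joint both one-sided derivatives are given by the same equation with the same
  vector and the same velocity, the one with respect to \<open>I\<close>, so they agree
  automatically.\<close>

lemma parallel_on_glue:
  assumes V: "parallel_on I \<gamma> {a..b} V" and W: "parallel_on I \<gamma> {b..c} W" and eq: "V b = W b"
    and abc: "a \<le> b" "b \<le> c"
  shows "parallel_on I \<gamma> {a..c} (\<lambda>t. if t \<le> b then V t else W t)" (is "parallel_on _ _ _ ?U")
  unfolding parallel_on_def
proof (intro ballI impI)
  fix d t assume d: "d \<in> A" and t: "t \<in> {a..c}" and p: "\<gamma> t \<in> chart_dom d"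
  let ?D = "\<lambda>X. - Gam d (chart_map d (\<gamma> t)) (coord_velocity d I \<gamma> t) (chart_coords A d (\<gamma> t) (X t))"
  have U: "(if t \<in> {a..b} then ?D V else ?D W) = ?D ?U"
    using t by auto
  have "((\<lambda>s. if s \<in> {a..b} then chart_coords A d (\<gamma> s) (V s) else chart_coords A d (\<gamma> s) (W s))
      has_vector_derivative (if t \<in> {a..b} then ?D V else ?D W)) (at t within {a..c})"
  proof (rule has_vector_derivative_If_within_closures[where T = "{b..c}"])
    show "t \<in> {a..b} \<union> {b..c}" "{a..c} = {a..b} \<union> {b..c}" using t abc by auto
    show "((\<lambda>s. chart_coords A d (\<gamma> s) (V s)) has_vector_derivative ?D V)
        (at t within {a..b} \<union> closure {a..b} \<inter> closure {b..c})"
      if "t \<in> {a..b} \<union> closure {a..b} \<inter> closure {b..c}"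
    proof -
      have "{a..b} \<union> closure {a..b} \<inter> closure {b..c} = {a..b}" by auto
      then show ?thesis using that parallel_onD[OF V d _ p] by simp
    qed
    show "((\<lambda>s. chart_coords A d (\<gamma> s) (W s)) has_vector_derivative ?D W)
        (at t within {b..c} \<union> closure {a..b} \<inter> closure {b..c})"
      if "t \<in> {b..c} \<union> closure {a..b} \<inter> closure {b..c}"
    proof -
      have "{b..c} \<union> closure {a..b} \<inter> closure {b..c} = {b..c}" by auto
      then show ?thesis using that parallel_onD[OF W d _ p] by simp
    qed
    assume "t \<in> closure {a..b}" "t \<in> closure {b..c}"
    then have "t = b" by auto
    then show "chart_coords A d (\<gamma> t) (V t) = chart_coords A d (\<gamma> t) (W t)" "?D V = ?D W"
      using eq by auto
  qed
  then show "((\<lambda>s. chart_coords A d (\<gamma> s) (?U s)) has_vector_derivative ?D ?U) (at t within {a..c})"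
    unfolding U by (rule has_vector_derivative_transform[OF t, rotated]) auto
qed

text \<open>The equation is solved for the components in the single chart \<open>c\<close>;
  invariance under chart change then gives it in every other chart.\<close>

lemma parallel_on_chart_exists:
  assumes \<gamma>: "C1_curve A I \<gamma>" and ab: "a \<le> b" "{a..b} \<subseteq> I" and t1: "t1 \<in> {a..b}"
    and c: "c \<in> A" and dom: "\<And>t. t \<in> {a..b} \<Longrightarrow> \<gamma> t \<in> chart_dom c"
    and K: "\<And>s v. s \<in> {a..b} \<Longrightarrow> norm (Gam c (chart_map c (\<gamma> s)) (coord_velocity c I \<gamma> s) v) \<le> K * norm v"
    and small: "K * (b - a) < 1"
  obtains V where "parallel_on I \<gamma> {a..b} V" "V t1 = v"
proof -
  let ?B = "\<lambda>s v. - Gam c (chart_map c (\<gamma> s)) (coord_velocity c I \<gamma> s) v"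
  have img: "(\<lambda>s. chart_map c (\<gamma> s)) ` {a..b} \<subseteq> chart_image c" using dom by blast
  have vel: "((\<lambda>s. chart_map c (\<gamma> s)) has_vector_derivative coord_velocity c I \<gamma> t) (at t within {a..b})"
    if "c \<in> A" "t \<in> {a..b}" "\<gamma> t \<in> chart_dom c" for c t
    using has_vector_derivative_within_subset[OF C1_curve_has_coord_velocity[OF \<gamma> _ that(1,3)] ab(2)] that ab by blast
  have zc: "continuous_on {a..b} (\<lambda>s. chart_map c (\<gamma> s))"
    unfolding continuous_on_eq_continuous_within
    using has_vector_derivative_continuous[OF vel[OF c _ dom]] by blast
  have uc: "continuous_on {a..b} (coord_velocity c I \<gamma>)"
    by (rule continuous_on_subset[where s = "{t \<in> I. \<gamma> t \<in> chart_dom c}"])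
      (use \<gamma> c dom ab in \<open>auto simp: C1_curve_def\<close>)
  obtain y where y: "y t1 = chart_coords A c (\<gamma> t1) v"
    "\<And>t. t \<in> {a..b} \<Longrightarrow> (y has_vector_derivative ?B t (y t)) (at t within {a..b})"
  proof (rule linear_ode_exists_short[OF ab(1) t1, of ?B K "chart_coords A c (\<gamma> t1) v"])
    show "continuous_on {a..b} (\<lambda>s. ?B s (y s))" if "continuous_on {a..b} y" for y
      by (intro continuous_on_minus continuous_on_Gam[OF c zc img uc that])
    show "linear (?B s)" if "s \<in> {a..b}" for s
      using bilinear_Gam[OF c, of "chart_map c (\<gamma> s)"] dom[OF that] unfolding bilinear_def
      by (auto intro!: linear_compose_neg)
    show "norm (?B s v) \<le> K * norm v" if "s \<in> {a..b}" for s v using K[OF that] by simp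
  qed (use small in auto)
  define V where "V t = chart_vector A c (\<gamma> t) (y t)" for t
  have Vy: "chart_coords A c (\<gamma> t) (V t) = y t" if "t \<in> {a..b}" for t
    using c dom[OF that] by (simp add: V_def)
  have "parallel_on I \<gamma> {a..b} V"
    unfolding parallel_on_def
  proof (intro ballI impI)
    fix d t assume d: "d \<in> A" and t: "t \<in> {a..b}" and p: "\<gamma> t \<in> chart_dom d"
    have "((\<lambda>s. chart_coords A c (\<gamma> s) (V s)) has_vector_derivative
       - Gam c (chart_map c (\<gamma> t)) (coord_velocity c I \<gamma> t) (chart_coords A c (\<gamma> t) (V t))) (at t within {a..b})"
      unfolding Vy[OF t] by (rule has_vector_derivative_transform[OF t Vy y(2)[OF t]])
    from parallel_chart_change[OF _ t c d dom[OF t] p vel[OF c t dom[OF t]] vel[OF d t p] this]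
    show "((\<lambda>s. chart_coords A d (\<gamma> s) (V s)) has_vector_derivative
       - Gam d (chart_map d (\<gamma> t)) (coord_velocity d I \<gamma> t) (chart_coords A d (\<gamma> t) (V t))) (at t within {a..b})"
      using continuous_within_subset[OF C1_curve_continuous_within[OF \<gamma>] ab(2)] t ab(2) by blast
  qed
  moreover have "V t1 = v" using y(1) c dom[OF t1] by (simp add: V_def)
  ultimately show ?thesis by (rule that)
qed

lemma parallel_along_exists:
  assumes \<gamma>: "C1_curve A {0..1} \<gamma>" and t1: "t1 \<in> {0..1}"
  obtains V where "parallel_along A nabla {0..1} \<gamma> V" "V t1 = v"
proof -
  \<comment> \<open>Solvability with any value prescribed at any time of the interval. This form
    survives concatenation: the half containing \<open>t1\<close> is solved first, and its value at
    the joint is prescribed for the other half, to the left or to the right.\<close>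
  let ?P = "\<lambda>a b. {a..b} \<subseteq> {0..1::real} \<longrightarrow>
    (\<forall>t1\<in>{a..b}. \<forall>v. \<exists>V. parallel_on {0..1} \<gamma> {a..b} V \<and> V t1 = v)"
  have "?P 0 1"
  proof (rule Bolzano[where P = ?P])
    fix a b c :: real
    assume trans: "?P a b" "?P b c" "a \<le> b" "b \<le> c"
    show "?P a c"
    proof (intro impI ballI allI)
      fix t1 v assume sub: "{a..c} \<subseteq> {0..1}" and t1: "t1 \<in> {a..c}"
      have ex: "\<exists>V. parallel_on {0..1} \<gamma> {a..b} V \<and> V s = v" if "s \<in> {a..b}" for s v
        using trans sub that by (auto simp: subset_iff)
      have ex': "\<exists>V. parallel_on {0..1} \<gamma> {b..c} V \<and> V s = v" if "s \<in> {b..c}" for s v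
        using trans sub that by (auto simp: subset_iff)
      show "\<exists>V. parallel_on {0..1} \<gamma> {a..c} V \<and> V t1 = v"
      proof (cases "t1 \<le> b")
        case True
        obtain V where V: "parallel_on {0..1} \<gamma> {a..b} V" "V t1 = v" using ex[of t1 v] True t1 by auto
        obtain W where W: "parallel_on {0..1} \<gamma> {b..c} W" "W b = V b" using ex'[of b "V b"] trans by auto
        show ?thesis
          using parallel_on_glue[OF V(1) W(1) W(2)[symmetric] trans(3,4)] V(2) True
          by (intro exI[of _ "\<lambda>t. if t \<le> b then V t else W t"] conjI) auto
      next
        case False
        obtain W where W: "parallel_on {0..1} \<gamma> {b..c} W" "W t1 = v" using ex'[of t1 v] False t1 by auto
        obtain V where V: "parallel_on {0..1} \<gamma> {a..b} V" "V b = W b" using ex[of b "W b"] trans by auto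
        show ?thesis
          using parallel_on_glue[OF V(1) W(1) V(2) trans(3,4)] W(2) False
          by (intro exI[of _ "\<lambda>t. if t \<le> b then V t else W t"] conjI) auto
      qed
    qed
  next
    fix x :: real assume "0 \<le> x" "x \<le> 1"
    then have x: "x \<in> {0..1}" by simp
    obtain c where c: "c \<in> A" "\<gamma> x \<in> chart_dom c" using chart_cover by blast
    have \<gamma>c: "continuous_on {0..1} \<gamma>" using \<gamma> by (simp add: C1_curve_def)
    obtain e where e: "e > 0" "\<And>t. \<lbrakk>t \<in> {0..1}; dist t x < e\<rbrakk> \<Longrightarrow> \<gamma> t \<in> chart_dom c"
      using eventually_in_chart_dom[OF C1_curve_continuous_within[OF \<gamma> x] c] c(2)
      unfolding eventually_at by (metis)
    let ?J = "{max 0 (x - e/2)..min 1 (x + e/2)}"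
    have J: "\<gamma> t \<in> chart_dom c" "t \<in> {0..1}" if "t \<in> ?J" for t
      using that e by (auto simp: dist_real_def)
    let ?f = "\<lambda>i s. Gam c (chart_map c (\<gamma> s)) (coord_velocity c {0..1} \<gamma> s) i"
    have f_cont: "continuous_on ?J (?f i)" for i
    proof (rule continuous_on_Gam[OF c(1)])
      show "continuous_on ?J (\<lambda>s. chart_map c (\<gamma> s))"
        using J continuous_on_subset[OF \<gamma>c, of ?J]
        by (intro continuous_on_compose2[OF homeomorphism_cont1[OF homeomorphism_chart[OF c(1)]]]) auto
      show "continuous_on ?J (coord_velocity c {0..1} \<gamma>)"
        by (rule continuous_on_subset[where s = "{t \<in> {0..1}. \<gamma> t \<in> chart_dom c}"])
          (use \<gamma> c J in \<open>auto simp: C1_curve_def\<close>)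
    qed (use J in \<open>auto intro!: continuous_intros\<close>)
    have "\<exists>B>0. \<forall>s\<in>?J. norm (?f i s) \<le> B * 1" for i
    proof -
      obtain B where "B > 0" "\<forall>y\<in>?f i ` ?J. norm y \<le> B"
        using compact_imp_bounded[OF compact_continuous_image[OF f_cont compact_Icc]]
        unfolding bounded_pos by blast
      then show ?thesis by (intro exI[of _ B]) auto
    qed
    then obtain B where B: "B > 0" "\<And>i s. \<lbrakk>i \<in> Basis; s \<in> ?J\<rbrakk> \<Longrightarrow> norm (?f i s) \<le> B * 1"
      using finite_uniform_bound[of "Basis :: 'e set" ?J "\<lambda>_. 1" "\<lambda>i s. norm (?f i s)"] by auto
    define K where "K = real DIM('e) * B"
    have K: "norm (?f v s) \<le> K * norm v" if "s \<in> ?J" for v s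
      unfolding K_def using bilinear_Gam[OF c(1), of "chart_map c (\<gamma> s)"] J[OF that] B(2)[OF _ that]
      by (intro linear_norm_le) (auto simp: bilinear_def)
    have K0: "K > 0" using B by (simp add: K_def)
    \<comment> \<open>The first bound keeps the interval in \<open>?J\<close>, where the curve stays
      in the chart and \<open>K\<close> is valid; the second makes the contraction factor at most
      1/2.\<close>
    define d where "d = min (e/2) (1 / (2 * K))"
    have "d > 0" using e K0 by (simp add: d_def)
    moreover have "?P a b" if "a \<le> x \<and> x \<le> b \<and> b - a < d" for a b
    proof (intro impI ballI allI)
      fix t1 v assume sub: "{a..b} \<subseteq> {0..1}" and t1: "t1 \<in> {a..b}"
      have abJ: "{a..b} \<subseteq> ?J" using that sub by (auto simp: d_def)
      have "K * (b - a) \<le> K * (1 / (2 * K))" using that K0 by (intro mult_left_mono) (auto simp: d_def)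
      then have small: "K * (b - a) < 1" using K0 by simp
      have ab: "a \<le> b" using that by simp
      show "\<exists>V. parallel_on {0..1} \<gamma> {a..b} V \<and> V t1 = v"
        using parallel_on_chart_exists[OF \<gamma> ab sub t1 c(1) _ _ small] J abJ K by (metis (no_types, lifting) subsetD)
    qed
    ultimately show "\<exists>d>0. \<forall>a b. a \<le> x \<and> x \<le> b \<and> b - a < d \<longrightarrow> ?P a b" by blast
  qed simp
  then show ?thesis using t1 that unfolding parallel_along_iff by blast
qed

section \<open>Uniqueness and isometry of parallel transport\<close>

lemma parallel_G_const:
  assumes \<gamma>: "C1_curve A {0..1} \<gamma>" and V: "parallel_along A nabla {0..1} \<gamma> V"
    and W: "parallel_along A nabla {0..1} \<gamma> W" and ts: "t \<in> {0..1}" "s \<in> {0..1}"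
  shows "G (\<gamma> t) (V t) (W t) = G (\<gamma> s) (V s) (W s)"
proof -
  have "((\<lambda>s. G (\<gamma> s) (V s) (W s)) has_vector_derivative 0) (at r within {0..1})" if r: "r \<in> {0..1}" for r
    using has_vector_derivative_G_parallel[OF C1_curve_continuous_within[OF \<gamma> r] r tangent_chart
        C1_curve_has_coord_velocity[OF \<gamma> r tangent_chart]
        parallel_onD[OF V[unfolded parallel_along_iff] tangent_chart(1) r tangent_chart(2)]
        parallel_onD[OF W[unfolded parallel_along_iff] tangent_chart(1) r tangent_chart(2)]] .
  then have "\<exists>k. \<forall>r\<in>{0..1}. G (\<gamma> r) (V r) (W r) = k"
    using has_derivative_zero_constant[OF convex_real_interval(5), of 0 1 "\<lambda>s. G (\<gamma> s) (V s) (W s)"]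
    unfolding has_vector_derivative_def by auto
  then show ?thesis using ts by auto
qed

text \<open>The squared norm of the difference expands into three inner products of parallel fields,
  each constant along the curve. Hence uniqueness follows from metric compatibility alone.\<close>

lemma parallel_unique:
  assumes \<gamma>: "C1_curve A {0..1} \<gamma>" and V: "parallel_along A nabla {0..1} \<gamma> V"
    and W: "parallel_along A nabla {0..1} \<gamma> W" and ts: "t \<in> {0..1}" "s \<in> {0..1}" and eq: "V s = W s"
  shows "V t = W t"
proof -
  have *: "G (\<gamma> r) (V r - W r) (V r - W r) = G (\<gamma> r) (V r) (V r) - 2 * G (\<gamma> r) (V r) (W r) + G (\<gamma> r) (W r) (W r)" for r
    using G_commute[of "\<gamma> r" "W r" "V r"] by (simp add: bilinear_lsub[OF bilinear_G] bilinear_rsub[OF bilinear_G])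
  have "G (\<gamma> t) (V t - W t) (V t - W t) = G (\<gamma> s) (V s - W s) (V s - W s)"
    unfolding * using parallel_G_const[OF \<gamma> V V ts] parallel_G_const[OF \<gamma> V W ts]
      parallel_G_const[OF \<gamma> W W ts] by simp
  also have "\<dots> = 0" using eq by (simp add: bilinear_lzero[OF bilinear_G])
  finally show ?thesis using G_pos[of "V t - W t" "\<gamma> t"] by fastforce
qed

lemma parallel_transport_eq:
  assumes \<gamma>: "C1_curve A {0..1} \<gamma>" and V: "parallel_along A nabla {0..1} \<gamma> V"
    and ts: "\<alpha> \<in> {0..1}" "\<beta> \<in> {0..1}"
  shows "parallel_transport A nabla \<gamma> \<alpha> \<beta> (V \<alpha>) = V \<beta>"
  unfolding parallel_transport_def
proof (rule the_equality)
  show "\<exists>U. parallel_along A nabla {0..1} \<gamma> U \<and> U \<alpha> = V \<alpha> \<and> U \<beta> = V \<beta>" using V by blast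
  show "w = V \<beta>" if "\<exists>U. parallel_along A nabla {0..1} \<gamma> U \<and> U \<alpha> = V \<alpha> \<and> U \<beta> = w" for w
    using that parallel_unique[OF \<gamma> _ V ts(2,1)] by blast
qed

text \<open>Both sides are values of one constant inner product of parallel fields. This form moves
  the transport from a vector onto the test field, so linearity of the transport need not be
  established separately.\<close>

lemma parallel_transport_adjoint:
  assumes \<gamma>: "C1_curve A {0..1} \<gamma>" and W: "parallel_along A nabla {0..1} \<gamma> W"
    and ts: "\<alpha> \<in> {0..1}" "\<beta> \<in> {0..1}"
  shows "G (\<gamma> \<beta>) (parallel_transport A nabla \<gamma> \<alpha> \<beta> v) (W \<beta>) = G (\<gamma> \<alpha>) v (W \<alpha>)"
proof -
  obtain V where V: "parallel_along A nabla {0..1} \<gamma> V" "V \<alpha> = v" using parallel_along_exists[OF \<gamma> ts(1)] by metis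
  show ?thesis
    using parallel_transport_eq[OF \<gamma> V(1) ts] parallel_G_const[OF \<gamma> V(1) W ts(2,1)] V(2) by simp
qed

section \<open>Geodesics and the exponential map\<close>

lemma geodesic_C1: "geodesic A nabla I \<gamma> \<Longrightarrow> C1_curve A I \<gamma>"
  by (simp add: geodesic_def)

lemma geodesic_velocity_parallel: "geodesic A nabla I \<gamma> \<Longrightarrow> parallel_along A nabla I \<gamma> (velocity A I \<gamma>)"
  by (simp add: geodesic_def)

text \<open>The equation in a fixed chart concerns the components of \<open>velocity\<close> in that
  chart, which equal \<open>coord_velocity\<close> at all times of \<open>I\<close> near
  \<open>t\<close>; agreement near \<open>t\<close> suffices for derivatives.\<close>

lemma geodesic_iff_ode:
  assumes C1: "C1_curve A I \<gamma>" and I: "\<And>t. t \<in> I \<Longrightarrow> at t within I \<noteq> bot"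
  shows "geodesic A nabla I \<gamma> \<longleftrightarrow> (\<forall>c\<in>A. \<forall>t\<in>I. \<gamma> t \<in> chart_dom c \<longrightarrow>
    (coord_velocity c I \<gamma> has_vector_derivative
      - Gam c (chart_map c (\<gamma> t)) (coord_velocity c I \<gamma> t) (coord_velocity c I \<gamma> t)) (at t within I))"
proof -
  have "((\<lambda>s. chart_coords A c (\<gamma> s) (velocity A I \<gamma> s)) has_vector_derivative D) (at t within I)
      \<longleftrightarrow> (coord_velocity c I \<gamma> has_vector_derivative D) (at t within I)"
    if c: "c \<in> A" and t: "t \<in> I" and p: "\<gamma> t \<in> chart_dom c" for c t D
  proof -
    have ev: "\<forall>\<^sub>F s in at t within I. chart_coords A c (\<gamma> s) (velocity A I \<gamma> s) = coord_velocity c I \<gamma> s"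
      using eventually_conj[OF eventually_in_chart_dom[OF C1_curve_continuous_within[OF C1 t] c p]
          at_within_eventually_mem]
      by (rule eventually_mono) (use chart_coords_velocity[OF C1 _ I c] in blast)
    then have ev': "\<forall>\<^sub>F s in at t within I. coord_velocity c I \<gamma> s = chart_coords A c (\<gamma> s) (velocity A I \<gamma> s)"
      by (rule eventually_mono) simp
    show ?thesis
      unfolding has_vector_derivative_def
      using has_derivative_transform_eventually[OF _ ev _ t] has_derivative_transform_eventually[OF _ ev' _ t]
        chart_coords_velocity[OF C1 t I[OF t] c p] by metis
  qed
  then show ?thesis
    unfolding geodesic_def parallel_along_iff parallel_on_def
    using C1 chart_coords_velocity[OF C1 _ I] by auto
qed

lemma at_within_unit: "t \<in> {0..1::real} \<Longrightarrow> at t within {0..1} \<noteq> bot"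
  by (simp add: trivial_limit_within islimpt_Icc)

lemma geodesic_ode:
  assumes "geodesic A nabla I \<gamma>" "\<And>t. t \<in> I \<Longrightarrow> at t within I \<noteq> bot"
    and "c \<in> A" "t \<in> I" "\<gamma> t \<in> chart_dom c"
  shows "(coord_velocity c I \<gamma> has_vector_derivative
      - Gam c (chart_map c (\<gamma> t)) (coord_velocity c I \<gamma> t) (coord_velocity c I \<gamma> t)) (at t within I)"
  using geodesic_iff_ode[OF geodesic_C1[OF assms(1)] assms(2)] assms by blast

section \<open>Uniqueness of geodesics\<close>

lemma Gam_quadratic_diff_le:
  assumes c: "c \<in> A" and yz: "y \<in> chart_image c" "z \<in> chart_image c"
    and B: "\<And>v w. norm (Gam c y v w) \<le> B * norm v * norm w"
    and L: "\<And>v w. norm (Gam c y v w - Gam c z v w) \<le> L * norm (y - z) * norm v * norm w"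
    and uv: "norm u \<le> U" "norm v \<le> U" and pos: "0 \<le> B" "0 \<le> L"
  shows "norm (Gam c y u u - Gam c z v v) \<le> L * U\<^sup>2 * norm (y - z) + 2 * B * U * norm (u - v)"
proof -
  note bil = bilinear_Gam[OF c yz(1)]
  have U: "0 \<le> U" using uv(1) norm_ge_zero order_trans by blast
  have "Gam c y u u - Gam c z v v
      = Gam c y (u - v) u + Gam c y v (u - v) + (Gam c y v v - Gam c z v v)"
    by (simp add: bilinear_lsub[OF bil] bilinear_rsub[OF bil])
  also have "norm \<dots> \<le> B * norm (u - v) * norm u + B * norm v * norm (u - v) + L * norm (y - z) * norm v * norm v"
    by (intro norm_triangle_le add_mono B L)
  also have "\<dots> \<le> B * norm (u - v) * U + B * U * norm (u - v) + L * norm (y - z) * U * U"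
    using uv pos U by (intro add_mono mult_mono) auto
  also have "\<dots> = L * U\<^sup>2 * norm (y - z) + 2 * B * U * norm (u - v)"
    by (simp add: power2_eq_square algebra_simps)
  finally show ?thesis .
qed

text \<open>The pair of differences of positions and velocities grows at most linearly and starts at
  0. In the growth constant, 1 stems from the position equation and the other terms from the
  acceleration, which is quadratic in the velocity and therefore Lipschitz only under a speed bound
  \<open>U\<close>.\<close>

lemma geodesic_unique_in_chart:
  assumes g: "geodesic A nabla {0..1} \<gamma>1" "geodesic A nabla {0..1} \<gamma>2"
    and ab: "{a..b} \<subseteq> {0..1}" "a \<le> b"
    and eq: "\<gamma>1 a = \<gamma>2 a" "velocity A {0..1} \<gamma>1 a = velocity A {0..1} \<gamma>2 a"
    and c: "c \<in> A" and K: "K \<subseteq> chart_image c"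
    and mem: "\<And>t. t \<in> {a..b} \<Longrightarrow> \<gamma>1 t \<in> chart_dom c" "\<And>t. t \<in> {a..b} \<Longrightarrow> \<gamma>2 t \<in> chart_dom c"
      "\<And>t. t \<in> {a..b} \<Longrightarrow> chart_map c (\<gamma>1 t) \<in> K" "\<And>t. t \<in> {a..b} \<Longrightarrow> chart_map c (\<gamma>2 t) \<in> K"
    and U: "\<And>t. t \<in> {a..b} \<Longrightarrow> norm (coord_velocity c {0..1} \<gamma>1 t) \<le> U"
      "\<And>t. t \<in> {a..b} \<Longrightarrow> norm (coord_velocity c {0..1} \<gamma>2 t) \<le> U"
    and BL: "0 \<le> B" "0 \<le> L"
      "\<And>z u w. z \<in> K \<Longrightarrow> norm (Gam c z u w) \<le> B * norm u * norm w"
      "\<And>y z u w. \<lbrakk>y \<in> K; z \<in> K\<rbrakk> \<Longrightarrow> norm (Gam c y u w - Gam c z u w) \<le> L * norm (y - z) * norm u * norm w"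
    and small: "(1 + L * U\<^sup>2 + 2 * B * U) * (b - a) < 1" and t: "t \<in> {a..b}"
  shows "\<gamma>1 t = \<gamma>2 t" "velocity A {0..1} \<gamma>1 t = velocity A {0..1} \<gamma>2 t"
proof -
  let ?u1 = "coord_velocity c {0..1} \<gamma>1" and ?u2 = "coord_velocity c {0..1} \<gamma>2"
  let ?z1 = "\<lambda>s. chart_map c (\<gamma>1 s)" and ?z2 = "\<lambda>s. chart_map c (\<gamma>2 s)"
  let ?w = "\<lambda>s. (?z1 s - ?z2 s, ?u1 s - ?u2 s)"
  let ?w' = "\<lambda>s. (?u1 s - ?u2 s, - Gam c (?z1 s) (?u1 s) (?u1 s) - - Gam c (?z2 s) (?u2 s) (?u2 s))"
  note C1 = geodesic_C1[OF g(1)] geodesic_C1[OF g(2)]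
  have U0: "0 \<le> U" using order_trans[OF norm_ge_zero U(1)[OF t]] .
  have "?w t = 0"
  proof (rule linear_growth_vanishing_short[where w = ?w and w' = ?w', OF _ _ _ small _ t])
    fix s assume s: "s \<in> {a..b}"
    then have s01: "s \<in> {0..1}" using ab by blast
    have z: "(?z1 has_vector_derivative ?u1 s) (at s within {a..b})" "(?z2 has_vector_derivative ?u2 s) (at s within {a..b})"
      using has_vector_derivative_within_subset[OF C1_curve_has_coord_velocity[OF C1(1) s01 c mem(1)[OF s]] ab(1)]
        has_vector_derivative_within_subset[OF C1_curve_has_coord_velocity[OF C1(2) s01 c mem(2)[OF s]] ab(1)] .
    have u1: "(?u1 has_vector_derivative - Gam c (?z1 s) (?u1 s) (?u1 s)) (at s within {a..b})"
      by (rule has_vector_derivative_within_subset[OF geodesic_ode[OF g(1) at_within_unit c s01 mem(1)[OF s]] ab(1)])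
    have u2: "(?u2 has_vector_derivative - Gam c (?z2 s) (?u2 s) (?u2 s)) (at s within {a..b})"
      by (rule has_vector_derivative_within_subset[OF geodesic_ode[OF g(2) at_within_unit c s01 mem(2)[OF s]] ab(1)])
    show "(?w has_vector_derivative ?w' s) (at s within {a..b})"
      by (intro has_vector_derivative_Pair has_vector_derivative_diff z u1 u2)
    have "norm (?w' s) \<le> norm (?u1 s - ?u2 s) + norm (Gam c (?z1 s) (?u1 s) (?u1 s) - Gam c (?z2 s) (?u2 s) (?u2 s))"
      using norm_Pair_le[of "?u1 s - ?u2 s" "- Gam c (?z1 s) (?u1 s) (?u1 s) - - Gam c (?z2 s) (?u2 s) (?u2 s)"]
      by (simp add: norm_minus_commute)
    also have "\<dots> \<le> norm (?u1 s - ?u2 s) + (L * U\<^sup>2 * norm (?z1 s - ?z2 s) + 2 * B * U * norm (?u1 s - ?u2 s))"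
      by (intro add_left_mono Gam_quadratic_diff_le c U s BL(1,2) BL(3)[OF mem(3)[OF s]]
          BL(4)[OF mem(3)[OF s] mem(4)[OF s]]) (use mem(3,4)[OF s] K in blast)+
    also have "\<dots> \<le> norm (?w s) + (L * U\<^sup>2 * norm (?w s) + 2 * B * U * norm (?w s))"
      using norm_fst_le[of "?z1 s - ?z2 s" "?u1 s - ?u2 s"] norm_snd_le[of "?u1 s - ?u2 s" "?z1 s - ?z2 s"] BL(1,2) U0
      by (intro add_mono mult_left_mono) auto
    also have "\<dots> = (1 + L * U\<^sup>2 + 2 * B * U) * norm (?w s)" by (simp add: algebra_simps)
    finally show "norm (?w' s) \<le> (1 + L * U\<^sup>2 + 2 * B * U) * norm (?w s)" .
  next
    have a01: "a \<in> {0..1}" "a \<in> {a..b}" using ab by auto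
    have "?u1 a = ?u2 a"
      using chart_coords_velocity[OF C1(1) a01(1) at_within_unit[OF a01(1)] c mem(1)[OF a01(2)]]
        chart_coords_velocity[OF C1(2) a01(1) at_within_unit[OF a01(1)] c mem(2)[OF a01(2)]] eq by simp
    then show "?w a = 0" using eq by (simp add: zero_prod_def)
    show "0 \<le> 1 + L * U\<^sup>2 + 2 * B * U" using BL(1,2) U0 by simp
  qed
  then have *: "?z1 t = ?z2 t" "?u1 t = ?u2 t" by (auto simp: zero_prod_def)
  show eqt: "\<gamma>1 t = \<gamma>2 t"
    using *(1) mem(1)[OF t] mem(2)[OF t] c chart_inv_chart_map by metis
  have t01: "t \<in> {0..1}" using t ab by blast
  show "velocity A {0..1} \<gamma>1 t = velocity A {0..1} \<gamma>2 t"
    using chart_vector_coord_velocity[OF C1(1) t01 at_within_unit[OF t01] c mem(1)[OF t]]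
      chart_vector_coord_velocity[OF C1(2) t01 at_within_unit[OF t01] c mem(2)[OF t]] *(2) eqt by simp
qed

lemma geodesic_bounds_near:
  assumes g: "geodesic A nabla {0..1} \<gamma>" and x: "x \<in> {0..1}" and c: "c \<in> A" "\<gamma> x \<in> chart_dom c" and r: "0 < r"
  obtains e where "e > 0" "\<And>t. \<lbrakk>t \<in> {0..1}; dist t x < e\<rbrakk> \<Longrightarrow> \<gamma> t \<in> chart_dom c \<and>
     chart_map c (\<gamma> t) \<in> cball (chart_map c (\<gamma> x)) r \<and>
     norm (coord_velocity c {0..1} \<gamma> t) \<le> norm (coord_velocity c {0..1} \<gamma> x) + 1"
proof -
  let ?u = "coord_velocity c {0..1} \<gamma>"
  note C1 = geodesic_C1[OF g]
  have "continuous (at x within {0..1}) ?u"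
    by (rule has_vector_derivative_continuous[OF geodesic_ode[OF g at_within_unit c(1) x c(2)]])
  then have "\<forall>\<^sub>F t in at x within {0..1}. dist (?u t) (?u x) < 1"
    unfolding continuous_within by (rule tendstoD) simp
  moreover have "\<forall>\<^sub>F t in at x within {0..1}. dist (chart_map c (\<gamma> t)) (chart_map c (\<gamma> x)) < r"
    using has_vector_derivative_continuous[OF C1_curve_has_coord_velocity[OF C1 x c]] r
    unfolding continuous_within by (rule tendstoD)
  moreover have "\<forall>\<^sub>F t in at x within {0..1}. \<gamma> t \<in> chart_dom c"
    by (rule eventually_in_chart_dom[OF C1_curve_continuous_within[OF C1 x] c])
  ultimately have "\<forall>\<^sub>F t in at x within {0..1}. \<gamma> t \<in> chart_dom c \<and>
     chart_map c (\<gamma> t) \<in> cball (chart_map c (\<gamma> x)) r \<and>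
     norm (?u t) \<le> norm (?u x) + 1"
  proof eventually_elim
    case (elim t)
    then show ?case
      using norm_triangle_sub[of "?u t" "?u x"]
      by (auto simp: dist_norm norm_minus_commute)
  qed
  then obtain e where e: "e > 0" "\<And>t. \<lbrakk>t \<in> {0..1}; t \<noteq> x; dist t x < e\<rbrakk> \<Longrightarrow> \<gamma> t \<in> chart_dom c \<and>
     chart_map c (\<gamma> t) \<in> cball (chart_map c (\<gamma> x)) r \<and>
     norm (?u t) \<le> norm (?u x) + 1"
    unfolding eventually_at by auto
  show ?thesis
  proof (rule that[OF e(1)])
    fix t assume t: "t \<in> {0..1}" "dist t x < e"
    show "\<gamma> t \<in> chart_dom c \<and> chart_map c (\<gamma> t) \<in> cball (chart_map c (\<gamma> x)) r \<and>
     norm (?u t) \<le> norm (?u x) + 1"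
      using e(2)[OF t(1) _ t(2)] c(2) r by (cases "t = x") auto
  qed
qed

lemma geodesic_unique:
  assumes g1: "geodesic A nabla {0..1} \<gamma>1" and g2: "geodesic A nabla {0..1} \<gamma>2"
    and eq: "\<gamma>1 0 = \<gamma>2 0" "velocity A {0..1} \<gamma>1 0 = velocity A {0..1} \<gamma>2 0" and t: "t \<in> {0..1}"
  shows "\<gamma>1 t = \<gamma>2 t"
proof -
  let ?E = "\<lambda>t. \<gamma>1 t = \<gamma>2 t \<and> velocity A {0..1} \<gamma>1 t = velocity A {0..1} \<gamma>2 t"
  \<comment> \<open>Agreement is demanded of the position and the velocity, and only propagated from
    the left end, so that the implication composes over adjacent intervals.\<close>
  let ?P = "\<lambda>a b. {a..b} \<subseteq> {0..1} \<longrightarrow> ?E a \<longrightarrow> (\<forall>t\<in>{a..b}. ?E t)"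
  have "?P 0 1"
  proof (rule Bolzano[where P = ?P])
    fix a b c :: real
    assume trans: "?P a b" "?P b c" "a \<le> b" "b \<le> c"
    show "?P a c"
    proof (intro impI ballI)
      fix t assume sub: "{a..c} \<subseteq> {0..1}" and a: "?E a" and t: "t \<in> {a..c}"
      have "{a..b} \<subseteq> {0..1}" "{b..c} \<subseteq> {0..1}" using sub trans(3,4) by auto
      then have ab: "\<forall>t\<in>{a..b}. ?E t" and bc: "?E b \<longrightarrow> (\<forall>t\<in>{b..c}. ?E t)"
        using trans(1,2) a by blast+
      have "b \<in> {a..b}" using trans(3) by simp
      then have bc': "\<forall>t\<in>{b..c}. ?E t" using ab bc by blast
      have "t \<in> {a..b} \<or> t \<in> {b..c}" using t by auto
      then show "?E t" using ab bc' by blast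
    qed
  next
    fix x :: real assume "0 \<le> x" "x \<le> 1"
    then have x: "x \<in> {0..1}" by simp
    show "\<exists>d>0. \<forall>a b. a \<le> x \<and> x \<le> b \<and> b - a < d \<longrightarrow> ?P a b"
    proof (cases "\<gamma>1 x = \<gamma>2 x")
      case False
      \<comment> \<open>Separated positions at \<open>x\<close> remain separated nearby, so on a
        short interval around \<open>x\<close> the premise of \<open>?P\<close> fails at the left
        end.\<close>
      obtain S T where ST: "open S" "open T" "\<gamma>1 x \<in> S" "\<gamma>2 x \<in> T" "S \<inter> T = {}"
        using hausdorff[OF False] by blast
      have "\<forall>\<^sub>F t in at x within {0..1}. \<gamma>1 t \<in> S" "\<forall>\<^sub>F t in at x within {0..1}. \<gamma>2 t \<in> T"
        using C1_curve_continuous_within[OF geodesic_C1[OF g1] x] C1_curve_continuous_within[OF geodesic_C1[OF g2] x] ST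
        unfolding continuous_within by (auto dest: topological_tendstoD)
      then have "\<forall>\<^sub>F t in at x within {0..1}. \<gamma>1 t \<noteq> \<gamma>2 t"
        by eventually_elim (use ST in auto)
      then obtain e where e: "e > 0" "\<And>t. \<lbrakk>t \<in> {0..1}; t \<noteq> x; dist t x < e\<rbrakk> \<Longrightarrow> \<gamma>1 t \<noteq> \<gamma>2 t"
        unfolding eventually_at by auto
      have "?P a b" if "a \<le> x \<and> x \<le> b \<and> b - a < e" for a b
      proof (intro impI ballI)
        fix t assume "{a..b} \<subseteq> {0..1}" "?E a"
        then show "?E t" using e(2)[of a] False that by (cases "a = x") (auto simp: dist_real_def)
      qed
      then show ?thesis using e(1) by blast
    next
      case True
      obtain c where c: "c \<in> A" "\<gamma>1 x \<in> chart_dom c" using chart_cover by blast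
      let ?u1 = "coord_velocity c {0..1} \<gamma>1" and ?u2 = "coord_velocity c {0..1} \<gamma>2"
      have c2: "\<gamma>2 x \<in> chart_dom c" using c True by simp
      let ?z = "chart_map c (\<gamma>1 x)"
      have "?z \<in> chart_image c" using c by blast
      then obtain r where r: "r > 0" "cball ?z r \<subseteq> chart_image c"
        using open_contains_cball open_chart_image[OF c(1)] by blast
      obtain B L where BL: "B > 0" "L > 0"
        "\<And>z u w. z \<in> cball ?z r \<Longrightarrow> norm (Gam c z u w) \<le> B * norm u * norm w"
        "\<And>y z u w. \<lbrakk>y \<in> cball ?z r; z \<in> cball ?z r\<rbrakk> \<Longrightarrow>
          norm (Gam c y u w - Gam c z u w) \<le> L * norm (y - z) * norm u * norm w"
        using Gam_bounded_lipschitz[OF c(1) compact_cball convex_cball r(2)] by metis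
      define U where "U = max (norm (?u1 x)) (norm (?u2 x)) + 1"
      have U12: "norm (?u1 x) + 1 \<le> U" "norm (?u2 x) + 1 \<le> U"
        by (auto simp: U_def)
      have U0: "U \<ge> 0" unfolding U_def by (simp add: le_max_iff_disj add_nonneg_nonneg)
      obtain e1 where e1: "e1 > 0" "\<And>t. \<lbrakk>t \<in> {0..1}; dist t x < e1\<rbrakk> \<Longrightarrow> \<gamma>1 t \<in> chart_dom c \<and>
         chart_map c (\<gamma>1 t) \<in> cball ?z r \<and>
         norm (?u1 t) \<le> norm (?u1 x) + 1"
        using geodesic_bounds_near[OF g1 x c r(1)] by blast
      obtain e2 where e2: "e2 > 0" "\<And>t. \<lbrakk>t \<in> {0..1}; dist t x < e2\<rbrakk> \<Longrightarrow> \<gamma>2 t \<in> chart_dom c \<and>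
         chart_map c (\<gamma>2 t) \<in> cball ?z r \<and>
         norm (?u2 t) \<le> norm (?u2 x) + 1"
        using geodesic_bounds_near[OF g2 x c(1) c2 r(1)] True by metis
      define M where "M = 1 + L * U\<^sup>2 + 2 * B * U"
      have M: "M > 0" unfolding M_def using BL(1,2) U0 by (simp add: add_pos_nonneg)
      define d where "d = min (min e1 e2) (1 / M)"
      have d: "d > 0" "d \<le> e1" "d \<le> e2" "d \<le> 1 / M" using e1(1) e2(1) M by (auto simp: d_def)
      have "?P a b" if ab: "a \<le> x \<and> x \<le> b \<and> b - a < d" for a b
      proof (intro impI ballI)
        fix t assume sub: "{a..b} \<subseteq> {0..1}" and E: "?E a" and t: "t \<in> {a..b}"
        have n1: "\<gamma>1 s \<in> chart_dom c" "chart_map c (\<gamma>1 s) \<in> cball ?z r"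
           "norm (?u1 s) \<le> U" if "s \<in> {a..b}" for s
        proof -
          have "s \<in> {0..1}" "dist s x < e1" using that ab sub d by (auto simp: dist_real_def)
          from e1(2)[OF this] U12(1) show "\<gamma>1 s \<in> chart_dom c" "chart_map c (\<gamma>1 s) \<in> cball ?z r"
             "norm (?u1 s) \<le> U" by (auto intro: order_trans)
        qed
        have n2: "\<gamma>2 s \<in> chart_dom c" "chart_map c (\<gamma>2 s) \<in> cball ?z r"
           "norm (?u2 s) \<le> U" if "s \<in> {a..b}" for s
        proof -
          have "s \<in> {0..1}" "dist s x < e2" using that ab sub d by (auto simp: dist_real_def)
          from e2(2)[OF this] U12(2) show "\<gamma>2 s \<in> chart_dom c" "chart_map c (\<gamma>2 s) \<in> cball ?z r"
             "norm (?u2 s) \<le> U" by (auto intro: order_trans)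
        qed
        have "M * (b - a) < M * (1 / M)" using M d ab by (intro mult_strict_left_mono) auto
        then have "(1 + L * U\<^sup>2 + 2 * B * U) * (b - a) < 1" using M by (simp add: M_def)
        from geodesic_unique_in_chart[OF g1 g2 sub _ _ _ c(1) r(2) n1(1) n2(1) n1(2) n2(2) n1(3) n2(3) _ _ BL(3,4) this t]
        show "?E t" using E BL(1,2) ab by auto
      qed
      then show ?thesis using d(1) by blast
    qed
  qed simp
  then show ?thesis using eq t by blast
qed

section \<open>The exponential map\<close>

lemma riem_exp_eq:
  assumes g: "geodesic A nabla {0..1} \<gamma>" and "\<gamma> 0 = p" "velocity A {0..1} \<gamma> 0 = v"
  shows "riem_exp A nabla p v = \<gamma> 1"
  unfolding riem_exp_def
proof (rule the_equality)
  show "\<exists>\<gamma>'. geodesic A nabla {0..1} \<gamma>' \<and> \<gamma>' 0 = p \<and> velocity A {0..1} \<gamma>' 0 = v \<and> \<gamma>' 1 = \<gamma> 1"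
    using assms by blast
  show "q = \<gamma> 1" if q: "\<exists>\<gamma>'. geodesic A nabla {0..1} \<gamma>' \<and> \<gamma>' 0 = p \<and> velocity A {0..1} \<gamma>' 0 = v \<and> \<gamma>' 1 = q" for q
  proof -
    obtain \<gamma>' where g': "geodesic A nabla {0..1} \<gamma>'" "\<gamma>' 0 = p" "velocity A {0..1} \<gamma>' 0 = v" "\<gamma>' 1 = q"
      using q by blast
    have "\<gamma>' 1 = \<gamma> 1"
      by (rule geodesic_unique[OF g'(1) g]) (use g' assms in simp_all)
    then show ?thesis using g'(4) by simp
  qed
qed

lemma geodesic_rescale:
  assumes g: "geodesic A nabla UNIV \<gamma>"
  shows "geodesic A nabla {0..1} (\<lambda>s. \<gamma> (a * s))"
    and "s \<in> {0..1} \<Longrightarrow> velocity A {0..1} (\<lambda>s. \<gamma> (a * s)) s = a *\<^sub>R velocity A UNIV \<gamma> (a * s)"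
proof -
  let ?\<gamma> = "\<lambda>s. \<gamma> (a * s)"
  note C1 = geodesic_C1[OF g]
  have comp: "((\<lambda>s. f (a * s)) has_vector_derivative a *\<^sub>R f') (at s within {0..1})"
    if "(f has_vector_derivative f') (at (a * s))" for f and f' :: 'e and s
  proof -
    have "((\<lambda>s. a * s) has_vector_derivative a) (at s within {0..1})"
      by (auto intro!: derivative_eq_intros)
    from vector_diff_chain_within[OF this has_vector_derivative_at_within[OF that]]
    show ?thesis by (simp add: o_def)
  qed
  have der: "((\<lambda>s. chart_map c (?\<gamma> s)) has_vector_derivative a *\<^sub>R coord_velocity c UNIV \<gamma> (a * s)) (at s within {0..1})"
    if "c \<in> A" "?\<gamma> s \<in> chart_dom c" for c s
    by (rule comp[OF C1_curve_has_coord_velocity[OF C1 UNIV_I that]])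
  have vel: "coord_velocity c {0..1} ?\<gamma> s = a *\<^sub>R coord_velocity c UNIV \<gamma> (a * s)"
    if "c \<in> A" "s \<in> {0..1}" "?\<gamma> s \<in> chart_dom c" for c s
    unfolding coord_velocity_def[of _ "{0..1}"]
    by (rule vector_derivative_within[OF at_within_unit[OF that(2)] der[OF that(1,3)]])
  show "velocity A {0..1} ?\<gamma> s = a *\<^sub>R velocity A UNIV \<gamma> (a * s)" if "s \<in> {0..1}" for s
    unfolding velocity_def by (rule vel[OF tangent_chart(1) that tangent_chart(2)])
  have \<gamma>: "continuous_on UNIV \<gamma>" using C1 by (simp add: C1_curve_def)
  have C1': "C1_curve A {0..1} ?\<gamma>"
    unfolding C1_curve_def
  proof (intro conjI ballI impI)
    show "continuous_on {0..1} ?\<gamma>"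
      by (intro continuous_on_compose2[OF \<gamma>] continuous_intros) auto
    show "(\<lambda>s. chart_map c (?\<gamma> s)) differentiable (at t within {0..1})"
      if "c \<in> A" "?\<gamma> t \<in> chart_dom c" for c t
      using der[OF that] by (meson differentiableI_vector)
    show "continuous_on {t \<in> {0..1}. ?\<gamma> t \<in> chart_dom c} (coord_velocity c {0..1} ?\<gamma>)" if c: "c \<in> A" for c
    proof -
      have "continuous_on {t \<in> UNIV. \<gamma> t \<in> chart_dom c} (coord_velocity c UNIV \<gamma>)"
        using C1 c unfolding C1_curve_def by blast
      then have "continuous_on {t \<in> {0..1}. ?\<gamma> t \<in> chart_dom c} (\<lambda>s. coord_velocity c UNIV \<gamma> (a * s))"
        by (rule continuous_on_compose2[OF _ continuous_on_mult_left[OF continuous_on_id]]) auto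
      then have "continuous_on {t \<in> {0..1}. ?\<gamma> t \<in> chart_dom c} (\<lambda>s. a *\<^sub>R coord_velocity c UNIV \<gamma> (a * s))"
        by (rule continuous_on_scaleR[OF continuous_on_const])
      then show ?thesis by (rule continuous_on_eq) (use vel[OF c] in auto)
    qed
  qed
  show "geodesic A nabla {0..1} ?\<gamma>"
  proof (rule geodesic_iff_ode[THEN iffD2, rule_format, OF C1' at_within_unit])
    fix c t assume c: "c \<in> A" and t: "t \<in> {0..1}" and p: "?\<gamma> t \<in> chart_dom c"
    let ?u = "coord_velocity c UNIV \<gamma>"
    have bil: "bilinear (Gam c (chart_map c (?\<gamma> t)))" using bilinear_Gam[OF c] p by blast
    have "(?u has_vector_derivative - Gam c (chart_map c (?\<gamma> t)) (?u (a * t)) (?u (a * t))) (at (a * t))"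
      by (rule geodesic_ode[OF g at_neq_bot c UNIV_I p])
    from has_derivative_scaleR_right[OF comp[OF this, unfolded has_vector_derivative_def], of a]
    have "((\<lambda>s. a *\<^sub>R ?u (a * s)) has_vector_derivative
       - Gam c (chart_map c (?\<gamma> t)) (a *\<^sub>R ?u (a * t)) (a *\<^sub>R ?u (a * t))) (at t within {0..1})"
      unfolding has_vector_derivative_def
      by (simp add: bilinear_lmul[OF bil] bilinear_rmul[OF bil] mult_ac)
    moreover have "\<forall>\<^sub>F s in at t within {0..1}. a *\<^sub>R ?u (a * s) = coord_velocity c {0..1} ?\<gamma> s"
      using eventually_conj[OF eventually_in_chart_dom[OF C1_curve_continuous_within[OF C1' t] c p]
          at_within_eventually_mem] by (rule eventually_mono) (use vel[OF c] in simp)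
    ultimately show "(coord_velocity c {0..1} ?\<gamma> has_vector_derivative
      - Gam c (chart_map c (?\<gamma> t)) (coord_velocity c {0..1} ?\<gamma> t) (coord_velocity c {0..1} ?\<gamma> t)) (at t within {0..1})"
      using has_derivative_transform_eventually[OF _ _ _ t, of "\<lambda>s. a *\<^sub>R ?u (a * s)" _ "coord_velocity c {0..1} ?\<gamma>"]
        vel[OF c t p]
      unfolding has_vector_derivative_def by simp
  qed
qed

lemma geodesic_riem_exp:
  assumes "geodesically_complete A nabla"
  obtains \<gamma> where "geodesic A nabla {0..1} \<gamma>" "\<gamma> 0 = p" "velocity A {0..1} \<gamma> 0 = v"
    "\<And>t. riem_exp A nabla p (t *\<^sub>R v) = \<gamma> t"
proof -
  obtain \<gamma> where \<gamma>: "geodesic A nabla UNIV \<gamma>" "\<gamma> 0 = p" "velocity A UNIV \<gamma> 0 = v"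
    using assms unfolding geodesically_complete_def by blast
  show ?thesis
  proof (rule that[of \<gamma>])
    show "geodesic A nabla {0..1} \<gamma>" "velocity A {0..1} \<gamma> 0 = v"
      using geodesic_rescale[OF \<gamma>(1), of 1] geodesic_rescale(2)[OF \<gamma>(1), of 0 1] \<gamma> by auto
    show "riem_exp A nabla p (t *\<^sub>R v) = \<gamma> t" for t
      using riem_exp_eq[OF geodesic_rescale(1)[OF \<gamma>(1), of t]] geodesic_rescale(2)[OF \<gamma>(1), of 0 t] \<gamma> by simp
  qed (rule \<gamma>(2))
qed

section \<open>Comparison with coordinate distances\<close>

lemma coord_velocity_le_speed:
  assumes C1: "C1_curve A I \<gamma>" and t: "t \<in> I" "at t within I \<noteq> bot" and c: "c \<in> A" "\<gamma> t \<in> chart_dom c"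
    and m: "m > 0" "\<And>v. m * (norm v)\<^sup>2 \<le> chart_metric c (chart_map c (\<gamma> t)) v v"
  shows "norm (coord_velocity c I \<gamma> t) \<le> riem_norm G (\<gamma> t) (velocity A I \<gamma> t) / sqrt m"
proof -
  have "m * (norm (coord_velocity c I \<gamma> t))\<^sup>2 \<le> (riem_norm G (\<gamma> t) (velocity A I \<gamma> t))\<^sup>2"
    using m(2)[of "coord_velocity c I \<gamma> t"] G_eq_chart_metric[OF c, of "velocity A I \<gamma> t" "velocity A I \<gamma> t"]
      chart_coords_velocity[OF C1 t c] by (simp add: riem_norm_power2)
  then have "sqrt (m * (norm (coord_velocity c I \<gamma> t))\<^sup>2) \<le> riem_norm G (\<gamma> t) (velocity A I \<gamma> t)"
    by (rule real_le_lsqrt[OF riem_norm_nonneg])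
  then show ?thesis using m(1) by (simp add: real_sqrt_mult field_simps)
qed

lemma geodesic_speed_const:
  assumes g: "geodesic A nabla {0..1} \<gamma>" and t: "t \<in> {0..1}"
  shows "riem_norm G (\<gamma> t) (velocity A {0..1} \<gamma> t) = riem_norm G (\<gamma> 0) (velocity A {0..1} \<gamma> 0)"
  unfolding riem_norm_def
  using parallel_G_const[OF geodesic_C1[OF g] geodesic_velocity_parallel[OF g] geodesic_velocity_parallel[OF g] t, of 0]
  by simp

lemma curve_displacement_le:
  assumes C1: "C1_curve A {0..1} \<gamma>" and c: "c \<in> A" and s: "s \<in> {0..1}"
    and dom: "\<And>t. t \<in> {0..s} \<Longrightarrow> \<gamma> t \<in> chart_dom c"
    and B: "\<And>t. t \<in> {0..s} \<Longrightarrow> norm (coord_velocity c {0..1} \<gamma> t) \<le> b"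
  shows "norm (chart_map c (\<gamma> s) - chart_map c (\<gamma> 0)) \<le> b * s"
proof -
  have sub: "{0..s} \<subseteq> {0..1}" using s by auto
  have "((\<lambda>t. chart_map c (\<gamma> t)) has_vector_derivative coord_velocity c {0..1} \<gamma> t) (at t within {0..s})"
    if t: "t \<in> {0..s}" for t
    using has_vector_derivative_within_subset[OF C1_curve_has_coord_velocity[OF C1 _ c dom[OF t]] sub] t sub by blast
  then have "norm (chart_map c (\<gamma> s) - chart_map c (\<gamma> 0)) \<le> b * norm (s - 0)"
    by (rule norm_diff_le_vector_derivative[OF _ B]) (use s in auto)
  then show ?thesis using s by simp
qed

text \<open>Up to the first exit time the constant Riemannian speed bounds the coordinate speed. The
  displacement is then below \<open>r / 2\<close> and the start is within \<open>r / 2\<close> of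
  the centre, so there is no exit.\<close>

lemma geodesic_stays_in_chart:
  assumes g: "geodesic A nabla {0..1} \<gamma>" and c: "c \<in> A" and K: "cball z0 r \<subseteq> chart_image c"
    and m: "m > 0" "\<And>z v. z \<in> cball z0 r \<Longrightarrow> m * (norm v)\<^sup>2 \<le> chart_metric c z v v"
    and p: "\<gamma> 0 \<in> chart_dom c" "dist z0 (chart_map c (\<gamma> 0)) < r / 2"
    and small: "riem_norm G (\<gamma> 0) (velocity A {0..1} \<gamma> 0) / sqrt m < r / 2" and t: "t \<in> {0..1}"
  shows "\<gamma> t \<in> chart_dom c" "chart_map c (\<gamma> t) \<in> ball z0 r"
proof -
  define \<rho> where "\<rho> = riem_norm G (\<gamma> 0) (velocity A {0..1} \<gamma> 0)"
  let ?O = "{q \<in> chart_dom c. chart_map c q \<in> ball z0 r}"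
  let ?C = "{q \<in> chart_dom c. chart_map c q \<in> cball z0 r}"
  note C1 = geodesic_C1[OF g]
  have \<gamma>: "continuous_on {0..1} \<gamma>" using C1 by (simp add: C1_curve_def)
  define S where "S = {0..1} \<inter> \<gamma> -` (- ?O)"
  have "closedin (top_of_set {0..1}) S"
    unfolding S_def by (rule continuous_closedin_preimage[OF \<gamma>]) (use open_chart_ball[OF c] in \<open>simp add: closed_def\<close>)
  then have S: "compact S" by (rule closedin_compact[OF compact_Icc])
  have r: "0 < r" using p(2) zero_le_dist[of z0 "chart_map c (\<gamma> 0)"] by linarith
  have "S = {}"
  proof (rule ccontr)
    assume "S \<noteq> {}"
    then obtain s where s: "s \<in> S" "\<And>t. t \<in> S \<Longrightarrow> s \<le> t" using compact_attains_inf[OF S] by blast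
    have s01: "s \<in> {0..1}" and sO: "\<gamma> s \<notin> ?O" using s(1) by (auto simp: S_def)
    have "0 \<notin> S" using p r by (auto simp: S_def)
    then have s0: "0 < s" using s01 s(1) by (cases "s = 0") auto
    have O: "\<gamma> t \<in> ?O" if "0 \<le> t" "t < s" for t
      using s(2)[of t] that s01 by (force simp: S_def)
    \<comment> \<open>At the exit time itself the curve might have left the chart domain. Since the
      closed coordinate ball is closed in the manifold, the curve is still in it at that time, and
      the displacement estimate covers this time too.\<close>
    have "closedin (top_of_set {0..1}) ({0..1} \<inter> \<gamma> -` ?C)"
      by (rule continuous_closedin_preimage[OF \<gamma> closed_chart_cball[OF c K]])
    then have "closed ({0..1} \<inter> \<gamma> -` ?C)" using closedin_closed_trans closed_atLeastAtMost by blast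
    moreover have "{0<..<s} \<subseteq> {0..1} \<inter> \<gamma> -` ?C" using O s01 by (auto intro: less_imp_le)
    ultimately have "closure {0<..<s} \<subseteq> {0..1} \<inter> \<gamma> -` ?C" by (rule closure_minimal[rotated])
    then have C: "\<gamma> t \<in> ?C" if "t \<in> {0..s}" for t using s0 that by auto
    have "norm (chart_map c (\<gamma> s) - chart_map c (\<gamma> 0)) \<le> (\<rho> / sqrt m) * s"
    proof (rule curve_displacement_le[OF C1 c s01])
      fix t assume t: "t \<in> {0..s}"
      then have t01: "t \<in> {0..1}" using s01 by auto
      show d: "\<gamma> t \<in> chart_dom c" using C[OF t] by blast
      show "norm (coord_velocity c {0..1} \<gamma> t) \<le> \<rho> / sqrt m"
        using coord_velocity_le_speed[OF C1 t01 at_within_unit[OF t01] c d m(1) m(2)] C[OF t]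
          geodesic_speed_const[OF g t01] by (simp add: \<rho>_def)
    qed
    also have "\<dots> \<le> (\<rho> / sqrt m) * 1"
      using s01 m(1) by (intro mult_left_mono) (auto simp: \<rho>_def)
    also have "\<dots> < r / 2" using small by (simp add: \<rho>_def)
    finally have "dist z0 (chart_map c (\<gamma> s)) < r"
      using p(2) dist_triangle[of z0 "chart_map c (\<gamma> s)" "chart_map c (\<gamma> 0)"]
      by (simp add: dist_norm norm_minus_commute)
    then show False using sO C[of s] s0 by auto
  qed
  then have "\<gamma> t \<in> ?O" using t by (auto simp: S_def)
  then show "\<gamma> t \<in> chart_dom c" "chart_map c (\<gamma> t) \<in> ball z0 r" by auto
qed

text \<open>The coordinate speed is at most \<open>\<rho> / sqrt m\<close>, so the acceleration
  given by the Christoffel symbols is at most \<open>B * \<rho>\<^sup>2 / m\<close>. Hence the chord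
  differs from the initial velocity only to second order in the length, which later allows the
  length of a Newton correction to be bounded by distances.\<close>

lemma geodesic_chart_estimate:
  assumes g: "geodesic A nabla {0..1} \<gamma>" and c: "c \<in> A" and K: "cball z0 r \<subseteq> chart_image c"
    and m: "m > 0" "\<And>z v. z \<in> cball z0 r \<Longrightarrow> m * (norm v)\<^sup>2 \<le> chart_metric c z v v"
    and B: "\<And>z u w. z \<in> cball z0 r \<Longrightarrow> norm (Gam c z u w) \<le> B * norm u * norm w" "B \<ge> 0"
    and p: "\<gamma> 0 \<in> chart_dom c" "dist z0 (chart_map c (\<gamma> 0)) < r / 2"
    and \<rho>: "\<rho> = riem_norm G (\<gamma> 0) (velocity A {0..1} \<gamma> 0)" and small: "\<rho> / sqrt m < r / 2"
  shows "norm (chart_map c (\<gamma> 1) - chart_map c (\<gamma> 0)) \<le> \<rho> / sqrt m"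
    "norm (chart_map c (\<gamma> 1) - chart_map c (\<gamma> 0) - chart_coords A c (\<gamma> 0) (velocity A {0..1} \<gamma> 0)) \<le> B * \<rho>\<^sup>2 / m"
proof -
  note C1 = geodesic_C1[OF g]
  let ?u = "coord_velocity c {0..1} \<gamma>"
  have \<rho>0: "\<rho> \<ge> 0" by (simp add: \<rho>)
  have dom: "\<gamma> t \<in> chart_dom c" and ball: "chart_map c (\<gamma> t) \<in> cball z0 r" if "t \<in> {0..1}" for t
    using geodesic_stays_in_chart[OF g c K m p small[unfolded \<rho>] that] by auto
  have u: "norm (?u t) \<le> \<rho> / sqrt m" if t: "t \<in> {0..1}" for t
    using coord_velocity_le_speed[OF C1 t at_within_unit[OF t] c dom[OF t] m(1) m(2)[OF ball[OF t]]]
      geodesic_speed_const[OF g t] by (simp add: \<rho>)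
  show "norm (chart_map c (\<gamma> 1) - chart_map c (\<gamma> 0)) \<le> \<rho> / sqrt m"
    using curve_displacement_le[OF C1 c, of 1 "\<rho> / sqrt m"] dom u by simp
  have b0: "0 \<le> B * \<rho>\<^sup>2 / m" using B(2) m(1) by simp
  have du: "norm (?u t - ?u 0) \<le> B * \<rho>\<^sup>2 / m" if t: "t \<in> {0..1}" for t
  proof -
    have "norm (?u t - ?u 0) \<le> (B * \<rho>\<^sup>2 / m) * norm (t - 0)"
    proof (rule norm_diff_le_vector_derivative[OF geodesic_ode[OF g at_within_unit c _ dom] _ t])
      fix s :: real assume s: "s \<in> {0..1}"
      let ?D = "- Gam c (chart_map c (\<gamma> s)) (?u s) (?u s)"
      have "norm ?D \<le> B * norm (?u s) * norm (?u s)" using B(1)[OF ball[OF s]] by simp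
      also have "\<dots> \<le> B * (\<rho> / sqrt m) * (\<rho> / sqrt m)"
        using u[OF s] B(2) \<rho>0 m(1) by (intro mult_mono mult_nonneg_nonneg) auto
      also have "\<dots> = B * \<rho>\<^sup>2 / m" using m(1) by (simp add: power2_eq_square)
      finally show "norm ?D \<le> B * \<rho>\<^sup>2 / m" .
    qed simp_all
    also have "\<dots> \<le> (B * \<rho>\<^sup>2 / m) * 1" using t b0 by (intro mult_left_mono) auto
    finally show ?thesis by simp
  qed
  \<comment> \<open>Subtracting the uniform motion with the initial velocity leaves a curve whose
    velocity is the change of velocity, already bounded.\<close>
  let ?h = "\<lambda>t. chart_map c (\<gamma> t) - t *\<^sub>R ?u 0"
  have "norm (?h 1 - ?h 0) \<le> (B * \<rho>\<^sup>2 / m) * norm (1 - 0::real)"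
  proof (rule norm_diff_le_vector_derivative[OF _ du])
    fix s :: real assume s: "s \<in> {0..1}"
    show "(?h has_vector_derivative ?u s - ?u 0) (at s within {0..1})"
      using C1_curve_has_coord_velocity[OF C1 s c dom[OF s]] by (auto intro!: derivative_eq_intros)
  qed auto
  moreover have "?u 0 = chart_coords A c (\<gamma> 0) (velocity A {0..1} \<gamma> 0)"
    using chart_coords_velocity[OF C1 _ at_within_unit c p(1)] by simp
  ultimately show "norm (chart_map c (\<gamma> 1) - chart_map c (\<gamma> 0) - chart_coords A c (\<gamma> 0) (velocity A {0..1} \<gamma> 0))
      \<le> B * \<rho>\<^sup>2 / m"
    by (simp add: algebra_simps)
qed

text \<open>The straight coordinate segment is an admissible curve; convexity keeps it in the ball,
  where the metric is bounded by \<open>C\<close>.\<close>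

lemma geodesic_dist_le_chart:
  assumes c: "c \<in> A" and K: "cball z0 r \<subseteq> chart_image c"
    and C: "\<And>z v w. z \<in> cball z0 r \<Longrightarrow> \<bar>chart_metric c z v w\<bar> \<le> C * norm v * norm w"
    and y: "y \<in> cball z0 r" "z \<in> cball z0 r"
  shows "geodesic_dist A G (chart_inv c y) (chart_inv c z) \<le> ennreal (sqrt C * norm (z - y))"
proof -
  let ?l = "\<lambda>t. y + t *\<^sub>R (z - y)"
  define \<sigma> where "\<sigma> t = chart_inv c (?l t)" for t
  have l_ball: "?l t \<in> cball z0 r" if "t \<in> {0..1}" for t
  proof -
    have "?l t = (1 - t) *\<^sub>R y + t *\<^sub>R z" by (simp add: algebra_simps)
    also have "\<dots> \<in> cball z0 r" using convexD_alt[OF convex_cball y] that by auto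
    finally show ?thesis .
  qed
  have l_img: "?l t \<in> chart_image c" if "t \<in> {0..1}" for t using l_ball[OF that] K by blast
  have l_cont: "continuous_on T ?l" for T by (intro continuous_intros)
  have \<sigma>_dom: "\<sigma> t \<in> chart_dom c" "chart_map c (\<sigma> t) = ?l t" if "t \<in> {0..1}" for t
    using l_img[OF that] c unfolding \<sigma>_def by simp_all
  have \<sigma>_cont: "continuous_on {0..1} \<sigma>"
    unfolding \<sigma>_def using l_img
    by (intro continuous_on_compose2[OF homeomorphism_cont2[OF homeomorphism_chart[OF c]] l_cont]) auto
  have der_c: "((\<lambda>s. chart_map c (\<sigma> s)) has_vector_derivative z - y) (at t within {0..1})" if t: "t \<in> {0..1}" for t
  proof (rule has_vector_derivative_transform[OF t \<sigma>_dom(2)])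
    show "(?l has_vector_derivative z - y) (at t within {0..1})" by (auto intro!: derivative_eq_intros)
  qed
  have der: "((\<lambda>s. chart_map d (\<sigma> s)) has_vector_derivative fderiv (transition c d) (?l t) (z - y)) (at t within {0..1})"
    if d: "d \<in> A" and t: "t \<in> {0..1}" and p: "\<sigma> t \<in> chart_dom d" for d t
    using has_vector_derivative_chart_change[OF _ t c d \<sigma>_dom(1)[OF t] p der_c[OF t]] \<sigma>_cont t
    by (simp add: \<sigma>_dom(2)[OF t] continuous_on_eq_continuous_within)
  have vel: "coord_velocity d {0..1} \<sigma> t = fderiv (transition c d) (?l t) (z - y)"
    if "d \<in> A" "t \<in> {0..1}" "\<sigma> t \<in> chart_dom d" for d t
    unfolding coord_velocity_def by (rule vector_derivative_within[OF at_within_unit[OF that(2)] der[OF that]])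
  have C1: "C1_curve A {0..1} \<sigma>"
    unfolding C1_curve_def
  proof (intro conjI ballI impI \<sigma>_cont)
    show "(\<lambda>s. chart_map d (\<sigma> s)) differentiable at t within {0..1}"
      if "d \<in> A" "t \<in> {0..1}" "\<sigma> t \<in> chart_dom d" for d t
      using der[OF that] by (rule differentiableI_vector)
    show "continuous_on {t \<in> {0..1}. \<sigma> t \<in> chart_dom d} (coord_velocity d {0..1} \<sigma>)" if d: "d \<in> A" for d
    proof -
      have "?l t \<in> chart_map c ` (chart_dom c \<inter> chart_dom d)" if "t \<in> {0..1}" "\<sigma> t \<in> chart_dom d" for t
        using \<sigma>_dom[OF that(1)] that(2) by (metis IntI imageI)
      then have "continuous_on {t \<in> {0..1}. \<sigma> t \<in> chart_dom d} (\<lambda>t. fderiv (transition c d) (?l t) (z - y))"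
        by (intro continuous_on_compose2[OF smooth_on_imp_C1[OF smooth_on_transition[OF c d]] l_cont]) blast
      then show ?thesis by (rule continuous_on_eq) (use vel[OF d] in auto)
    qed
  qed
  have "piecewise_C1_curve A \<sigma>"
    unfolding piecewise_C1_curve_def
    by (intro exI[of _ "{0, 1}"] conjI) (use C1 in auto)
  moreover have "\<sigma> 0 = chart_inv c y" "\<sigma> 1 = chart_inv c z" by (simp_all add: \<sigma>_def)
  ultimately have "geodesic_dist A G (chart_inv c y) (chart_inv c z) \<le> ennreal (curve_length A G \<sigma>)"
    unfolding geodesic_dist_def by (intro INF_lower) blast
  moreover have "curve_length A G \<sigma> \<le> sqrt C * norm (z - y)"
  proof -
    have le: "riem_norm G (\<sigma> t) (velocity A {0..1} \<sigma> t) \<le> sqrt C * norm (z - y)" if t: "t \<in> {0..1}" for t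
    proof -
      have v: "chart_coords A c (\<sigma> t) (velocity A {0..1} \<sigma> t) = z - y"
        unfolding chart_coords_velocity[OF C1 t at_within_unit[OF t] c \<sigma>_dom(1)[OF t]] coord_velocity_def
        by (rule vector_derivative_within[OF at_within_unit[OF t] der_c[OF t]])
      have "G (\<sigma> t) (velocity A {0..1} \<sigma> t) (velocity A {0..1} \<sigma> t) \<le> C * norm (z - y) * norm (z - y)"
        unfolding G_eq_chart_metric[OF c \<sigma>_dom(1)[OF t]] v \<sigma>_dom(2)[OF t]
        using C[OF l_ball[OF t], of "z - y" "z - y"] by linarith
      then have "riem_norm G (\<sigma> t) (velocity A {0..1} \<sigma> t) \<le> sqrt (C * norm (z - y) * norm (z - y))"
        unfolding riem_norm_def by (rule real_sqrt_le_mono)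
      then show ?thesis by (simp add: real_sqrt_mult mult.assoc)
    qed
    have nn: "0 \<le> sqrt C * norm (z - y)" using order_trans[OF riem_norm_nonneg le[of 0]] by simp
    show ?thesis
    proof (cases "(\<lambda>t. riem_norm G (\<sigma> t) (velocity A {0..1} \<sigma> t)) integrable_on {0..1}")
      case True
      have "curve_length A G \<sigma> \<le> integral {0..1::real} (\<lambda>_. sqrt C * norm (z - y))"
        unfolding curve_length_def by (intro integral_le True le) auto
      then show ?thesis by simp
    next
      \<comment> \<open>The integral of a non-integrable function is 0, so the bound holds in this
        case as well.\<close>
      case False
      then show ?thesis using nn by (simp add: curve_length_def not_integrable_integral)
    qed
  qed
  ultimately show ?thesis using ennreal_leI order_trans by blast
qed

section \<open>Lengths of piecewise continuously differentiable curves\<close>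

lemma continuous_on_speed:
  assumes C1: "C1_curve A {a..b} \<gamma>" and ab: "a < b"
  shows "continuous_on {a..b} (\<lambda>t. riem_norm G (\<gamma> t) (velocity A {a..b} \<gamma> t))"
  unfolding continuous_on_eq_continuous_within
proof
  fix x assume x: "x \<in> {a..b}"
  let ?f = "\<lambda>t. riem_norm G (\<gamma> t) (velocity A {a..b} \<gamma> t)"
  obtain c where c: "c \<in> A" "\<gamma> x \<in> chart_dom c" using chart_cover by blast
  let ?T = "{t \<in> {a..b}. \<gamma> t \<in> chart_dom c}"
  have nb: "at t within {a..b} \<noteq> bot" if "t \<in> {a..b}" for t
    using ab that by (simp add: trivial_limit_within islimpt_Icc)
  have \<gamma>: "continuous_on {a..b} \<gamma>" using C1 by (simp add: C1_curve_def)
  have "continuous_on ?T (\<lambda>t. sqrt (chart_metric c (chart_map c (\<gamma> t)) (coord_velocity c {a..b} \<gamma> t) (coord_velocity c {a..b} \<gamma> t)))"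
  proof (intro continuous_on_real_sqrt continuous_on_chart_metric c)
    show "continuous_on ?T (\<lambda>t. chart_map c (\<gamma> t))"
      by (rule continuous_on_chart_curve[OF continuous_on_subset[OF \<gamma>] c(1)]) auto
    show "continuous_on ?T (coord_velocity c {a..b} \<gamma>)" "continuous_on ?T (coord_velocity c {a..b} \<gamma>)"
      using C1 c(1) unfolding C1_curve_def by blast+
  qed auto
  then have fT: "continuous_on ?T ?f"
  proof (rule continuous_on_eq)
    fix t assume "t \<in> ?T"
    then have t: "t \<in> {a..b}" "\<gamma> t \<in> chart_dom c" by auto
    show "sqrt (chart_metric c (chart_map c (\<gamma> t)) (coord_velocity c {a..b} \<gamma> t) (coord_velocity c {a..b} \<gamma> t)) = ?f t"
      unfolding riem_norm_def G_eq_chart_metric[OF c(1) t(2)]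
        chart_coords_velocity[OF C1 t(1) nb[OF t(1)] c(1) t(2)] ..
  qed
  have "openin (top_of_set {a..b}) ({a..b} \<inter> \<gamma> -` chart_dom c)"
    by (rule continuous_openin_preimage_gen[OF \<gamma> open_chart_dom[OF c(1)]])
  then obtain W where W: "open W" "{a..b} \<inter> \<gamma> -` chart_dom c = {a..b} \<inter> W"
    unfolding openin_open by blast
  have "x \<in> W" using W(2) x c(2) by blast
  moreover have "?T = {a..b} \<inter> W" using W(2) by blast
  ultimately have "at x within {a..b} = at x within ?T"
    by (intro at_within_nhd[OF _ W(1)]) auto
  moreover have "continuous (at x within ?T) ?f"
    using fT x c by (simp add: continuous_on_eq_continuous_within)
  ultimately show "continuous (at x within {a..b}) ?f"
    unfolding continuous_within by simp
qed

text \<open>Inside the subinterval the two filters coincide. Regularity of a piecewise curve is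
  given with velocities relative to subintervals, while \<open>curve_length\<close> uses those
  relative to [0,1].\<close>

lemma coord_velocity_subinterval:
  assumes "{a..b} \<subseteq> {0..1}" "a < t" "t < b"
  shows "coord_velocity c {a..b} \<gamma> t = coord_velocity c {0..1} \<gamma> t"
    "velocity A {a..b} \<gamma> t = velocity A {0..1} \<gamma> t"
proof -
  have "0 \<le> a" "b \<le> 1" using assms by auto
  then have "at t within {a..b} = at t within {0..1}"
    using assms by (simp add: at_within_Icc_at)
  then show "coord_velocity c {a..b} \<gamma> t = coord_velocity c {0..1} \<gamma> t"
    "velocity A {a..b} \<gamma> t = velocity A {0..1} \<gamma> t"
    unfolding velocity_def coord_velocity_def by simp_all
qed

text \<open>Hides the partition: what remains is continuity, integrability of the speed, and
  regularity near every point outside a finite set.\<close>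

lemma piecewise_C1_curve_regular:
  assumes "piecewise_C1_curve A \<gamma>"
  obtains P where "finite P" "continuous_on {0..1} \<gamma>"
    "(\<lambda>t. riem_norm G (\<gamma> t) (velocity A {0..1} \<gamma> t)) integrable_on {0..1}"
    "\<And>t. t \<in> {0<..<1} - P \<Longrightarrow> \<exists>a b. 0 \<le> a \<and> a < t \<and> t < b \<and> b \<le> 1 \<and> C1_curve A {a..b} \<gamma>"
proof -
  let ?f = "\<lambda>t. riem_norm G (\<gamma> t) (velocity A {0..1} \<gamma> t)"
  obtain P where "finite P \<and> {0, 1} \<subseteq> P \<and> P \<subseteq> {0..1} \<and>
      (\<forall>a\<in>P. \<forall>b\<in>P. a < b \<and> {a<..<b} \<inter> P = {} \<longrightarrow> C1_curve A {a..b} \<gamma>)"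
    using assms unfolding piecewise_C1_curve_def by (rule exE)
  then have P: "finite P" "{0, 1} \<subseteq> P" "P \<subseteq> {0..1}"
    and C1: "\<And>a b. \<lbrakk>a \<in> P; b \<in> P; a < b; {a<..<b} \<inter> P = {}\<rbrakk> \<Longrightarrow> C1_curve A {a..b} \<gamma>"
    by simp_all
  have "continuous_on {0..1} \<gamma> \<and> ?f integrable_on {0..1}"
  proof (rule partition_induct[where P = P and lo = 0 and Q = "\<lambda>b. continuous_on {0..b} \<gamma> \<and> ?f integrable_on {0..b}"])
    show "continuous_on {0..0} \<gamma> \<and> ?f integrable_on {0..0}"
      using integrable_on_refl[of ?f "0::real"] by simp
    fix a b assume ab: "a \<in> P" "b \<in> P" "a < b" "{a<..<b} \<inter> P = {}"
      and IH: "continuous_on {0..a} \<gamma> \<and> ?f integrable_on {0..a}"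
    note c1 = C1[OF ab]
    have a0: "0 \<le> a" "b \<le> 1" using ab P by auto
    have un: "{0..b} = {0..a} \<union> {a..b}" using a0 ab by auto
    have "continuous_on {a..b} \<gamma>" using c1 by (simp add: C1_curve_def)
    then have "continuous_on {0..b} \<gamma>"
      unfolding un using IH by (intro continuous_on_closed_Un) auto
    \<comment> \<open>At the two ends the velocity relative to [0,1] may be arbitrary; finitely many
      points do not affect integrability.\<close>
    moreover have "?f integrable_on {a..b}"
    proof (rule integrable_spike_finite[of "{a, b}" _ _ "\<lambda>t. riem_norm G (\<gamma> t) (velocity A {a..b} \<gamma> t)"])
      show "(\<lambda>t. riem_norm G (\<gamma> t) (velocity A {a..b} \<gamma> t)) integrable_on {a..b}"
        using integrable_continuous[of a b] continuous_on_speed[OF c1 ab(3)] by simp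
      show "?f t = riem_norm G (\<gamma> t) (velocity A {a..b} \<gamma> t)" if "t \<in> {a..b} - {a, b}" for t
        using coord_velocity_subinterval(2)[of a b t \<gamma>] that a0 by auto
    qed simp
    ultimately show "continuous_on {0..b} \<gamma> \<and> ?f integrable_on {0..b}"
      using IH a0(1) ab(3) Henstock_Kurzweil_Integration.integrable_combine[of 0 a b ?f] by simp
  qed (use P in auto)
  moreover have "\<exists>a b. 0 \<le> a \<and> a < t \<and> t < b \<and> b \<le> 1 \<and> C1_curve A {a..b} \<gamma>" if t: "t \<in> {0<..<1} - P" for t
  proof -
    obtain a b where "a \<in> P" "b \<in> P" "a < t" "t < b" "{a<..<b} \<inter> P = {}"
      using partition_gap[OF P(1), of 0 1 t] P(2) t by auto
    then show ?thesis using C1[of a b] P(3) by (intro exI[of _ a] exI[of _ b]) auto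
  qed
  ultimately show ?thesis using that P(1) by blast
qed

lemma curve_length_ge_chart:
  assumes \<gamma>: "piecewise_C1_curve A \<gamma>" and c: "c \<in> A" and s: "s \<in> {0..1}"
    and dom: "\<And>t. t \<in> {s..1} \<Longrightarrow> \<gamma> t \<in> chart_dom c"
    and m: "m > 0" "\<And>t v. t \<in> {s..1} \<Longrightarrow> m * (norm v)\<^sup>2 \<le> chart_metric c (chart_map c (\<gamma> t)) v v"
  shows "sqrt m * norm (chart_map c (\<gamma> 1) - chart_map c (\<gamma> s)) \<le> curve_length A G \<gamma>"
proof -
  let ?f = "\<lambda>t. riem_norm G (\<gamma> t) (velocity A {0..1} \<gamma> t)"
  obtain P where P: "finite P" "continuous_on {0..1} \<gamma>" "?f integrable_on {0..1}"
    and reg: "\<And>t. t \<in> {0<..<1} - P \<Longrightarrow> \<exists>a b. 0 \<le> a \<and> a < t \<and> t < b \<and> b \<le> 1 \<and> C1_curve A {a..b} \<gamma>"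
    using piecewise_C1_curve_regular[OF \<gamma>] by blast
  let ?u = "coord_velocity c {0..1} \<gamma>"
  have sub: "{s..1} \<subseteq> {0..1}" using s by auto
  have int: "?f integrable_on {s..1}" by (rule integrable_on_subinterval[OF P(3) sub])
  have der: "((\<lambda>t. chart_map c (\<gamma> t)) has_vector_derivative ?u t) (at t)"
    and le: "norm (?u t) \<le> ?f t / sqrt m" if t: "t \<in> {s<..<1} - P" for t
  proof -
    obtain a b where ab: "0 \<le> a" "a < t" "t < b" "b \<le> 1" and C1: "C1_curve A {a..b} \<gamma>"
      using reg[of t] t s by auto
    have sub': "{a..b} \<subseteq> {0..1}" and tab: "t \<in> {a..b}" using ab by auto
    have at: "at t within {a..b} = at t" using ab by (simp add: at_within_Icc_at)
    have p: "\<gamma> t \<in> chart_dom c" using dom t by simp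
    note eq = coord_velocity_subinterval[OF sub' ab(2,3)]
    show "((\<lambda>t. chart_map c (\<gamma> t)) has_vector_derivative ?u t) (at t)"
      using C1_curve_has_coord_velocity[OF C1 tab c p] unfolding at eq .
    show "norm (?u t) \<le> ?f t / sqrt m"
      using coord_velocity_le_speed[OF C1 tab _ c p m(1) m(2)] t unfolding at eq by simp
  qed
  have "continuous_on {s..1} (\<lambda>t. chart_map c (\<gamma> t))"
    by (rule continuous_on_chart_curve[OF continuous_on_subset[OF P(2) sub] c]) (use dom in auto)
  then have "(?u has_integral (chart_map c (\<gamma> 1) - chart_map c (\<gamma> s))) {s..1}"
    using s der by (intro fundamental_theorem_of_calculus_interior_strong[OF P(1)]) auto
  \<comment> \<open>The bound by the speed may fail at breakpoints and at the ends, so the integrand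
    is set to 0 there before norms are compared.\<close>
  then have hi: "((\<lambda>t. if t \<in> P \<union> {s, 1} then 0 else ?u t) has_integral (chart_map c (\<gamma> 1) - chart_map c (\<gamma> s))) {s..1}"
    by (rule has_integral_spike_finite[of "P \<union> {s, 1}", rotated 2]) (use P(1) in auto)
  have "norm (chart_map c (\<gamma> 1) - chart_map c (\<gamma> s)) \<le> integral {s..1} (\<lambda>t. ?f t / sqrt m)"
    unfolding integral_unique[OF hi, symmetric]
  proof (rule integral_norm_bound_integral)
    show "(\<lambda>t. if t \<in> P \<union> {s, 1} then 0 else ?u t) integrable_on {s..1}" using hi by blast
    show "(\<lambda>t. ?f t / sqrt m) integrable_on {s..1}" using integrable_on_mult_left[OF int, of "1 / sqrt m"] by simp
    show "norm (if t \<in> P \<union> {s, 1} then 0 else ?u t) \<le> ?f t / sqrt m" if "t \<in> {s..1}" for t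
      using le[of t] that m(1) by auto
  qed
  also have "\<dots> = integral {s..1} ?f / sqrt m" by simp
  also have "integral {s..1} ?f \<le> integral {0..1} ?f"
    by (rule integral_subset_le[OF sub int P(3)]) simp
  then have "integral {s..1} ?f / sqrt m \<le> curve_length A G \<gamma> / sqrt m"
    unfolding curve_length_def using m(1) by (simp add: divide_right_mono)
  finally show ?thesis using m(1) by (simp add: field_simps)
qed

text \<open>Consider the last time at which a curve ending in the centre of a coordinate ball is outside the
  ball: from then on its coordinate representation is no longer than its length, up to a factor.\<close>

lemma geodesic_dist_ge_chart:
  assumes c: "c \<in> A" and q: "q \<in> chart_dom c" and r: "r > 0" and K: "cball (chart_map c q) r \<subseteq> chart_image c"
    and m: "m > 0" "\<And>z v. z \<in> cball (chart_map c q) r \<Longrightarrow> m * (norm v)\<^sup>2 \<le> chart_metric c z v v"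
  defines "O' \<equiv> {p \<in> chart_dom c. chart_map c p \<in> ball (chart_map c q) r}"
  shows "p \<in> O' \<Longrightarrow> ennreal (sqrt m * dist (chart_map c p) (chart_map c q)) \<le> geodesic_dist A G p q"
    and "p \<notin> O' \<Longrightarrow> ennreal (sqrt m * r) \<le> geodesic_dist A G p q"
proof -
  let ?C = "{p \<in> chart_dom c. chart_map c p \<in> cball (chart_map c q) r}"
  have qO: "q \<in> O'" using q r by (simp add: O'_def)
  \<comment> \<open>A curve that leaves the ball has at least the length corresponding to the
    radius; one that never leaves it starts in the ball, and the whole curve can be measured in the
    chart.\<close>
  have key: "sqrt m * r \<le> curve_length A G \<gamma> \<or>
      (p \<in> O' \<and> sqrt m * dist (chart_map c p) (chart_map c q) \<le> curve_length A G \<gamma>)"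
    if \<gamma>: "piecewise_C1_curve A \<gamma>" "\<gamma> 0 = p" "\<gamma> 1 = q" for \<gamma> p
  proof -
    have cont: "continuous_on {0..1} \<gamma>" using piecewise_C1_curve_regular[OF \<gamma>(1)] by blast
    define S where "S = {0..1} \<inter> \<gamma> -` (- O')"
    have "closedin (top_of_set {0..1}) S"
      unfolding S_def O'_def by (rule continuous_closedin_preimage[OF cont])
        (use open_chart_ball[OF c] in \<open>simp add: closed_def\<close>)
    then have S: "compact S" by (rule closedin_compact[OF compact_Icc])
    have len: "sqrt m * norm (chart_map c q - chart_map c (\<gamma> s)) \<le> curve_length A G \<gamma>"
      if "s \<in> {0..1}" "\<And>t. t \<in> {s..1} \<Longrightarrow> \<gamma> t \<in> ?C" for s
      using curve_length_ge_chart[OF \<gamma>(1) c that(1) _ m(1) m(2)] that(2) unfolding \<gamma>(3) by blast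
    show ?thesis
    proof (cases "S = {}")
      case True
      then have "\<gamma> t \<in> O'" if "t \<in> {0..1}" for t using that by (auto simp: S_def)
      then have "\<gamma> 0 \<in> O'" "\<And>t. t \<in> {0..1} \<Longrightarrow> \<gamma> t \<in> ?C" by (auto simp: O'_def intro: less_imp_le)
      then show ?thesis using len[of 0] \<gamma>(2) by (simp add: dist_norm norm_minus_commute)
    next
      case False
      then obtain s where s: "s \<in> S" "\<And>t. t \<in> S \<Longrightarrow> t \<le> s" using compact_attains_sup[OF S] by blast
      have s01: "s \<in> {0..1}" and sO: "\<gamma> s \<notin> O'" using s(1) by (auto simp: S_def)
      have s1: "s < 1" using s01 sO qO \<gamma>(3) by (cases "s = 1") auto
      have O: "\<gamma> t \<in> O'" if "s < t" "t \<le> 1" for t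
        using s(2)[of t] that s01 by (force simp: S_def)
      have "closedin (top_of_set {0..1}) ({0..1} \<inter> \<gamma> -` ?C)"
        by (rule continuous_closedin_preimage[OF cont closed_chart_cball[OF c K]])
      then have "closed ({0..1} \<inter> \<gamma> -` ?C)" using closedin_closed_trans closed_atLeastAtMost by blast
      moreover have "{s<..<1} \<subseteq> {0..1} \<inter> \<gamma> -` ?C" using O s01 by (auto simp: O'_def intro: less_imp_le)
      ultimately have "closure {s<..<1} \<subseteq> {0..1} \<inter> \<gamma> -` ?C" by (rule closure_minimal[rotated])
      then have C: "\<gamma> t \<in> ?C" if "t \<in> {s..1}" for t using s1 that by auto
      have "r \<le> dist (chart_map c q) (chart_map c (\<gamma> s))"
        using sO C[of s] s1 unfolding O'_def by auto
      then have "sqrt m * r \<le> sqrt m * norm (chart_map c q - chart_map c (\<gamma> s))"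
        using m(1) by (intro mult_left_mono) (auto simp: dist_norm)
      then show ?thesis using len[OF s01 C] by linarith
    qed
  qed
  show "ennreal (sqrt m * dist (chart_map c p) (chart_map c q)) \<le> geodesic_dist A G p q" if p: "p \<in> O'"
    unfolding geodesic_dist_def
  proof (rule INF_greatest, rule ennreal_leI)
    fix \<gamma> assume "\<gamma> \<in> {\<gamma>. piecewise_C1_curve A \<gamma> \<and> \<gamma> 0 = p \<and> \<gamma> 1 = q}"
    then have *: "sqrt m * r \<le> curve_length A G \<gamma> \<or>
      sqrt m * dist (chart_map c p) (chart_map c q) \<le> curve_length A G \<gamma>" using key by blast
    have "sqrt m * dist (chart_map c p) (chart_map c q) \<le> sqrt m * r"
      using p m(1) by (intro mult_left_mono) (auto simp: O'_def dist_commute)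
    then show "sqrt m * dist (chart_map c p) (chart_map c q) \<le> curve_length A G \<gamma>" using * by linarith
  qed
  show "ennreal (sqrt m * r) \<le> geodesic_dist A G p q" if p: "p \<notin> O'"
    unfolding geodesic_dist_def
  proof (rule INF_greatest, rule ennreal_leI)
    fix \<gamma> assume "\<gamma> \<in> {\<gamma>. piecewise_C1_curve A \<gamma> \<and> \<gamma> 0 = p \<and> \<gamma> 1 = q}"
    then show "sqrt m * r \<le> curve_length A G \<gamma>" using key p by blast
  qed
qed

section \<open>Convergence of the Newton iteration\<close>

text \<open>In the standard basis \<open>T\<close> is the Gram matrix of the inner product:
  injective by definiteness, hence surjective in finite dimension. The lemma provides the adjoint of
  \<open>M\<close> with respect to the Riemannian inner product.\<close>

lemma G_riesz:
  assumes "linear f"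
  obtains w where "\<And>v. f v = G p v w"
proof -
  define T where "T w = (\<Sum>b\<in>Basis. G p b w *\<^sub>R b)" for w :: 'e
  have T: "v \<bullet> T w = G p v w" for v w
  proof -
    have "G p v w = G p (\<Sum>b\<in>Basis. (v \<bullet> b) *\<^sub>R b) w" by (simp add: euclidean_representation)
    also have "\<dots> = (\<Sum>b\<in>Basis. (v \<bullet> b) * G p b w)"
      by (simp add: linear_sum[OF G_linear(1)] linear_scale[OF G_linear(1)])
    finally show ?thesis by (simp add: T_def inner_sum_right mult.commute)
  qed
  have lin: "linear T"
    unfolding T_def by (auto simp: linear_iff bilinear_radd[OF bilinear_G] bilinear_rmul[OF bilinear_G]
        scaleR_add_left sum.distrib scaleR_sum_right)
  have "inj T"
    unfolding linear_injective_0[OF lin]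
  proof (intro allI impI)
    fix w assume "T w = 0"
    then have "G p w w = 0" using T[of w w] by simp
    then show "w = 0" using G_pos[of w p] by fastforce
  qed
  then have "surj T" using linear_injective_imp_surjective[OF lin] by blast
  then obtain w where w: "T w = (\<Sum>b\<in>Basis. f b *\<^sub>R b)" by (metis surjD)
  show ?thesis
  proof (rule that)
    fix v
    have "f v = f (\<Sum>b\<in>Basis. (v \<bullet> b) *\<^sub>R b)" by (simp add: euclidean_representation)
    also have "\<dots> = v \<bullet> T w"
      unfolding w by (simp add: linear_sum[OF assms] linear_scale[OF assms] inner_sum_right mult.commute)
    finally show "f v = G p v w" by (simp add: T)
  qed
qed

text \<open>Instead of integrating \<open>M(y) P\<^sub>t\<^sub>,\<^sub>1 J(\<gamma>(t)) \<gamma>'(t)\<close>, the inner product of \<open>F\<close> with a parallel field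
  along the geodesic is differentiated; the field is chosen such that its value at the end point is the
  adjoint of \<open>M(y)\<close> applied to \<open>M(y) F(y)\<close>.\<close>

lemma newton_step_bound:
  assumes g: "geodesic A nabla {0..1} \<gamma>"
    and F: "\<And>p. field_differentiable_at A F p"
    and M: "linear M"
    and newton: "nabla (\<gamma> 0) (velocity A {0..1} \<gamma> 0) F = - F (\<gamma> 0)"
    and bound: "\<And>t. t \<in> {0..1} \<Longrightarrow>
      riem_norm G (\<gamma> 1) (M (parallel_transport A nabla \<gamma> t 1
          (nabla (\<gamma> t) (parallel_transport A nabla \<gamma> 0 t (velocity A {0..1} \<gamma> 0)) F)
        - parallel_transport A nabla \<gamma> 0 1 (nabla (\<gamma> 0) (velocity A {0..1} \<gamma> 0) F))) \<le> b * t"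
  shows "riem_norm G (\<gamma> 1) (M (F (\<gamma> 1))) \<le> b / 2"
proof -
  note C1 = geodesic_C1[OF g]
  define n where "n = M (F (\<gamma> 1))"
  define N where "N = riem_norm G (\<gamma> 1) n"
  have N0: "N \<ge> 0" by (simp add: N_def)
  have b0: "b \<ge> 0" using order_trans[OF riem_norm_nonneg bound[of 1]] by simp
  have "linear (\<lambda>v. G (\<gamma> 1) (M v) n)"
    using linear_compose[OF M G_linear(1)] by (simp add: o_def)
  then obtain w where w: "\<And>v. G (\<gamma> 1) (M v) n = G (\<gamma> 1) v w" using G_riesz by metis
  obtain W where W: "parallel_along A nabla {0..1} \<gamma> W" "W 1 = w"
    using parallel_along_exists[OF C1, of 1 w] by auto
  define \<phi> where "\<phi> t = G (\<gamma> t) (F (\<gamma> t)) (W t)" for t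
  define \<phi>' where "\<phi>' t = G (\<gamma> t) (nabla (\<gamma> t) (velocity A {0..1} \<gamma> t) F) (W t)" for t
  have d\<phi>: "(\<phi> has_vector_derivative \<phi>' t) (at t within {0..1})" if t: "t \<in> {0..1}" for t
    using has_vector_derivative_G_field_parallel[OF C1_curve_continuous_within[OF C1 t] t tangent_chart
        C1_curve_has_coord_velocity[OF C1 t tangent_chart] F
        parallel_onD[OF W(1)[unfolded parallel_along_iff] tangent_chart(1) t tangent_chart(2)]]
    unfolding chart_vector_coord_velocity[OF C1 t at_within_unit[OF t] tangent_chart]
    by (simp add: \<phi>_def[abs_def] \<phi>'_def)
  \<comment> \<open>Pairing with \<open>W\<close> turns the transported derivative at 0 into
    \<open>- \<phi> 0\<close> by the Newton equation. What is left is the vector bounded by the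
    hypothesis, paired with \<open>n\<close>.\<close>
  have le: "\<phi>' t \<le> b * t * N - \<phi> 0" if t: "t \<in> {0..1}" for t
  proof -
    let ?A = "parallel_transport A nabla \<gamma> t 1 (nabla (\<gamma> t) (velocity A {0..1} \<gamma> t) F)"
    let ?B = "parallel_transport A nabla \<gamma> 0 1 (nabla (\<gamma> 0) (velocity A {0..1} \<gamma> 0) F)"
    have vel: "parallel_transport A nabla \<gamma> 0 t (velocity A {0..1} \<gamma> 0) = velocity A {0..1} \<gamma> t"
      by (rule parallel_transport_eq[OF C1 geodesic_velocity_parallel[OF g] _ t]) simp
    have "\<phi>' t = G (\<gamma> 1) ?A w"
      using parallel_transport_adjoint[OF C1 W(1) t, of 1] W(2) by (simp add: \<phi>'_def)
    also have "\<dots> = G (\<gamma> 1) (M (?A - ?B)) n + G (\<gamma> 1) ?B w"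
      unfolding w by (simp add: bilinear_lsub[OF bilinear_G])
    also have "G (\<gamma> 1) ?B w = - \<phi> 0"
      using parallel_transport_adjoint[OF C1 W(1), of 0 1] W(2)
      by (simp add: newton \<phi>_def bilinear_lneg[OF bilinear_G])
    also have "G (\<gamma> 1) (M (?A - ?B)) n \<le> riem_norm G (\<gamma> 1) (M (?A - ?B)) * N"
      unfolding N_def by (rule G_Cauchy_Schwarz)
    also have "\<dots> \<le> b * t * N"
      using bound[OF t] N0 unfolding vel by (rule mult_right_mono)
    finally show ?thesis by simp
  qed
  \<comment> \<open>An antiderivative of \<open>\<phi>' t + \<phi> 0 - b * N * t\<close>, which is
    nonpositive. Comparing its values at 1 and 0 gives \<open>N\<^sup>2 \<le> b * N / 2\<close>; the
    factor 1/2 is the integral of \<open>t\<close> over [0,1].\<close>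
  let ?\<chi> = "\<lambda>t. \<phi> t + t * \<phi> 0 - b * N * t\<^sup>2 / 2"
  have "?\<chi> 1 \<le> ?\<chi> 0"
  proof (rule DERIV_nonpos_imp_decreasing_open[of 0 1 "?\<chi>"])
    show "\<exists>y. DERIV ?\<chi> t :> y \<and> y \<le> 0" if "0 < t" "t < 1" for t
    proof (intro exI conjI)
      have "DERIV \<phi> t :> \<phi>' t"
        using d\<phi>[of t] that by (simp add: at_within_Icc_at has_real_derivative_iff_has_vector_derivative)
      then show "DERIV ?\<chi> t :> \<phi>' t + \<phi> 0 - b * N * t"
        by (auto intro!: derivative_eq_intros)
      show "\<phi>' t + \<phi> 0 - b * N * t \<le> 0" using le[of t] that by (simp add: mult_ac)
    qed
    have "continuous_on {0..1} \<phi>"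
      using d\<phi> has_vector_derivative_continuous continuous_on_eq_continuous_within by blast
    then show "continuous_on {0..1} ?\<chi>" by (auto intro!: continuous_intros)
  qed simp
  moreover have "\<phi> 1 = N\<^sup>2"
    using w[of "F (\<gamma> 1)"] W(2) by (simp add: \<phi>_def N_def n_def riem_norm_power2)
  ultimately have "N * N \<le> (b / 2) * N" by (simp add: power2_eq_square)
  then have "N = 0 \<or> N \<le> b / 2" using N0 mult_right_le_imp_le by (metis order_le_less)
  then have "N \<le> b / 2" using b0 by auto
  then show ?thesis by (simp add: N_def n_def)
qed

lemma riem_norm_zero [simp]: "riem_norm G p 0 = 0"
  by simp

lemma riem_norm_minus [simp]: "riem_norm G p (- v) = riem_norm G p v"
  by (simp add: riem_norm_def bilinear_lneg[OF bilinear_G] bilinear_rneg[OF bilinear_G])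

text \<open>The vector field enters only through the decay of the update lengths. All estimates take
  place in one chart around the limit, and the geodesic distance is brought in at the start, to
  place the iterates in this chart, and at the end.\<close>

lemma exp_iteration_converges_quadratically:
  fixes x :: "nat \<Rightarrow> 'a" and V :: "nat \<Rightarrow> 'e"
  assumes complete: "geodesically_complete A nabla"
    and x: "\<And>k. x (Suc k) = riem_exp A nabla (x k) (V k)"
    and \<delta>: "\<And>k. riem_norm G (x (Suc k)) (V (Suc k)) \<le> a * (riem_norm G (x k) (V k))\<^sup>2"
    and a: "0 \<le> a" "a * riem_norm G (x 0) (V 0) < 1"
    and lim: "(\<lambda>k. geodesic_dist A G (x k) xhat) \<longlonglongrightarrow> 0"
  shows "\<exists>k\<^sub>0. \<exists>C<\<infinity>. \<forall>k\<ge>k\<^sub>0. geodesic_dist A G (x (Suc k)) xhat \<le> C * (geodesic_dist A G (x k) xhat)\<^sup>2"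
proof -
  define \<delta> where "\<delta> k = riem_norm G (x k) (V k)" for k
  have \<delta>0: "0 \<le> \<delta> k" for k by (simp add: \<delta>_def)
  have \<delta>_step: "\<delta> (Suc k) \<le> a * (\<delta> k)\<^sup>2" for k using assms(3) by (simp add: \<delta>_def)
  define q where "q = a * \<delta> 0"
  have q: "0 \<le> q" "q < 1" using a \<delta>0[of 0] by (simp_all add: q_def \<delta>_def)
  have \<delta>q: "\<And>k. \<delta> (Suc k) \<le> q * \<delta> k" and \<delta>_lim: "\<delta> \<longlonglongrightarrow> 0"
    using quadratic_decay[of \<delta> a, OF \<delta>0 \<delta>_step a(1)] a(2) by (simp_all add: q_def \<delta>_def)
  obtain c where c: "c \<in> A" "xhat \<in> chart_dom c" using chart_cover by blast
  define z0 where "z0 = chart_map c xhat"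
  have "z0 \<in> chart_image c" using c by (simp add: z0_def)
  then obtain r where r: "r > 0" "cball z0 r \<subseteq> chart_image c"
    using open_contains_cball open_chart_image[OF c(1)] by blast
  obtain m where m: "m > 0" "\<And>z v. z \<in> cball z0 r \<Longrightarrow> m * (norm v)\<^sup>2 \<le> chart_metric c z v v"
    using chart_metric_lower_bound[OF c(1) compact_cball r(2)] by blast
  obtain C where C: "C > 0" "\<And>z v w. z \<in> cball z0 r \<Longrightarrow> \<bar>chart_metric c z v w\<bar> \<le> C * norm v * norm w"
    using chart_metric_upper_bound[OF c(1) compact_cball r(2)] by blast
  obtain B where B: "B > 0" "\<And>z u w. z \<in> cball z0 r \<Longrightarrow> norm (Gam c z u w) \<le> B * norm u * norm w"
    using Gam_bounded_lipschitz[OF c(1) compact_cball convex_cball r(2)] by metis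
  define z where "z k = chart_map c (x k)" for k
  define O' where "O' = {p \<in> chart_dom c. chart_map c p \<in> ball z0 r}"
  have dist_ge: "ennreal (sqrt m * dist (chart_map c p) z0) \<le> geodesic_dist A G p xhat" if "p \<in> O'" for p
    using geodesic_dist_ge_chart(1)[OF c r(1) r(2)[unfolded z0_def] m(1) m(2)[unfolded z0_def]] that
    unfolding O'_def z0_def by blast
  have dist_ge': "ennreal (sqrt m * r) \<le> geodesic_dist A G p xhat" if "p \<notin> O'" for p
    using geodesic_dist_ge_chart(2)[OF c r(1) r(2)[unfolded z0_def] m(1) m(2)[unfolded z0_def]] that
    unfolding O'_def z0_def by blast
  \<comment> \<open>Points outside the coordinate ball have distance at least
    \<open>sqrt m * r\<close> from the limit, so small distance puts an iterate into the ball, where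
    the distance dominates the coordinate distance.\<close>
  have near: "\<forall>\<^sub>F k in sequentially. x k \<in> O' \<and> dist (z k) z0 < e" if e: "0 < e" "e \<le> r" for e
  proof -
    have "0 < ennreal (sqrt m * e)" using m(1) e by simp
    from order_tendstoD(2)[OF lim this]
    show ?thesis
    proof eventually_elim
      case (elim k)
      have "ennreal (sqrt m * e) \<le> ennreal (sqrt m * r)" using m(1) e by (intro ennreal_leI mult_left_mono) auto
      then have xO: "x k \<in> O'" using dist_ge'[of "x k"] elim by (meson leD order_trans)
      have "ennreal (sqrt m * dist (z k) z0) < ennreal (sqrt m * e)"
        unfolding z_def by (rule le_less_trans[OF dist_ge[OF xO] elim])
      then have "sqrt m * dist (z k) z0 < sqrt m * e" by (simp add: ennreal_less_iff m(1) less_imp_le)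
      then show ?case using xO m(1) by simp
    qed
  qed
  have z_lim: "z \<longlonglongrightarrow> z0"
  proof (rule tendstoI)
    fix e :: real assume "0 < e"
    then have "\<forall>\<^sub>F k in sequentially. x k \<in> O' \<and> dist (z k) z0 < min e r" using r(1) by (intro near) auto
    then show "\<forall>\<^sub>F k in sequentially. dist (z k) z0 < e" by (rule eventually_mono) simp
  qed
  \<comment> \<open>\<open>b\<close> converts Riemannian into coordinate lengths, \<open>D\<close>
    is the factor for the tail of the iteration, and \<open>E\<close> collects both quadratic errors
    in the bound of \<open>\<delta> k\<close> by the coordinate distance: the distance of the next
    iterate to the limit and the curvature of the geodesic in the chart.\<close>
  define b where "b = 1 / sqrt m"
  define D where "D = b / (1 - q)"
  define E where "E = sqrt C * (D * a + B / m)"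
  have pos: "0 < b" "0 < D" "0 \<le> E" using m(1) q C(1) B(1) a(1) by (auto simp: b_def D_def E_def)
  have "\<forall>\<^sub>F k in sequentially. \<delta> k < min (r / 2 * sqrt m) (1 / (2 * E + 1))"
    by (rule order_tendstoD(2)[OF \<delta>_lim]) (use r m(1) pos in auto)
  moreover have "\<forall>\<^sub>F k in sequentially. x k \<in> O' \<and> dist (z k) z0 < r / 2" by (rule near) (use r in auto)
  ultimately have "\<forall>\<^sub>F k in sequentially. x k \<in> O' \<and> dist (z k) z0 < r / 2 \<and> \<delta> k < r / 2 * sqrt m \<and> \<delta> k < 1 / (2 * E + 1)"
    by eventually_elim simp
  \<comment> \<open>The first bound on \<open>\<delta> k\<close> keeps the geodesic in the ball; the
    second yields \<open>E * \<delta> k \<le> 1 / 2\<close>, so that the quadratic error can be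
    absorbed. The 1 in the denominator keeps it positive knowing only
    \<open>0 \<le> E\<close>.\<close>
  then obtain N where N: "\<And>k. k \<ge> N \<Longrightarrow> x k \<in> O' \<and> dist (z k) z0 < r / 2 \<and> \<delta> k < r / 2 * sqrt m \<and> \<delta> k < 1 / (2 * E + 1)"
    unfolding eventually_sequentially by blast
  have step: "norm (z (Suc k) - z k) \<le> b * \<delta> k"
    and dev: "norm (z (Suc k) - z k - chart_coords A c (x k) (V k)) \<le> B * (\<delta> k)\<^sup>2 / m" if k: "k \<ge> N" for k
  proof -
    obtain \<gamma> where \<gamma>: "geodesic A nabla {0..1} \<gamma>" "\<gamma> 0 = x k" "velocity A {0..1} \<gamma> 0 = V k"
      "\<And>t. riem_exp A nabla (x k) (t *\<^sub>R V k) = \<gamma> t"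
      using geodesic_riem_exp[OF complete, of "x k" "V k"] by metis
    have \<gamma>1: "\<gamma> 1 = x (Suc k)" using \<gamma>(4)[of 1] x by simp
    have p: "\<gamma> 0 \<in> chart_dom c" "dist z0 (chart_map c (\<gamma> 0)) < r / 2"
      using N[OF k] \<gamma>(2) by (auto simp: O'_def z_def dist_commute)
    have d: "\<delta> k = riem_norm G (\<gamma> 0) (velocity A {0..1} \<gamma> 0)" by (simp add: \<delta>_def \<gamma>)
    have s: "\<delta> k / sqrt m < r / 2" using N[OF k] m(1) by (simp add: field_simps)
    from geodesic_chart_estimate[OF \<gamma>(1) c(1) r(2) m B(2) less_imp_le[OF B(1)] p d s]
    show "norm (z (Suc k) - z k) \<le> b * \<delta> k"
      "norm (z (Suc k) - z k - chart_coords A c (x k) (V k)) \<le> B * (\<delta> k)\<^sup>2 / m"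
      unfolding \<gamma>1 \<gamma>(2,3) z_def b_def by simp_all
  qed
  have tail: "norm (z0 - z k) \<le> D * \<delta> k" if "k \<ge> N" for k
    unfolding D_def by (rule tail_distance_le[OF z_lim step \<delta>q q less_imp_le[OF pos(1)] that])
  have tail2: "norm (z0 - z (Suc k)) \<le> D * a * (\<delta> k)\<^sup>2" if "k \<ge> N" for k
  proof -
    have "norm (z0 - z (Suc k)) \<le> D * \<delta> (Suc k)" using tail[of "Suc k"] that by simp
    also have "\<dots> \<le> D * (a * (\<delta> k)\<^sup>2)" using \<delta>_step pos by (intro mult_left_mono) auto
    finally show ?thesis by (simp add: mult.assoc)
  qed
  have \<delta>_le: "\<delta> k \<le> 2 * sqrt C * norm (z k - z0)" if k: "k \<ge> N" for k
  proof -
    let ?u = "chart_coords A c (x k) (V k)"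
    have p: "x k \<in> chart_dom c" "chart_map c (x k) \<in> cball z0 r" using N[OF k] by (auto simp: O'_def)
    have "G (x k) (V k) (V k) \<le> C * norm ?u * norm ?u"
      unfolding G_eq_chart_metric[OF c(1) p(1)] using C(2)[OF p(2), of ?u ?u] by linarith
    then have "\<delta> k \<le> sqrt (C * norm ?u * norm ?u)"
      unfolding \<delta>_def riem_norm_def by (rule real_sqrt_le_mono)
    then have 1: "\<delta> k \<le> sqrt C * norm ?u" by (simp add: real_sqrt_mult mult.assoc)
    have "norm ?u \<le> norm (z (Suc k) - z k) + norm (z (Suc k) - z k - ?u)"
      using norm_triangle_ineq4[of "z (Suc k) - z k" "z (Suc k) - z k - ?u"] by simp
    also have "norm (z (Suc k) - z k) \<le> norm (z k - z0) + norm (z0 - z (Suc k))"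
      using norm_triangle_ineq[of "z k - z0" "z0 - z (Suc k)"] by (simp add: norm_minus_commute)
    finally have "norm ?u \<le> norm (z k - z0) + D * a * (\<delta> k)\<^sup>2 + B * (\<delta> k)\<^sup>2 / m"
      using tail2[OF k] dev[OF k] by linarith
    then have "sqrt C * norm ?u \<le> sqrt C * (norm (z k - z0) + D * a * (\<delta> k)\<^sup>2 + B * (\<delta> k)\<^sup>2 / m)"
      using C(1) by (intro mult_left_mono) auto
    also have "\<dots> = sqrt C * norm (z k - z0) + (E * \<delta> k) * \<delta> k"
      by (simp add: E_def power2_eq_square algebra_simps)
    finally have 2: "\<delta> k \<le> sqrt C * norm (z k - z0) + (E * \<delta> k) * \<delta> k" using 1 by linarith
    have "\<delta> k * (2 * E + 1) < 1" using N[OF k] pos(3) by (simp add: pos_less_divide_eq)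
    then have "E * \<delta> k \<le> 1 / 2" using \<delta>0[of k] by (simp add: algebra_simps)
    then have "(E * \<delta> k) * \<delta> k \<le> (1 / 2) * \<delta> k" using \<delta>0 by (rule mult_right_mono)
    then show ?thesis using 2 by linarith
  qed
  \<comment> \<open>The outer \<open>sqrt C\<close> turns coordinate distance into a bound of the
    geodesic distance, \<open>D * a\<close> is the factor of \<open>tail2\<close>, and the square
    comes from inserting \<open>\<delta>_le\<close>. The later division by \<open>m\<close> undoes
    the lower comparison of distances, which is squared as well.\<close>
  define Q where "Q = sqrt C * (D * a * (2 * sqrt C)\<^sup>2)"
  have Q0: "0 \<le> Q" using C(1) pos a(1) by (simp add: Q_def)
  have "geodesic_dist A G (x (Suc k)) xhat \<le> ennreal (Q / m) * (geodesic_dist A G (x k) xhat)\<^sup>2" if k: "k \<ge> N" for k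
  proof -
    have xk: "x k \<in> O'" "x (Suc k) \<in> O'" using N k by auto
    have inv: "chart_inv c (z (Suc k)) = x (Suc k)" "chart_inv c z0 = xhat"
      using xk(2) c by (auto simp: z_def z0_def O'_def)
    have "z (Suc k) \<in> cball z0 r" "z0 \<in> cball z0 r" using xk(2) r(1) by (auto simp: O'_def z_def)
    from geodesic_dist_le_chart[OF c(1) r(2) C(2) this]
    have "geodesic_dist A G (x (Suc k)) xhat \<le> ennreal (sqrt C * norm (z0 - z (Suc k)))"
      unfolding inv .
    also have "\<dots> \<le> ennreal (Q / m * (sqrt m * dist (z k) z0)\<^sup>2)"
    proof (rule ennreal_leI)
      have "norm (z0 - z (Suc k)) \<le> D * a * (\<delta> k)\<^sup>2" by (rule tail2[OF k])
      also have "\<dots> \<le> D * a * (2 * sqrt C * norm (z k - z0))\<^sup>2"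
        using \<delta>_le[OF k] \<delta>0 pos a(1) by (intro mult_left_mono power_mono) auto
      finally have "sqrt C * norm (z0 - z (Suc k)) \<le> sqrt C * (D * a * (2 * sqrt C * norm (z k - z0))\<^sup>2)"
        using C(1) by (intro mult_left_mono) auto
      also have "\<dots> = Q / m * (sqrt m * dist (z k) z0)\<^sup>2"
        using m(1) by (simp add: Q_def power_mult_distrib dist_norm)
      finally show "sqrt C * norm (z0 - z (Suc k)) \<le> Q / m * (sqrt m * dist (z k) z0)\<^sup>2" .
    qed
    also have "\<dots> = ennreal (Q / m) * (ennreal (sqrt m * dist (z k) z0))\<^sup>2"
    proof -
      have "0 \<le> Q / m" "0 \<le> sqrt m * dist (z k) z0" using Q0 m(1) by simp_all
      then show ?thesis by (simp only: ennreal_mult[OF _ zero_le_power2] ennreal_power)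
    qed
    also have "\<dots> \<le> ennreal (Q / m) * (geodesic_dist A G (x k) xhat)\<^sup>2"
      using dist_ge[OF xk(1)] by (intro mult_left_mono power_mono) (auto simp: z_def)
    finally show ?thesis .
  qed
  then show ?thesis by (intro exI[of _ N] exI[of _ "ennreal (Q / m)"]) auto
qed

end

theorem corollary3p2:
  fixes A :: "('a::{t2_space, second_countable_topology}, 'e::euclidean_space) chart set"
    and G :: "('a, 'e) metric_field"
    and nabla :: "('a, 'e) connection"
    and D :: "'a set"
    and F :: "'a \<Rightarrow> 'e"
    and J M :: "'a \<Rightarrow> 'e \<Rightarrow> 'e"
    and \<Delta> :: "'a \<Rightarrow> 'e"
    and \<gamma> :: "'a \<Rightarrow> real \<Rightarrow> 'a"
    and P :: "'a \<Rightarrow> real \<Rightarrow> real \<Rightarrow> 'e \<Rightarrow> 'e"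
    and \<kappa>' :: "'a \<Rightarrow> real"
    and \<omega> \<kappa> :: real
    and x :: "nat \<Rightarrow> 'a"
    and xhat :: 'a
  assumes "riemannian_manifold A G"
    and "levi_civita_connection A G nabla"
    and "geodesically_complete A nabla"
    and "open D" and "simply_connected D"
    and "field_twice_differentiable A F"
    and "\<And>p v. J p v = nabla p v F"
    and "\<And>p. p \<in> D \<Longrightarrow> bij (J p)"
    and "\<And>p. p \<in> D \<Longrightarrow> M p = inv (J p)"
    and "\<And>p. p \<in> D \<Longrightarrow> \<Delta> p = - M p (F p)"
    and "\<And>p t. p \<in> D \<Longrightarrow> \<gamma> p t = riem_exp A nabla p (- t *\<^sub>R M p (F p))"
    and "\<And>p \<alpha> \<beta>. p \<in> D \<Longrightarrow> P p \<alpha> \<beta> = parallel_transport A nabla (\<gamma> p) \<alpha> \<beta>"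
    and "\<And>p y t. \<lbrakk>p \<in> D; y \<in> D; y = riem_exp A nabla p (\<Delta> p); t \<in> {0..1}\<rbrakk> \<Longrightarrow>
           riem_norm G y (M y (P p t 1 (J (\<gamma> p t) (P p 0 t (\<Delta> p))) - P p 0 1 (J p (\<Delta> p))))
             \<le> \<omega> * t * (riem_norm G p (\<Delta> p))\<^sup>2"
    and "\<kappa> < 1"
    and "\<And>p y. \<lbrakk>p \<in> D; y \<in> D; y = riem_exp A nabla p (\<Delta> p)\<rbrakk> \<Longrightarrow>
           riem_norm G y (M y (P p 0 1 (F p + J p (\<Delta> p)))) = \<kappa>' p * riem_norm G p (\<Delta> p) \<and>
           \<kappa>' p \<le> \<kappa>"
    and "x 0 \<in> D"
    and "\<kappa> + \<omega> / 2 * riem_norm G (x 0) (M (x 0) (F (x 0))) < 1"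
    and "\<And>k. x k \<in> D"
    and "\<And>k. x (Suc k) = riem_exp A nabla (x k) (- M (x k) (F (x k)))"
    and "(\<lambda>k. geodesic_dist A G (x k) xhat) \<longlonglongrightarrow> 0"
  shows "\<exists>k\<^sub>0. \<exists>C<\<infinity>. \<forall>k\<ge>k\<^sub>0.
           geodesic_dist A G (x (Suc k)) xhat \<le> C * (geodesic_dist A G (x k) xhat)\<^sup>2"
proof -
  interpret levi_civita_manifold A G nabla
    by unfold_locales (use assms(1,2) in \<open>auto simp: riemannian_manifold_def\<close>)
  note complete = assms(3) and F2 = assms(6) and J = assms(7) and bij = assms(8) and M = assms(9)
    and \<Delta> = assms(10) and \<gamma> = assms(11) and P = assms(12) and cond1 = assms(13) and cond2 = assms(15) and start = assms(17) and xD = assms(18) and x_Suc = assms(19)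
  have F: "field_differentiable_at A F p" for p
    using F2 unfolding field_twice_differentiable_def field_differentiable_at_def by blast
  have linJ: "linear (J p)" for p
  proof -
    have "J p = (\<lambda>v. nabla p v F)" using J by blast
    then show ?thesis
      using assms(2) F unfolding levi_civita_connection_def affine_connection_def by metis
  qed
  have linM: "linear (M p)" if "p \<in> D" for p
    unfolding M[OF that] by (rule inj_linear_imp_inv_linear[OF linJ bij_is_inj[OF bij[OF that]]])
  have J\<Delta>: "J p (\<Delta> p) = - F p" if "p \<in> D" for p
    unfolding \<Delta>[OF that] M[OF that] linear_neg[OF linJ]
    by (simp add: surj_f_inv_f[OF bij_is_surj[OF bij[OF that]]])
  have x_Suc': "x (Suc k) = riem_exp A nabla (x k) (\<Delta> (x k))" for k
    using x_Suc \<Delta>[OF xD] by simp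
  \<comment> \<open>Parallel transport in the hypotheses runs along \<open>\<gamma> (x k)\<close>,
    so this must be the geodesic itself as a function, not just have the same end point.\<close>
  have transport: "\<exists>\<sigma>. geodesic A nabla {0..1} \<sigma> \<and> \<sigma> 0 = x k \<and> velocity A {0..1} \<sigma> 0 = \<Delta> (x k)
      \<and> \<sigma> 1 = x (Suc k) \<and> \<gamma> (x k) = \<sigma>" for k
  proof -
    obtain \<sigma> where \<sigma>: "geodesic A nabla {0..1} \<sigma>" "\<sigma> 0 = x k" "velocity A {0..1} \<sigma> 0 = \<Delta> (x k)"
      "\<And>t. riem_exp A nabla (x k) (t *\<^sub>R \<Delta> (x k)) = \<sigma> t"
      using geodesic_riem_exp[OF complete, of "x k" "\<Delta> (x k)"] by metis
    have "\<gamma> (x k) t = \<sigma> t" for t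
      unfolding \<sigma>(4)[symmetric] \<gamma>[OF xD] \<Delta>[OF xD] by simp
    moreover have "\<sigma> 1 = x (Suc k)" using \<sigma>(4)[of 1] x_Suc' by simp
    ultimately show ?thesis using \<sigma> by blast
  qed
  have step: "riem_norm G (x (Suc k)) (\<Delta> (x (Suc k))) \<le> \<omega> * (riem_norm G (x k) (\<Delta> (x k)))\<^sup>2 / 2" for k
  proof -
    obtain \<sigma> where \<sigma>: "geodesic A nabla {0..1} \<sigma>" "\<sigma> 0 = x k" "velocity A {0..1} \<sigma> 0 = \<Delta> (x k)"
      "\<sigma> 1 = x (Suc k)" "\<gamma> (x k) = \<sigma>" using transport by blast
    have "riem_norm G (\<sigma> 1) (M (x (Suc k)) (F (\<sigma> 1))) \<le> \<omega> * (riem_norm G (x k) (\<Delta> (x k)))\<^sup>2 / 2"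
    proof (rule newton_step_bound[OF \<sigma>(1) F linM[OF xD]])
      show "nabla (\<sigma> 0) (velocity A {0..1} \<sigma> 0) F = - F (\<sigma> 0)"
        using J\<Delta>[OF xD] by (simp add: \<sigma>(2,3) J)
      show "riem_norm G (\<sigma> 1) (M (x (Suc k)) (parallel_transport A nabla \<sigma> t 1
          (nabla (\<sigma> t) (parallel_transport A nabla \<sigma> 0 t (velocity A {0..1} \<sigma> 0)) F)
        - parallel_transport A nabla \<sigma> 0 1 (nabla (\<sigma> 0) (velocity A {0..1} \<sigma> 0) F)))
        \<le> \<omega> * (riem_norm G (x k) (\<Delta> (x k)))\<^sup>2 * t" if "t \<in> {0..1}" for t
        using cond1[OF xD[of k] xD[of "Suc k"] x_Suc' that] unfolding P[OF xD] J \<sigma>(2-5) by (simp add: mult_ac)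
    qed
    then show ?thesis by (simp add: \<sigma>(4) \<Delta>[OF xD])
  qed
  \<comment> \<open>The sign of \<open>\<omega>\<close> is not prescribed; the absolute value makes
    the factor nonnegative.\<close>
  define a where "a = \<bar>\<omega>\<bar> / 2"
  \<comment> \<open>If the first correction is nonzero, condition (i) at \<open>t = 1\<close> forces
    \<open>0 \<le> \<omega>\<close>. Condition (ii) forces \<open>0 \<le> \<kappa>\<close>, because
    the Newton residual vanishes and hence \<open>\<kappa>' (x 0) = 0\<close>. The start condition
    then gives the claim.\<close>
  have "a * riem_norm G (x 0) (\<Delta> (x 0)) < 1"
  proof (cases "riem_norm G (x 0) (\<Delta> (x 0)) = 0")
    case False
    have "0 \<le> \<omega> * 1 * (riem_norm G (x 0) (\<Delta> (x 0)))\<^sup>2"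
      using cond1[OF xD xD x_Suc', of 1] by (rule order_trans[OF riem_norm_nonneg]) simp
    then have \<omega>: "0 \<le> \<omega>" using False by (simp add: zero_le_mult_iff)
    obtain \<sigma> where \<sigma>: "geodesic A nabla {0..1} \<sigma>" "\<sigma> 0 = x 0" "\<sigma> 1 = x (Suc 0)" "\<gamma> (x 0) = \<sigma>"
      using transport by blast
    \<comment> \<open>The zero field is parallel, so the transport of the zero residual is
      0.\<close>
    have "parallel_along A nabla {0..1} \<sigma> (\<lambda>_. 0)"
    proof -
      have "((\<lambda>s. chart_coords A c (\<sigma> s) 0) has_vector_derivative 0) (at t within {0..1})"
        if "c \<in> A" "t \<in> {0..1}" "\<sigma> t \<in> chart_dom c" for c t
      proof -
        have "((\<lambda>s. 0::'e) has_derivative (\<lambda>h. 0)) (at t within {0..1})" by simp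
        then have "((\<lambda>s. chart_coords A c (\<sigma> s) 0) has_derivative (\<lambda>h. 0)) (at t within {0..1})"
          by (rule has_derivative_transform_eventually)
            (use eventually_in_chart_dom[OF C1_curve_continuous_within[OF geodesic_C1[OF \<sigma>(1)] that(2)] that(1,3)] that
              in \<open>auto elim!: eventually_mono simp: linear_0[OF linear_chart_coords]\<close>)
        then show ?thesis by (simp add: has_vector_derivative_def)
      qed
      then show ?thesis
        unfolding parallel_along_iff parallel_on_def
        by (auto simp: linear_0[OF linear_chart_coords] bilinear_rzero[OF bilinear_Gam])
    qed
    from parallel_transport_eq[OF geodesic_C1[OF \<sigma>(1)] this, of 0 1]
    have "P (x 0) 0 1 (F (x 0) + J (x 0) (\<Delta> (x 0))) = 0"
      by (simp add: P[OF xD] \<sigma>(4) J\<Delta>[OF xD])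
    then have "\<kappa>' (x 0) * riem_norm G (x 0) (\<Delta> (x 0)) = 0" "\<kappa>' (x 0) \<le> \<kappa>"
      using cond2[OF xD xD x_Suc', of 0] linear_0[OF linM[OF xD]] by auto
    then have "0 \<le> \<kappa>" using False by simp
    then show ?thesis using start \<omega> by (simp add: a_def \<Delta>[OF xD])
  qed simp
  moreover have "riem_norm G (x (Suc k)) (\<Delta> (x (Suc k))) \<le> a * (riem_norm G (x k) (\<Delta> (x k)))\<^sup>2" for k
    using step[of k] mult_right_mono[OF abs_ge_self[of \<omega>], of "(riem_norm G (x k) (\<Delta> (x k)))\<^sup>2"]
    by (simp add: a_def)
  ultimately show ?thesis
    using exp_iteration_converges_quadratically[OF complete, of x "\<lambda>k. \<Delta> (x k)" a xhat] x_Suc' assms(20)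
    by (simp add: a_def)
qed

end
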